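(* Let $X=(X_t)_{t\in\mathbb R}$ be an RSMPR process (defined in the context) with stationary law $\mu$ and transition probabilities $\eta(dx|y,t)$. Let $v$ be the number of points of $\operatorname{supp}\mu$ ($v=\infty$ if it is infinite); all indices $n$ below range over $0\le n<v$. Then there are polynomials $h_n$, with $h_0=1$ and $\deg h_n=n$, orthonormal with respect to $\mu$, and positive constants $\alpha_n$, $1\le n<v$ (and $\alpha_0=0$), such that: (1) the sequences $(M_n(X_t,t),\mathcal F_{\le t})_{t\in\mathbb R}$, $n\ge 1$, defined by $M_n(X_t,t)=\exp(\alpha_n t)h_n(X_t)$ form a family of orthogonal martingales. (2) The operators $U^t:L_2(\mu)\to L_2(\mu)$, $t\ge0$, given by $U^0=I$ and $U^t f=\sum_{n\ge0}\exp(-\alpha_n t)c_nh_n$ for $f=\sum_{n\ge0}c_nh_n$, form a strongly continuous semigroup of transition operators of $X$, i.e. for every $f\in L_2(\mu)$ and $t\ge 0$, $(U^tf)(y)=E(f(X_t)\mid X_0=y)$. (3) The operator $A$ with domain $D_A=\{f=\sum_{n\ge0}c_nh_n\in L_2(\mu):\sum_{n\ge0}c_n^2\alpha_n^2<\infty\}$ given by $Af=-\sum_{n\ge0}\alpha_nc_nh_n$ is the infinitesimal operator (generator) of the semigroup $\{U^t\}_{t\ge0}$, and $D_A$ is its domain. Consequently RSMPR processes are completely characterized by the polynomials $\{h_n\}$ and the positive reals $\{\alpha_n\}$, i.e. these data determine the finite-dimensional distributions of the process. (4) If additionally $\eta\ll\mu$ and $\int\left(\frac{d\eta}{d\mu}\right)^2d\mu<\infty$,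 then $$\frac{d\eta}{d\mu}(x|y,t)=\sum_{n\ge0}\exp(-\alpha_nt)h_n(x)h_n(y),$$ the series being understood as an orthogonal expansion in $L_2(\mu)$ in the variable $x$ (for $t>0$ and $\mu$-almost every $y$).
   Context: Let $X=(X_t)_{t\in\mathbb R}$ be a real Markov process, $\mathcal F_{\le s}=\sigma(X_r:r\le s)$; $\mu$ is the law of $X_0$, $v\in\mathbb N\cup\{\infty\}$ is the number of points in $\operatorname{supp}\mu$. Equalities between random variables are almost sure. $X$ is an SMPR process (stationary Markov process with polynomial regression) if: (a) it is stationary: $X_t\sim\mu$ for all $t$, and the conditional law of $X_{t}$ given $X_s=y$, $s<t$, depends only on $y$ and $t-s$; it is denoted $\eta(\cdot|y,t-s)$; (b) all moments of $X_0$ are finite and $\mu$ is identifiable by its moments; (c) (totally linearly dependent, TLD) for all $0<n\le v-1$ and all distinct $s_1,\dots,s_n$ the matrix $[\operatorname{cov}(X_{s_i},X_{s_j})]$ is non-singular; (d) (mean-square continuous, MSC) for all $m,j\ge 0$ the quantity $E X_t^mX_s^j$ is a function of $|t-s|$, continuous at least at $0$; (e) for all $1\le n<v$ and $s<t$, $E(X_t^n|\mathcal F_{\le s})=Q_n(X_s,t-s)$ where $Q_n(x,\tau)=\sum_{j=0}^n\gamma_{n,j}(\tau)x^j$ is a polynomial in $x$ of degree exactly $n$; (f) for each $n<v$ the lower triangular $(n+1)\times(n+1)$ matrices $A_n(t)$ with entries $\gamma_{i,j}(t)$, $0\le j\le i\le n$, $\gamma_{0,0}=1$, are diagonalizable.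 Then $A_n(t)=V_n\Lambda_n(t)V_n^{-1}$ with $V_n$ lower triangular not depending on $t$ and $\Lambda_n(t)=\mathrm{diag}\{1,e^{-\alpha_1t},\dots,e^{-\alpha_nt}\}$. Consequently there are real numbers $\alpha_n$ ($\alpha_0=0$), called correlation indices, and monic polynomials $p_n$ with $\deg p_n=n$, $0\le n<v$, with $E(p_n(X_t)|\mathcal F_{\le s})=e^{-\alpha_n(t-s)}p_n(X_s)$ for $s<t$. The process is called regular (RSMPR) if the polynomials $p_n$ are orthogonal with respect to $\mu$.
   Formalization: Positivity of all α_n fails in general (X_t=R·Y_t, Y a ±1 telegraph process): proved are α_n≥0, α_n>0 unless h_n(X_t) is a.s. constant in t, and α_1>0 if v>2. For v<∞ the data do not fix μ (v=1: constants), so the finite-dimensional laws are determined given also supp μ. *)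

theory Defs
  imports
    "HOL-Probability.Probability"
    "HOL-Computational_Algebra.Polynomial"
    "Jordan_Normal_Form.Determinant"
begin

section \<open>Stationary law and filtration of a real process\<close>

definition stationary_law :: "'a measure \<Rightarrow> (real \<Rightarrow> 'a \<Rightarrow> real) \<Rightarrow> real measure" where
  "stationary_law M X = distr M borel (X 0)"

definition past :: "'a measure \<Rightarrow> (real \<Rightarrow> 'a \<Rightarrow> real) \<Rightarrow> real \<Rightarrow> 'a measure" where
  "past M X s = sigma (space M) (\<Union>r\<in>{..s}. {X r -` B \<inter> space M | B. B \<in> sets borel})"

definition sigma_gen :: "'a measure \<Rightarrow> ('a \<Rightarrow> real) \<Rightarrow> 'a measure" where
  "sigma_gen M Y = vimage_algebra (space M) Y borel"

definition supp :: "real measure \<Rightarrow> real set" where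
  "supp \<mu> = {x. \<forall>U. open U \<and> x \<in> U \<longrightarrow> 0 < emeasure \<mu> U}"

definition supp_size :: "real measure \<Rightarrow> enat" where
  "supp_size \<mu> = (if finite (supp \<mu>) then enat (card (supp \<mu>)) else \<infinity>)"

definition moment_determinate :: "real measure \<Rightarrow> bool" where
  "moment_determinate \<mu> \<longleftrightarrow>
     (\<forall>\<nu>. prob_space \<nu> \<and> sets \<nu> = sets borel
        \<and> (\<forall>n. integrable \<nu> (\<lambda>x. x ^ n) \<and> (\<integral>x. x ^ n \<partial>\<nu>) = (\<integral>x. x ^ n \<partial>\<mu>))
      \<longrightarrow> \<nu> = \<mu>)"

definition covariance :: "'a measure \<Rightarrow> ('a \<Rightarrow> real) \<Rightarrow> ('a \<Rightarrow> real) \<Rightarrow> real" where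
  "covariance M Y Z =
     (\<integral>\<omega>. (Y \<omega> - (\<integral>\<omega>'. Y \<omega>' \<partial>M)) * (Z \<omega> - (\<integral>\<omega>'. Z \<omega>' \<partial>M)) \<partial>M)"

definition diagonalizable_mat :: "real mat \<Rightarrow> bool" where
  "diagonalizable_mat A \<longleftrightarrow> (\<exists>D. diagonal_mat D \<and> similar_mat A D)"

section \<open>SMPR and RSMPR processes\<close>

text \<open>\<open>\<eta> y t\<close> is the conditional law of the process at time \<open>s + t\<close> given that it is at \<open>y\<close> at
  time \<open>s\<close>; only \<open>t > 0\<close> matters. In the regression assumption, \<open>poly.coeff (Q i \<tau>) j\<close> is the
  coefficient $\gamma_{i,j}(\tau)$ of $x^j$ in $Q_i(x,\tau)$.\<close>

locale smpr_process = prob_space M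
  for M :: "'a measure" +
  fixes X :: "real \<Rightarrow> 'a \<Rightarrow> real"
    and \<eta> :: "real \<Rightarrow> real \<Rightarrow> real measure"
  assumes measurable_process: "X t \<in> borel_measurable M"
    and markov:
      "\<lbrakk>s < t; B \<in> sets borel\<rbrakk> \<Longrightarrow> AE \<omega> in M.
         real_cond_exp M (past M X s) (indicator (X t -` B \<inter> space M)) \<omega>
         = real_cond_exp M (sigma_gen M (X s)) (indicator (X t -` B \<inter> space M)) \<omega>"
    and stationary: "distr M borel (X t) = stationary_law M X"
    and kernel: "0 < t \<Longrightarrow> (\<lambda>y. \<eta> y t) \<in> borel \<rightarrow>\<^sub>M prob_algebra borel"
    and transition_law:
      "\<lbrakk>s < t; B \<in> sets borel\<rbrakk> \<Longrightarrow> AE \<omega> in M.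
         real_cond_exp M (sigma_gen M (X s)) (indicator (X t -` B \<inter> space M)) \<omega>
         = Sigma_Algebra.measure (\<eta> (X s \<omega>) (t - s)) B"
    and finite_moments: "integrable M (\<lambda>\<omega>. X 0 \<omega> ^ n)"
    and determinate: "moment_determinate (stationary_law M X)"
    and TLD:
      "\<lbrakk>ts \<noteq> []; distinct ts; enat (length ts) < supp_size (stationary_law M X)\<rbrakk> \<Longrightarrow>
         Determinant.det (Matrix.mat (length ts) (length ts)
           (\<lambda>(i, j). covariance M (X (ts ! i)) (X (ts ! j)))) \<noteq> 0"
    and MSC:
      "\<exists>g. (\<forall>s t. (\<integral>\<omega>. X t \<omega> ^ m * X s \<omega> ^ j \<partial>M) = g \<bar>t - s\<bar>) \<and> (g \<longlongrightarrow> g 0) (at_right 0)"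
    and polynomial_regression:
      "\<exists>Q :: nat \<Rightarrow> real \<Rightarrow> real poly.
         (\<forall>\<tau>. Q 0 \<tau> = 1)
       \<and> (\<forall>n s t. 1 \<le> n \<and> enat n < supp_size (stationary_law M X) \<and> s < t \<longrightarrow>
            degree (Q n (t - s)) = n
          \<and> (AE \<omega> in M. real_cond_exp M (past M X s) (\<lambda>\<omega>'. X t \<omega>' ^ n) \<omega>
                         = poly (Q n (t - s)) (X s \<omega>)))
       \<and> (\<forall>n \<tau>. enat n < supp_size (stationary_law M X) \<and> 0 < \<tau> \<longrightarrow>
            diagonalizable_mat
              (Matrix.mat (n + 1) (n + 1) (\<lambda>(i, j). poly.coeff (Q i \<tau>) j)))"

definition eigen_regression ::
  "'a measure \<Rightarrow> (real \<Rightarrow> 'a \<Rightarrow> real) \<Rightarrow> (nat \<Rightarrow> real poly) \<Rightarrow> (nat \<Rightarrow> real) \<Rightarrow> bool" where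
  "eigen_regression M X p \<alpha> \<longleftrightarrow>
     \<alpha> 0 = 0
   \<and> (\<forall>n s t. enat n < supp_size (stationary_law M X) \<and> s < t \<longrightarrow>
        (AE \<omega> in M. real_cond_exp M (past M X s) (\<lambda>\<omega>'. poly (p n) (X t \<omega>')) \<omega>
                     = exp (- \<alpha> n * (t - s)) * poly (p n) (X s \<omega>)))"

text \<open>If some of the \<open>\<alpha> n\<close> coincide, the monic polynomials \<open>p n\<close> are not unique; regularity asks that
  they can be chosen orthogonal.\<close>

locale rsmpr_process = smpr_process M X \<eta>
  for M :: "'a measure" and X \<eta> +
  assumes regular:
    "\<exists>(p :: nat \<Rightarrow> real poly) \<alpha>.
       (\<forall>n. enat n < supp_size (stationary_law M X) \<longrightarrow>
          degree (p n) = n \<and> lead_coeff (p n) = 1)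
     \<and> eigen_regression M X p \<alpha>
     \<and> (\<forall>m n. enat m < supp_size (stationary_law M X) \<and> enat n < supp_size (stationary_law M X)
          \<and> m \<noteq> n \<longrightarrow> (\<integral>x. poly (p m) x * poly (p n) x \<partial>stationary_law M X) = 0)"

section \<open>The space $L_2(\mu)$\<close>

text \<open>Elements of $L_2(\mu)$ are represented by functions, equality being equality almost everywhere.\<close>

definition L2 :: "real measure \<Rightarrow> (real \<Rightarrow> real) set" where
  "L2 \<mu> = {f \<in> borel_measurable \<mu>. integrable \<mu> (\<lambda>x. (f x)\<^sup>2)}"

definition L2_norm :: "real measure \<Rightarrow> (real \<Rightarrow> real) \<Rightarrow> real" where
  "L2_norm \<mu> f = sqrt (\<integral>x. (f x)\<^sup>2 \<partial>\<mu>)"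

definition orthonormal_polys :: "real measure \<Rightarrow> (nat \<Rightarrow> real poly) \<Rightarrow> bool" where
  "orthonormal_polys \<mu> h \<longleftrightarrow>
     h 0 = 1
   \<and> (\<forall>n. enat n < supp_size \<mu> \<longrightarrow> degree (h n) = n)
   \<and> (\<forall>m n. enat m < supp_size \<mu> \<and> enat n < supp_size \<mu> \<longrightarrow>
        (\<integral>x. poly (h m) x * poly (h n) x \<partial>\<mu>) = (if m = n then 1 else 0))"

text \<open>\<open>has_expansion \<mu> h c f\<close> is $f = \sum_{0 \le n < v} c_n h_n$ with convergence in $L_2(\mu)$, where
  $v$ is the number of points of the support of $\mu$.\<close>

definition has_expansion ::
  "real measure \<Rightarrow> (nat \<Rightarrow> real poly) \<Rightarrow> (nat \<Rightarrow> real) \<Rightarrow> (real \<Rightarrow> real) \<Rightarrow> bool" where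
  "has_expansion \<mu> h c f \<longleftrightarrow>
     f \<in> L2 \<mu>
   \<and> (\<lambda>N. L2_norm \<mu> (\<lambda>x. f x - (\<Sum>n | n < N \<and> enat n < supp_size \<mu>. c n * poly (h n) x)))
       \<longlonglongrightarrow> 0"

definition bounded_L2_operator ::
  "real measure \<Rightarrow> ((real \<Rightarrow> real) \<Rightarrow> real \<Rightarrow> real) \<Rightarrow> bool" where
  "bounded_L2_operator \<mu> T \<longleftrightarrow>
     (\<forall>f\<in>L2 \<mu>. T f \<in> L2 \<mu>)
   \<and> (\<forall>f\<in>L2 \<mu>. \<forall>g\<in>L2 \<mu>. (AE x in \<mu>. f x = g x) \<longrightarrow> (AE x in \<mu>. T f x = T g x))
   \<and> (\<forall>f\<in>L2 \<mu>. \<forall>g\<in>L2 \<mu>. \<forall>a b.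
        AE x in \<mu>. T (\<lambda>x'. a * f x' + b * g x') x = a * T f x + b * T g x)
   \<and> (\<exists>K. \<forall>f\<in>L2 \<mu>. L2_norm \<mu> (T f) \<le> K * L2_norm \<mu> f)"

definition strongly_continuous_semigroup ::
  "real measure \<Rightarrow> (real \<Rightarrow> (real \<Rightarrow> real) \<Rightarrow> real \<Rightarrow> real) \<Rightarrow> bool" where
  "strongly_continuous_semigroup \<mu> U \<longleftrightarrow>
     (\<forall>t\<ge>0. bounded_L2_operator \<mu> (U t))
   \<and> (\<forall>f\<in>L2 \<mu>. AE x in \<mu>. U 0 f x = f x)
   \<and> (\<forall>s\<ge>0. \<forall>t\<ge>0. \<forall>f\<in>L2 \<mu>. AE x in \<mu>. U (s + t) f x = U s (U t f) x)
   \<and> (\<forall>f\<in>L2 \<mu>. ((\<lambda>t. L2_norm \<mu> (\<lambda>x. U t f x - f x)) \<longlongrightarrow> 0) (at_right 0))"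

definition derivative_at_0 ::
  "real measure \<Rightarrow> (real \<Rightarrow> (real \<Rightarrow> real) \<Rightarrow> real \<Rightarrow> real) \<Rightarrow> (real \<Rightarrow> real) \<Rightarrow> (real \<Rightarrow> real) \<Rightarrow> bool"
where
  "derivative_at_0 \<mu> U f g \<longleftrightarrow>
     g \<in> L2 \<mu> \<and> ((\<lambda>t. L2_norm \<mu> (\<lambda>x. (U t f x - f x) / t - g x)) \<longlongrightarrow> 0) (at_right 0)"

definition is_generator ::
  "real measure \<Rightarrow> (real \<Rightarrow> (real \<Rightarrow> real) \<Rightarrow> real \<Rightarrow> real) \<Rightarrow> (real \<Rightarrow> real) set
     \<Rightarrow> ((real \<Rightarrow> real) \<Rightarrow> real \<Rightarrow> real) \<Rightarrow> bool" where
  "is_generator \<mu> U D A \<longleftrightarrow>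
     D = {f \<in> L2 \<mu>. \<exists>g. derivative_at_0 \<mu> U f g} \<and> (\<forall>f\<in>D. derivative_at_0 \<mu> U f (A f))"

definition spectral_domain ::
  "real measure \<Rightarrow> (nat \<Rightarrow> real poly) \<Rightarrow> (nat \<Rightarrow> real) \<Rightarrow> (real \<Rightarrow> real) set" where
  "spectral_domain \<mu> h \<alpha> =
     {f \<in> L2 \<mu>. \<exists>c. has_expansion \<mu> h c f
        \<and> (\<lambda>n. (c n)\<^sup>2 * (\<alpha> n)\<^sup>2) summable_on {n. enat n < supp_size \<mu>}}"

section \<open>Martingales, conditional expectations, finite-dimensional distributions\<close>

definition martingale ::
  "'a measure \<Rightarrow> (real \<Rightarrow> 'a measure) \<Rightarrow> (real \<Rightarrow> 'a \<Rightarrow> real) \<Rightarrow> bool" where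
  "martingale M F Z \<longleftrightarrow>
     filtration (space M) F
   \<and> (\<forall>t. subalgebra M (F t) \<and> Z t \<in> borel_measurable (F t) \<and> integrable M (Z t))
   \<and> (\<forall>s t. s \<le> t \<longrightarrow> (AE \<omega> in M. real_cond_exp M (F s) (Z t) \<omega> = Z s \<omega>))"

text \<open>\<open>g\<close> is a version of $y \mapsto E(Z \mid Y = y)$.\<close>

definition cond_exp_given ::
  "'a measure \<Rightarrow> ('a \<Rightarrow> real) \<Rightarrow> ('a \<Rightarrow> real) \<Rightarrow> (real \<Rightarrow> real) \<Rightarrow> bool" where
  "cond_exp_given M Z Y g \<longleftrightarrow>
     integrable M Z \<and> g \<in> borel_measurable borel
   \<and> (AE \<omega> in M. real_cond_exp M (sigma_gen M Y) Z \<omega> = g (Y \<omega>))"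

definition fdd :: "'a measure \<Rightarrow> (real \<Rightarrow> 'a \<Rightarrow> real) \<Rightarrow> real set \<Rightarrow> (real \<Rightarrow> real) measure" where
  "fdd M X J = distr M (PiM J (\<lambda>_. borel)) (\<lambda>\<omega>. \<lambda>t\<in>J. X t \<omega>)"

definition spectral_data ::
  "'a measure \<Rightarrow> (real \<Rightarrow> 'a \<Rightarrow> real) \<Rightarrow> (nat \<Rightarrow> real poly) \<Rightarrow> (nat \<Rightarrow> real) \<Rightarrow> bool" where
  "spectral_data M X h \<alpha> \<longleftrightarrow>
     orthonormal_polys (stationary_law M X) h \<and> eigen_regression M X h \<alpha>"

end

theory Submission
  imports
    Defs
    "HOL-Computational_Algebra.Fundamental_Theorem_Algebra"
    "HOL-Real_Asymp.Real_Asymp"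
begin

text \<open>Determinacy makes the polynomials dense in $L_2(\mu)$ (M. Riesz): for continuous \<open>\<phi>\<close> of polynomial growth,
  the infimum of $\int q \, d\mu$ over the polynomials \<open>q \<ge> \<phi>\<close> equals $\int \phi \, d\mu$, since otherwise the
  Hahn--Banach theorem gives a positive functional, and hence a measure, that has the moments of \<open>\<mu>\<close> but integrates
  \<open>\<phi>\<close> differently. For \<open>\<phi> = 1/\<bar>x - z\<bar>\<^sup>2\<close> this yields polynomial approximations of the imaginary part of
  \<open>1/(x - z)\<close> in $L_2(\mu)$, and a function orthogonal to all of these vanishes.

  So the $h_n$ are an orthonormal basis. Conditional Jensen makes the transition operators contractions; being
  diagonal on the basis they are determined by the \<open>\<alpha> n\<close>, which are nonnegative for the same reason. Semigroup,
  generator and transition densities are then read off the coefficients, and the Markov property reduces the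
  finite-dimensional distributions to \<open>\<mu>\<close> and the transition operators.\<close>

section \<open>A Hahn--Banach theorem for spaces of functions\<close>

text \<open>Supports may be unbounded, so Stone--Weierstrass gives no density, and determinacy
  speaks of measures whereas a basis of L2 is wanted. The bridge turns one-sided approximation in
  the mean into two-sided approximation in L2: a polynomial \<open>q\<close> above
  \<open>1/m\<close> leaves a nonnegative polynomial \<open>m * q - 1\<close>, and such a polynomial
  is a squared modulus. The Hahn--Banach functional is only finitely additive. It is built on all
  functions of polynomial growth, so that indicators of half-lines give it a distribution function,
  while polynomials of higher degree control the tails.

  The indices are in general only nonnegative. Let \<open>R > 0\<close> be bounded and non-constant,
  independent of a stationary symmetric Markov chain with states 1 and -1. Their product satisfies
  all assumptions, its square does not move, and the second index vanishes. Strict positivity is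
  therefore tied to \<open>h n\<close> moving in time; for the first index, non-singular covariance
  matrices ensure this when the support has more than two points.\<close>

definition function_space :: "('b \<Rightarrow> real) set \<Rightarrow> bool" where
  "function_space V \<longleftrightarrow> (\<lambda>x. 0) \<in> V \<and> (\<forall>f\<in>V. \<forall>g\<in>V. (\<lambda>x. f x + g x) \<in> V)
     \<and> (\<forall>c. \<forall>f\<in>V. (\<lambda>x. c * f x) \<in> V)"

lemma function_spaceD:
  assumes "function_space V"
  shows "(\<lambda>x. 0) \<in> V" "f \<in> V \<Longrightarrow> g \<in> V \<Longrightarrow> (\<lambda>x. f x + g x) \<in> V" "f \<in> V \<Longrightarrow> (\<lambda>x. c * f x) \<in> V"
    "f \<in> V \<Longrightarrow> (\<lambda>x. - f x) \<in> V" "f \<in> V \<Longrightarrow> g \<in> V \<Longrightarrow> (\<lambda>x. f x - g x) \<in> V"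
proof -
  show *: "(\<lambda>x. 0) \<in> V" "\<And>f g. f \<in> V \<Longrightarrow> g \<in> V \<Longrightarrow> (\<lambda>x. f x + g x) \<in> V"
     "\<And>c f. f \<in> V \<Longrightarrow> (\<lambda>x. c * f x) \<in> V"
    using assms by (auto simp: function_space_def)
  show n: "(\<lambda>x. - f x) \<in> V" if "f \<in> V" for f
    using *(3)[OF that, of "-1"] by simp
  show "f \<in> V \<Longrightarrow> g \<in> V \<Longrightarrow> (\<lambda>x. f x - g x) \<in> V"
    using *(2)[OF _ n, of f g] by simp
qed

definition sublinear_on :: "('b \<Rightarrow> real) set \<Rightarrow> (('b \<Rightarrow> real) \<Rightarrow> real) \<Rightarrow> bool" where
  "sublinear_on V p \<longleftrightarrow> (\<forall>f\<in>V. \<forall>g\<in>V. p (\<lambda>x. f x + g x) \<le> p f + p g)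
     \<and> (\<forall>c>0. \<forall>f\<in>V. p (\<lambda>x. c * f x) = c * p f) \<and> p (\<lambda>x. 0) = 0"

lemma sublinear_onD:
  assumes "sublinear_on V p"
  shows "f \<in> V \<Longrightarrow> g \<in> V \<Longrightarrow> p (\<lambda>x. f x + g x) \<le> p f + p g"
    "c > 0 \<Longrightarrow> f \<in> V \<Longrightarrow> p (\<lambda>x. c * f x) = c * p f" "p (\<lambda>x. 0) = 0"
    "c \<ge> 0 \<Longrightarrow> f \<in> V \<Longrightarrow> p (\<lambda>x. c * f x) = c * p f"
  using assms by (auto simp: sublinear_on_def order_le_less)

lemma sublinear_on_minus:
  assumes "function_space V" "sublinear_on V p" "f \<in> V"
  shows "- p (\<lambda>x. - f x) \<le> p f"
  using sublinear_onD(1)[OF assms(2) assms(3) function_spaceD(4)[OF assms(1,3)]]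
    sublinear_onD(3)[OF assms(2)] by simp

text \<open>An auxiliary functional from the theory of sublinear functionals. A linear
  \<open>L\<close> below \<open>p\<close> with \<open>L h = p h\<close> satisfies
  \<open>L g = L (g + t * h) - t * p h\<close>, hence lies below this infimum too: nothing that
  attains \<open>p\<close> at \<open>h\<close> is lost.\<close>

definition tilt :: "(('b \<Rightarrow> real) \<Rightarrow> real) \<Rightarrow> ('b \<Rightarrow> real) \<Rightarrow> ('b \<Rightarrow> real) \<Rightarrow> real" where
  "tilt p h g = (INF t\<in>{0..}. p (\<lambda>x. g x + t * h x) - t * p h)"

text \<open>Subadditivity applied to \<open>t * h = (g + t * h) + (- g)\<close> bounds the infimum
  from below by \<open>- p (- g)\<close>, so it is finite. The values \<open>t = 0\<close> and
  \<open>t = 1\<close> give the last two claims; a parameter \<open>s\<close> for \<open>f\<close>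
  and a parameter \<open>t\<close> for \<open>g\<close> combine to \<open>s + t\<close> for the
  sum.\<close>

lemma tilt:
  assumes V: "function_space V" and p: "sublinear_on V p" and h: "h \<in> V"
  shows "sublinear_on V (tilt p h)" "g \<in> V \<Longrightarrow> tilt p h g \<le> p g"
    "tilt p h (\<lambda>x. - h x) \<le> - p h"
proof -
  note vs = function_spaceD[OF V] and sl = sublinear_onD[OF p]
  have lb: "- p (\<lambda>x. - g x) \<le> p (\<lambda>x. g x + t * h x) - t * p h" if "g \<in> V" "t \<ge> 0" for g t
  proof -
    have "p (\<lambda>x. t * h x) \<le> p (\<lambda>x. g x + t * h x) + p (\<lambda>x. - g x)"
      using sl(1)[of "\<lambda>x. g x + t * h x" "\<lambda>x. - g x"] vs that h by simp
    then show ?thesis using sl(4)[of t h] h that by simp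
  qed
  have bdd: "bdd_below ((\<lambda>t. p (\<lambda>x. g x + t * h x) - t * p h) ` {0..})" if "g \<in> V" for g
    by (rule bdd_belowI2[where m="- p (\<lambda>x. - g x)"]) (use lb[OF that] in auto)
  have le: "tilt p h g \<le> p (\<lambda>x. g x + t * h x) - t * p h" if "g \<in> V" "t \<ge> 0" for g t
    unfolding tilt_def by (rule cINF_lower[OF bdd]) (use that in auto)
  have ge: "c \<le> tilt p h g" if "g \<in> V" "\<And>t. t \<ge> 0 \<Longrightarrow> c \<le> p (\<lambda>x. g x + t * h x) - t * p h" for c g
    unfolding tilt_def by (rule cINF_greatest) (use that in auto)
  show "tilt p h g \<le> p g" if "g \<in> V" for g
    using le[OF that, of 0] by simp
  show "tilt p h (\<lambda>x. - h x) \<le> - p h"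
    using le[of "\<lambda>x. - h x" 1] vs h sl(3) by simp
  have add: "tilt p h (\<lambda>x. f x + g x) \<le> tilt p h f + tilt p h g" if fg: "f \<in> V" "g \<in> V" for f g
  proof -
    have step: "tilt p h (\<lambda>x. f x + g x) \<le> (p (\<lambda>x. f x + s * h x) - s * p h) + (p (\<lambda>x. g x + t * h x) - t * p h)"
      if st: "s \<ge> 0" "t \<ge> 0" for s t
    proof -
      have "tilt p h (\<lambda>x. f x + g x) \<le> p (\<lambda>x. f x + g x + (s + t) * h x) - (s + t) * p h"
        by (rule le) (use vs fg st in auto)
      also have "(\<lambda>x. f x + g x + (s + t) * h x) = (\<lambda>x. (f x + s * h x) + (g x + t * h x))"
        by (auto simp: algebra_simps)
      also have "p (\<lambda>x. (f x + s * h x) + (g x + t * h x)) \<le> p (\<lambda>x. f x + s * h x) + p (\<lambda>x. g x + t * h x)"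
        by (rule sl(1)) (use vs fg h in auto)
      finally show ?thesis by (simp add: algebra_simps)
    qed
    have "tilt p h (\<lambda>x. f x + g x) - tilt p h g \<le> tilt p h f"
    proof (rule ge[OF fg(1)])
      fix s :: real assume s: "s \<ge> 0"
      have "tilt p h (\<lambda>x. f x + g x) - (p (\<lambda>x. f x + s * h x) - s * p h) \<le> tilt p h g"
        by (rule ge[OF fg(2)]) (use step[OF s] in \<open>simp add: algebra_simps\<close>)
      then show "tilt p h (\<lambda>x. f x + g x) - tilt p h g \<le> p (\<lambda>x. f x + s * h x) - s * p h"
        by simp
    qed
    then show ?thesis by simp
  qed
  have scale_le: "tilt p h (\<lambda>x. c * f x) \<le> c * tilt p h f" if c: "c > 0" and f: "f \<in> V" for c f
  proof -
    have "tilt p h (\<lambda>x. c * f x) / c \<le> tilt p h f"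
    proof (rule ge[OF f])
      fix t :: real assume t: "t \<ge> 0"
      have "tilt p h (\<lambda>x. c * f x) \<le> p (\<lambda>x. c * f x + (c * t) * h x) - (c * t) * p h"
        by (rule le) (use vs f c t in auto)
      also have "(\<lambda>x. c * f x + (c * t) * h x) = (\<lambda>x. c * (f x + t * h x))"
        by (auto simp: algebra_simps)
      also have "p \<dots> = c * p (\<lambda>x. f x + t * h x)"
        by (rule sl(2)) (use vs f c h in auto)
      finally show "tilt p h (\<lambda>x. c * f x) / c \<le> p (\<lambda>x. f x + t * h x) - t * p h"
        using c by (simp add: field_simps)
    qed
    then show ?thesis using c by (simp add: field_simps)
  qed
  have scale: "tilt p h (\<lambda>x. c * f x) = c * tilt p h f" if c: "c > 0" and f: "f \<in> V" for c f
  proof (rule antisym)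
    have "tilt p h (\<lambda>x. (1/c) * (c * f x)) \<le> (1/c) * tilt p h (\<lambda>x. c * f x)"
      by (rule scale_le) (use c f vs in auto)
    then show "c * tilt p h f \<le> tilt p h (\<lambda>x. c * f x)" using c by (simp add: field_simps)
  qed (rule scale_le[OF c f])
  have zero: "tilt p h (\<lambda>x. 0) = 0"
  proof (rule antisym)
    show "tilt p h (\<lambda>x. 0) \<le> 0" using le[OF vs(1), of 0] sl(3) by simp
    show "0 \<le> tilt p h (\<lambda>x. 0)" using lb[OF vs(1)] sl(3) by (intro ge[OF vs(1)]) simp
  qed
  show "sublinear_on V (tilt p h)"
    unfolding sublinear_on_def using add scale zero by auto
qed

text \<open>A minimal sublinear functional is linear, because it coincides with all its tilts.\<close>

theorem hahn_banach_attained: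
  fixes V :: "('b \<Rightarrow> real) set"
  assumes V: "function_space V" and p: "sublinear_on V p" and \<phi>: "\<phi> \<in> V"
  obtains L where "\<And>f g. f \<in> V \<Longrightarrow> g \<in> V \<Longrightarrow> L (\<lambda>x. f x + g x) = L f + L g"
    "\<And>c f. f \<in> V \<Longrightarrow> L (\<lambda>x. c * f x) = c * L f"
    "\<And>f. f \<in> V \<Longrightarrow> L f \<le> p f" "L \<phi> = p \<phi>"
proof -
  note vs = function_spaceD[OF V]
  \<comment> \<open>Starting from the tilted functional rather than from \<open>p\<close> forces
    equality at \<open>\<phi>\<close>: everything below \<open>q\<close> is at most
    \<open>- p \<phi>\<close> at \<open>- \<phi>\<close>.\<close>
  define q where "q = tilt p \<phi>"
  have q: "sublinear_on V q" "\<And>g. g \<in> V \<Longrightarrow> q g \<le> p g" "q (\<lambda>x. - \<phi> x) \<le> - p \<phi>"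
    unfolding q_def using tilt[OF V p \<phi>] by auto
  \<comment> \<open>Candidates vanish off \<open>V\<close>, so that comparing them everywhere is the
    same as comparing them on \<open>V\<close>, and infima of chains are finite at every argument.
    The order \<open>R\<close> is reversed: a maximal element for Zorn's lemma is a minimal
    functional.\<close>
  define S where "S = {r. sublinear_on V r \<and> (\<forall>g\<in>V. r g \<le> q g) \<and> (\<forall>g. g \<notin> V \<longrightarrow> r g = 0)}"
  define R where "R r r' \<longleftrightarrow> (\<forall>g. r' g \<le> r g)" for r r' :: "('b \<Rightarrow> real) \<Rightarrow> real"
  define cut where "cut r = (\<lambda>g. if g \<in> V then r g else 0 :: real)" for r
  have cut: "sublinear_on V (cut r) \<longleftrightarrow> sublinear_on V r" for r
    unfolding sublinear_on_def cut_def using vs by auto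
  have q0: "cut q \<in> S"
    unfolding S_def using q(1) cut by (auto simp: cut_def)
  have low: "- q (\<lambda>x. - g x) \<le> r g" if "r \<in> S" "g \<in> V" for r g
    using sublinear_on_minus[OF V, of r g] that vs(4)[of g] unfolding S_def by force
  have "\<exists>m\<in>S. \<forall>a\<in>S. R m a \<longrightarrow> a = m"
  proof (rule predicate_Zorn)
    show "partial_order_on S (relation_of R S)"
      by (rule partial_order_on_relation_ofI) (auto simp: R_def fun_eq_iff intro: order_trans antisym)
    fix C assume "C \<in> Chains (relation_of R S)"
    then have CS: "C \<subseteq> S" and ch: "\<And>a b. a \<in> C \<Longrightarrow> b \<in> C \<Longrightarrow> R a b \<or> R b a"
      by (auto simp: Chains_def relation_of_def)
    show "\<exists>u\<in>S. \<forall>a\<in>C. R a u"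
    proof (cases "C = {}")
      case True then show ?thesis using q0 by auto
    next
      case False
      then obtain r0 where r0: "r0 \<in> C" by auto
      define u where "u g = (INF r\<in>C. r g)" for g
      have bdd: "bdd_below ((\<lambda>r. r g) ` C)" for g
      proof (cases "g \<in> V")
        case True then show ?thesis
          by (intro bdd_belowI2[where m="- q (\<lambda>x. - g x)"]) (use low CS in auto)
      next
        case False then show ?thesis
          by (intro bdd_belowI2[where m=0]) (use CS in \<open>auto simp: S_def\<close>)
      qed
      have u_le: "u g \<le> r g" if "r \<in> C" for r g
        unfolding u_def by (rule cINF_lower[OF bdd that])
      have u_ge: "c \<le> u g" if "\<And>r. r \<in> C \<Longrightarrow> c \<le> r g" for c g
        unfolding u_def by (rule cINF_greatest[OF False]) (use that in auto)
      have slr: "sublinear_on V r" if "r \<in> C" for r using that CS by (auto simp: S_def)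
      have "u (\<lambda>x. f x + g x) \<le> u f + u g" if fg: "f \<in> V" "g \<in> V" for f g
      proof -
        have "u (\<lambda>x. f x + g x) \<le> r f + s g" if rs: "r \<in> C" "s \<in> C" for r s
        proof -
          \<comment> \<open>The infimum is subadditive because a chain has one member below both
            \<open>r\<close> and \<open>s\<close>; for an arbitrary family this would fail.\<close>
          obtain w where w: "w \<in> C" "R r w" "R s w"
            using ch[OF rs] rs by (auto simp: R_def)
          have "u (\<lambda>x. f x + g x) \<le> w (\<lambda>x. f x + g x)" by (rule u_le[OF w(1)])
          also have "\<dots> \<le> w f + w g" by (rule sublinear_onD(1)[OF slr[OF w(1)] fg])
          also have "\<dots> \<le> r f + s g" using w by (intro add_mono) (auto simp: R_def)
          finally show ?thesis .
        qed
        then have "u (\<lambda>x. f x + g x) - s g \<le> u f" if "s \<in> C" for s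
          by (intro u_ge) (use that in \<open>simp add: algebra_simps\<close>)
        then have "u (\<lambda>x. f x + g x) - u f \<le> u g"
          by (intro u_ge) (simp add: algebra_simps)
        then show ?thesis by simp
      qed
      moreover have "u (\<lambda>x. c * f x) = c * u f" if c: "c > 0" and f: "f \<in> V" for c f
      proof (rule antisym)
        have "u (\<lambda>x. c * f x) / c \<le> u f"
          by (rule u_ge) (use u_le[of _ "\<lambda>x. c * f x"] sublinear_onD(2)[OF slr c f] c in \<open>simp add: field_simps\<close>)
        then show "u (\<lambda>x. c * f x) \<le> c * u f" using c by (simp add: field_simps)
        show "c * u f \<le> u (\<lambda>x. c * f x)"
        proof (rule u_ge)
          fix r assume r: "r \<in> C"
          then show "c * u f \<le> r (\<lambda>x. c * f x)"
            using u_le[OF r, of f] sublinear_onD(2)[OF slr[OF r] c f] c by simp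
        qed
      qed
      moreover have "u (\<lambda>x. 0) = 0"
        unfolding u_def using sublinear_onD(3)[OF slr] False
        by (subst INF_cong[OF refl, of C _ "\<lambda>_. 0"]) auto
      moreover have "u g \<le> q g" if "g \<in> V" for g
        using u_le[OF r0, of g] r0 CS that by (force simp: S_def)
      moreover have "u g = 0" if "g \<notin> V" for g
        unfolding u_def using CS that False
        by (subst INF_cong[OF refl, of C _ "\<lambda>_. 0"]) (auto simp: S_def)
      ultimately have "u \<in> S" unfolding S_def sublinear_on_def by auto
      then show ?thesis using u_le by (auto simp: R_def)
    qed
  qed
  then obtain m where m: "m \<in> S" and minm: "\<And>a. a \<in> S \<Longrightarrow> R m a \<Longrightarrow> a = m" by auto
  have mS: "sublinear_on V m" "\<And>g. g \<in> V \<Longrightarrow> m g \<le> q g" "\<And>g. g \<notin> V \<Longrightarrow> m g = 0"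
    using m by (auto simp: S_def)
  have neg: "m (\<lambda>x. - h x) = - m h" if h: "h \<in> V" for h
  proof (rule antisym)
    note t = tilt[OF V mS(1) h]
    have "cut (tilt m h) = m"
    proof (rule minm)
      show "cut (tilt m h) \<in> S"
        using t(1) t(2) mS(2) cut[of "tilt m h"] unfolding S_def by (auto simp: cut_def intro: order_trans)
      show "R m (cut (tilt m h))" using t(2) mS(3) by (auto simp: R_def cut_def)
    qed
    then have "m (\<lambda>x. - h x) = tilt m h (\<lambda>x. - h x)"
      using vs(4)[OF h] by (metis cut_def)
    then show "m (\<lambda>x. - h x) \<le> - m h" using t(3) by simp
    show "- m h \<le> m (\<lambda>x. - h x)" using sublinear_on_minus[OF V mS(1) h] by simp
  qed
  show ?thesis
  proof (rule that[of m])
    show "m (\<lambda>x. f x + g x) = m f + m g" if fg: "f \<in> V" "g \<in> V" for f g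
    proof (rule antisym)
      show "m (\<lambda>x. f x + g x) \<le> m f + m g" by (rule sublinear_onD(1)[OF mS(1) fg])
      have "m (\<lambda>x. (f x + g x) + - g x) \<le> m (\<lambda>x. f x + g x) + m (\<lambda>x. - g x)"
        by (rule sublinear_onD(1)[OF mS(1)]) (use fg vs in auto)
      then show "m f + m g \<le> m (\<lambda>x. f x + g x)" using neg[OF fg(2)] by simp
    qed
    show "m (\<lambda>x. c * f x) = c * m f" if f: "f \<in> V" for c f
    proof (cases "c \<ge> 0")
      case True then show ?thesis using sublinear_onD(4)[OF mS(1)] f by auto
    next
      case False
      then have "m (\<lambda>x. (- c) * f x) = (- c) * m f" by (intro sublinear_onD(4)[OF mS(1) _ f]) simp
      moreover have "m (\<lambda>x. - (c * f x)) = - m (\<lambda>x. c * f x)" by (rule neg[OF vs(3)[OF f]])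
      ultimately show ?thesis by simp
    qed
    show mp: "m f \<le> p f" if "f \<in> V" for f using mS(2) q(2) that by (meson order_trans)
    have "m (\<lambda>x. - \<phi> x) \<le> - p \<phi>" using mS(2)[OF vs(4)[OF \<phi>]] q(3) by simp
    then show "m \<phi> = p \<phi>" using neg[OF \<phi>] mp[OF \<phi>] by simp
  qed
qed

section \<open>Positive functionals on functions of polynomial growth\<close>

text \<open>Every member lies between two polynomials, which makes the infimum over polynomial
  majorants finite. The class is not restricted to continuous functions, so that it contains
  indicators.\<close>

definition poly_growth :: "(real \<Rightarrow> real) set" where
  "poly_growth = {f. \<exists>q::real poly. \<forall>x. \<bar>f x\<bar> \<le> poly q x}"

lemma poly_growthI: "(\<And>x. \<bar>f x\<bar> \<le> poly q x) \<Longrightarrow> f \<in> poly_growth"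
  unfolding poly_growth_def by blast

lemma function_space_poly_growth: "function_space poly_growth"
  unfolding function_space_def
proof (intro conjI ballI allI)
  show "(\<lambda>x. 0) \<in> poly_growth" by (rule poly_growthI[of _ 0]) simp
next
  fix f g assume "f \<in> poly_growth" "g \<in> poly_growth"
  then obtain q r :: "real poly" where "\<And>x. \<bar>f x\<bar> \<le> poly q x" "\<And>x. \<bar>g x\<bar> \<le> poly r x"
    unfolding poly_growth_def by blast
  then show "(\<lambda>x. f x + g x) \<in> poly_growth"
    by (intro poly_growthI[of _ "q + r"]) (smt (verit) poly_add)
next
  fix c f assume "f \<in> poly_growth"
  then obtain q :: "real poly" where "\<And>x. \<bar>f x\<bar> \<le> poly q x"
    unfolding poly_growth_def by blast
  then show "(\<lambda>x. c * f x) \<in> poly_growth"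
    by (intro poly_growthI[of _ "Polynomial.smult \<bar>c\<bar> q"]) (simp add: abs_mult mult_left_mono)
qed

lemmas poly_growth_vs = function_spaceD[OF function_space_poly_growth]

lemma poly_growth_bounded: "(\<And>x. \<bar>f x\<bar> \<le> c) \<Longrightarrow> f \<in> poly_growth"
  by (rule poly_growthI[of _ "[:c:]"]) simp

lemma poly_growth_dominated: "g \<in> poly_growth \<Longrightarrow> (\<And>x. \<bar>f x\<bar> \<le> \<bar>g x\<bar>) \<Longrightarrow> f \<in> poly_growth"
  unfolding poly_growth_def by (blast intro: order_trans)

text \<open>The bound has to be nonnegative, so \<open>q\<close> itself will not do;
  \<open>\<bar>q\<bar> \<le> 1 + q * q\<close> comes from the square of
  \<open>\<bar>q\<bar> - 1/2\<close>.\<close>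

lemma poly_growth_poly: "poly q \<in> poly_growth"
proof (rule poly_growthI)
  fix x
  show "\<bar>poly q x\<bar> \<le> poly (1 + q * q) x"
    using zero_le_power2[of "\<bar>poly q x\<bar> - 1/2"]
    by (simp add: power2_diff) (simp add: power2_eq_square)
qed

lemma poly_growth_sum: "(\<And>i. i \<in> A \<Longrightarrow> f i \<in> poly_growth) \<Longrightarrow> (\<lambda>x. \<Sum>i\<in>A. f i x) \<in> poly_growth"
  by (induction A rule: infinite_finite_induct) (auto intro: poly_growth_vs)

lemma poly_growth_indicator: "indicator A \<in> poly_growth"
  by (rule poly_growth_bounded[of _ 1]) (auto simp: indicator_def)

lemma poly_growth_mult_indicator: "f \<in> poly_growth \<Longrightarrow> (\<lambda>x. f x * indicator A x) \<in> poly_growth"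
  by (erule poly_growth_dominated) (auto simp: indicator_def)

text \<open>The setting of a Riesz representation theorem on a non-compact space, without continuity
  of \<open>L\<close> under monotone limits. Positivity together with the availability of all
  polynomials makes up for both.\<close>

locale positive_functional =
  fixes L :: "(real \<Rightarrow> real) \<Rightarrow> real"
  assumes add: "f \<in> poly_growth \<Longrightarrow> g \<in> poly_growth \<Longrightarrow> L (\<lambda>x. f x + g x) = L f + L g"
    and scale: "f \<in> poly_growth \<Longrightarrow> L (\<lambda>x. c * f x) = c * L f"
    and pos: "f \<in> poly_growth \<Longrightarrow> (\<And>x. 0 \<le> f x) \<Longrightarrow> 0 \<le> L f"
    and one: "L (\<lambda>x. 1) = 1"
begin

lemma zero: "L (\<lambda>x. 0) = 0"
  using scale[OF poly_growth_vs(1), of 0] by simp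

lemma diff: "f \<in> poly_growth \<Longrightarrow> g \<in> poly_growth \<Longrightarrow> L (\<lambda>x. f x - g x) = L f - L g"
  using add[of f "\<lambda>x. (-1) * g x"] scale[of g "-1"] poly_growth_vs(3)[of g "-1"] by simp

lemma mono: "f \<in> poly_growth \<Longrightarrow> g \<in> poly_growth \<Longrightarrow> (\<And>x. f x \<le> g x) \<Longrightarrow> L f \<le> L g"
  using pos[of "\<lambda>x. g x - f x"] poly_growth_vs(5)[of g f] diff[of g f] by simp

lemma sum: "(\<And>i. i \<in> A \<Longrightarrow> f i \<in> poly_growth) \<Longrightarrow> L (\<lambda>x. \<Sum>i\<in>A. c i * f i x) = (\<Sum>i\<in>A. c i * L (f i))"
proof (induction A rule: infinite_finite_induct)
  case (insert i A)
  then show ?case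
    by (simp add: add[OF poly_growth_vs(3) poly_growth_sum[OF poly_growth_vs(3)]] scale)
qed (simp_all add: zero)

lemma abs_le:
  assumes "f \<in> poly_growth" "g \<in> poly_growth" "\<And>x. \<bar>f x\<bar> \<le> g x"
  shows "\<bar>L f\<bar> \<le> L g"
proof -
  have "L f \<le> L g" by (rule mono) (use assms in \<open>auto simp: abs_le_iff\<close>)
  moreover have "L (\<lambda>x. (-1) * f x) \<le> L g"
  proof (rule mono[OF poly_growth_vs(3)[OF assms(1)] assms(2)])
    show "-1 * f x \<le> g x" for x using assms(3)[of x] by linarith
  qed
  ultimately show ?thesis using scale[OF assms(1), of "-1"] by simp
qed

section \<open>The distribution function of a positive functional\<close>

definition F where "F x = L (indicator {..x})"

lemma F_mono: "x \<le> y \<Longrightarrow> F x \<le> F y"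
  unfolding F_def by (intro mono poly_growth_indicator) (auto simp: indicator_def)

lemma F_nonneg: "0 \<le> F x" unfolding F_def by (intro pos poly_growth_indicator) auto

lemma F_le_1: "F x \<le> 1"
  using mono[OF poly_growth_indicator[of "{..x}"] poly_growth_bounded[of "\<lambda>_. 1" 1]] one
  by (auto simp: F_def indicator_def)

text \<open>\<open>F\<close> may fail to be right continuous, because \<open>L\<close> is only
  finitely additive. \<open>G\<close> is its right limit; the two differ at most at discontinuities
  of \<open>F\<close>.\<close>

definition G where "G x = Inf (F ` {x<..})"

lemma G_bdd: "bdd_below (F ` {x<..})"
  by (rule bdd_belowI2[where m=0]) (rule F_nonneg)

lemma G_le: "x < y \<Longrightarrow> G x \<le> F y"
  unfolding G_def by (rule cINF_lower[OF G_bdd]) auto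

lemma F_le_G: "F x \<le> G x"
  unfolding G_def by (rule cINF_greatest) (auto intro: F_mono)

lemma G_mono: "x \<le> y \<Longrightarrow> G x \<le> G y"
  by (cases "x = y") (auto intro: order_trans[OF G_le F_le_G])

lemma G_less: "G x < c \<Longrightarrow> \<exists>y>x. F y < c"
  unfolding G_def using cINF_less_iff[OF _ G_bdd, of x] by auto

lemma G_right_cont: "continuous (at_right a) G"
  unfolding continuous_within
proof (rule order_tendstoI)
  fix c assume "c < G a"
  then show "\<forall>\<^sub>F x in at_right a. c < G x"
    using less_le_trans[OF _ G_mono] by (intro eventually_at_rightI[of a "a+1"]) auto
next
  fix c assume "G a < c"
  then obtain y where "y > a" "F y < c" using G_less by blast
  then show "\<forall>\<^sub>F x in at_right a. G x < c"
    by (intro eventually_at_rightI[of a y]) (auto intro: le_less_trans G_le)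
qed

lemma square_growth: "(\<lambda>x. x\<^sup>2) \<in> poly_growth"
proof -
  have "poly [:0, 0, 1:] = (\<lambda>x::real. x\<^sup>2)" by (auto simp: power2_eq_square)
  then show ?thesis using poly_growth_poly[of "[:0, 0, 1:]"] by simp
qed

text \<open>Chebyshev's inequality for \<open>L\<close>: on the half-line below
  \<open>x \<le> -1\<close> one has \<open>1 \<le> y\<^sup>2 / x\<^sup>2\<close>. The second moment
  thus prevents a loss of mass at infinity, which positivity alone would not exclude;
  \<open>F_at_top\<close> rests on the same bound.\<close>

lemma F_at_bot: "(F \<longlongrightarrow> 0) at_bot"
proof (rule tendsto_sandwich[of "\<lambda>_. 0" _ _ "\<lambda>x. (1/x\<^sup>2) * L (\<lambda>x. x\<^sup>2)"])
  show "\<forall>\<^sub>F x in at_bot. F x \<le> (1/x\<^sup>2) * L (\<lambda>x. x\<^sup>2)"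
  proof (rule eventually_at_bot_linorderI[of "-1"])
    fix x :: real assume x: "x \<le> -1"
    have "indicator {..x} y \<le> (1/x\<^sup>2) * y\<^sup>2" for y
      using x abs_le_square_iff[of x y] by (auto simp: indicator_def field_simps)
    then show "F x \<le> (1/x\<^sup>2) * L (\<lambda>x. x\<^sup>2)"
      unfolding F_def scale[OF square_growth, symmetric]
      by (intro mono poly_growth_indicator poly_growth_vs square_growth)
  qed
  show "((\<lambda>x. 1 / x\<^sup>2 * L power2) \<longlongrightarrow> 0) at_bot"
    by (intro tendsto_mult_left_zero tendsto_divide_0[OF tendsto_const] filterlim_at_top_imp_at_infinity filterlim_pow_at_bot_even) (auto simp: filterlim_ident)
qed (auto simp: F_nonneg)

lemma F_at_top: "(F \<longlongrightarrow> 1) at_top"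
proof (rule tendsto_sandwich[of "\<lambda>x. 1 - (1/x\<^sup>2) * L (\<lambda>x. x\<^sup>2)" _ _ "\<lambda>_. 1"])
  show "\<forall>\<^sub>F x in at_top. 1 - (1/x\<^sup>2) * L (\<lambda>x. x\<^sup>2) \<le> F x"
  proof (rule eventually_at_top_linorderI[of "1"])
    fix x :: real assume x: "x \<ge> 1"
    have "1 - (1/x\<^sup>2) * y\<^sup>2 \<le> indicator {..x} y" for y
      using x abs_le_square_iff[of x y] by (auto simp: indicator_def field_simps)
    then have "L (\<lambda>y. 1 - (1/x\<^sup>2) * y\<^sup>2) \<le> F x"
      unfolding F_def
      by (intro mono poly_growth_indicator poly_growth_vs square_growth poly_growth_bounded[of "\<lambda>_. 1" 1]) auto
    then show "1 - (1/x\<^sup>2) * L (\<lambda>x. x\<^sup>2) \<le> F x"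
      using diff[OF poly_growth_bounded[of "\<lambda>_. 1" 1] poly_growth_vs(3)[OF square_growth, of "1/x\<^sup>2"]] one
        scale[OF square_growth, of "1/x\<^sup>2"] by simp
  qed
  have "((\<lambda>x. 1 - 1 / x\<^sup>2 * L power2) \<longlongrightarrow> 1 - 0) at_top"
    by (intro tendsto_diff tendsto_const tendsto_mult_left_zero tendsto_divide_0[OF tendsto_const] filterlim_at_top_imp_at_infinity filterlim_pow_at_top) (auto simp: filterlim_ident)
  then show "((\<lambda>x. 1 - 1 / x\<^sup>2 * L power2) \<longlongrightarrow> 1) at_top" by simp
qed (auto simp: F_le_1)

definition \<nu> where "\<nu> = interval_measure G"

sublocale nu: real_distribution \<nu>
  unfolding \<nu>_def
proof (rule real_distribution_interval_measure[OF G_mono G_right_cont])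
  show "(G \<longlongrightarrow> 0) at_bot"
  proof (rule tendsto_sandwich[of F _ _ "\<lambda>x. F (x + 1)"])
    show "((\<lambda>x. F (x + 1)) \<longlongrightarrow> 0) at_bot"
      by (rule filterlim_compose[OF F_at_bot]) real_asymp
  qed (auto simp: F_le_G G_le F_at_bot)
  show "(G \<longlongrightarrow> 1) at_top"
  proof (rule tendsto_sandwich[of F _ _ "\<lambda>x. F (x + 1)"])
    show "((\<lambda>x. F (x + 1)) \<longlongrightarrow> 1) at_top"
      by (rule filterlim_compose[OF F_at_top]) real_asymp
  qed (auto simp: F_le_G G_le F_at_top)
qed

lemma G_eq: assumes "isCont F x" shows "G x = F x"
proof (rule antisym)
  have "(F \<longlongrightarrow> F x) (at_right x)"
    using assms by (simp add: isCont_def filterlim_at_split)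
  moreover have "\<forall>\<^sub>F y in at_right x. G x \<le> F y"
    by (rule eventually_at_rightI[of x "x+1"]) (auto intro: G_le)
  ultimately show "G x \<le> F x" by (intro tendsto_lowerbound[of F _ "at_right x"]) auto
qed (rule F_le_G)

section \<open>Agreement of the measure with the functional\<close>

lemma measure_Ioc:
  assumes "isCont F a" "isCont F b" "a \<le> b"
  shows "measure \<nu> {a<..b} = L (indicator {a<..b})"
proof -
  have "measure \<nu> {a<..b} = G b - G a"
    unfolding \<nu>_def by (rule measure_interval_measure_Ioc[OF assms(3) G_mono G_right_cont])
  also have "\<dots> = L (indicator {..b}) - L (indicator {..a})"
    using G_eq assms by (simp add: F_def)
  also have "\<dots> = L (\<lambda>x. indicator {..b} x - indicator {..a} x)"
    by (rule diff[symmetric]; rule poly_growth_indicator)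
  also have "(\<lambda>x. indicator {..b} x - indicator {..a} x) = (indicator {a<..b} :: real \<Rightarrow> real)"
    using assms(3) by (auto simp: indicator_def)
  finally show ?thesis .
qed

text \<open>The functional and the measure agree on half-open intervals whose end points are continuity points of
  the distribution function; a translate of the rationals consists of such points only.\<close>

lemma continuity_grid: obtains \<theta> where "\<And>r. r \<in> \<rat> \<Longrightarrow> isCont F (\<theta> + r)"
proof -
  have c: "countable {a. \<not> isCont F a}"
    using mono_on_ctble_discont[of UNIV F] F_mono by (simp add: mono_on_def)
  have "countable (\<Union>r\<in>\<rat>. (\<lambda>a. a - r) ` {a. \<not> isCont F a})"
    by (intro countable_UN countable_image c countable_rat)
  then have "(\<Union>r\<in>\<rat>. (\<lambda>a. a - r) ` {a. \<not> isCont F a}) \<noteq> UNIV"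
    using uncountable_UNIV_real by metis
  then obtain \<theta> where \<theta>: "\<theta> \<notin> (\<Union>r\<in>\<rat>. (\<lambda>a. a - r) ` {a. \<not> isCont F a})" by blast
  show ?thesis
  proof (rule that)
    fix r :: real assume "r \<in> \<rat>"
    show "isCont F (\<theta> + r)"
    proof (rule ccontr)
      assume "\<not> isCont F (\<theta> + r)"
      then have "\<theta> \<in> (\<lambda>a. a - r) ` {a. \<not> isCont F a}" by (intro image_eqI[of _ _ "\<theta> + r"]) auto
      then show False using \<theta> \<open>r \<in> \<rat>\<close> by blast
    qed
  qed
qed

text \<open>On a grid of mesh \<open>1/N\<close> in the window, uniform continuity replaces
  \<open>g\<close> by a step function \<open>s\<close> up to \<open>e\<close>. For \<open>s\<close>
  both sides agree by \<open>measure_Ioc\<close>, and the replacement costs at most \<open>e\<close>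
  on either side because both total masses are one.\<close>

lemma window_integral:
  fixes g :: "real \<Rightarrow> real"
  assumes \<theta>: "\<And>r. r \<in> \<rat> \<Longrightarrow> isCont F (\<theta> + r)"
    and g: "continuous_on UNIV g" "g \<in> poly_growth" and K: "K > (0::nat)"
  shows "(\<integral>x. g x * indicator {\<theta> - K<..\<theta> + K} x \<partial>\<nu>) = L (\<lambda>x. g x * indicator {\<theta> - K<..\<theta> + K} x)"
    (is "?I = ?L")
proof -
  define W where "W = {\<theta> - real K<..\<theta> + real K}"
  have gb: "\<exists>C. \<forall>x. \<bar>g x * indicator W x\<bar> \<le> C"
  proof -
    have "compact (g ` {\<theta> - real K..\<theta> + real K})"
      by (intro compact_continuous_image continuous_on_subset[OF g(1)]) auto
    then obtain C where "\<And>x. x \<in> {\<theta> - real K..\<theta> + real K} \<Longrightarrow> \<bar>g x\<bar> \<le> C"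
      using compact_imp_bounded by (fastforce simp: bounded_iff)
    then show ?thesis by (intro exI[of _ "max C 0"]) (auto simp: indicator_def W_def le_max_iff_disj)
  qed
  have gm: "g \<in> borel_measurable borel" using g(1) by (rule borel_measurable_continuous_onI)
  have int_gW: "integrable \<nu> (\<lambda>x. g x * indicator W x)"
  proof -
    obtain C where "\<And>x. \<bar>g x * indicator W x\<bar> \<le> C" using gb by blast
    then show ?thesis using gm by (intro nu.integrable_const_bound[of _ C]) (auto simp: W_def)
  qed
  have "\<bar>?I - ?L\<bar> \<le> 2 * e" if e: "e > 0" for e
  proof -
    have "uniformly_continuous_on {\<theta> - real K..\<theta> + real K} g"
      by (intro compact_uniformly_continuous continuous_on_subset[OF g(1)]) auto
    then obtain d where d: "d > 0" "\<And>x y. x \<in> {\<theta> - real K..\<theta> + real K} \<Longrightarrow> y \<in> {\<theta> - real K..\<theta> + real K}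
        \<Longrightarrow> \<bar>x - y\<bar> < d \<Longrightarrow> \<bar>g x - g y\<bar> < e"
      using e unfolding uniformly_continuous_on_def dist_real_def by metis
    obtain N :: nat where N: "N > 0" "1 / N < d"
      using d(1) nat_approx_posE by (metis of_nat_0_less_iff zero_less_Suc)
    define c where "c i = \<theta> - real K + real i / real N" for i :: nat
    define I where "I i = {c i<..c (Suc i)}" for i
    define s where "s x = (\<Sum>i<2*K*N. g (c i) * indicator (I i) x)" for x
    have cgood: "isCont F (c i)" for i
      using \<theta>[of "- real K + real i / real N"] by (simp add: c_def algebra_simps)
    have cmono: "c i \<le> c (Suc i)" for i by (simp add: c_def divide_right_mono)
    have cW: "c 0 = \<theta> - K" "c (2*K*N) = \<theta> + K" using N by (auto simp: c_def field_simps)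
    have cmono': "i \<le> j \<Longrightarrow> c i \<le> c j" for i j by (simp add: c_def divide_right_mono)
    have near: "\<bar>s x - g x * indicator W x\<bar> \<le> e" for x
    proof (cases "x \<in> W")
      case False
      have "x \<notin> I i" if "i < 2*K*N" for i
        using False cmono'[of 0 i] cmono'[of "Suc i" "2*K*N"] that cW by (auto simp: I_def W_def)
      then have "s x = 0" unfolding s_def by (intro sum.neutral) auto
      then show ?thesis using False e by simp
    next
      case True
      define z where "z = (x - \<theta> + K) * N"
      have z: "0 < z" "z \<le> 2 * K * N" using True N by (auto simp: z_def W_def)
      \<comment> \<open>The cells are open on the left and closed on the right, so the one
        containing \<open>x\<close> has the index \<open>k\<close> with
        \<open>k < z \<le> k + 1\<close>: the ceiling minus one, not the floor.\<close>
      define k where "k = nat (\<lceil>z\<rceil> - 1)"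
      have k: "real k < z" "z \<le> real k + 1" using z(1) by (auto simp: k_def) linarith+
      have iff: "x \<in> I i \<longleftrightarrow> i = k" for i
      proof -
        have "x \<in> I i \<longleftrightarrow> real i < z \<and> z \<le> real i + 1"
          using N by (simp add: I_def c_def z_def field_simps)
        also have "\<dots> \<longleftrightarrow> i = k" using k by auto
        finally show ?thesis .
      qed
      have kl: "k < 2*K*N" using k z by linarith
      have "s x = (\<Sum>i<2*K*N. if i = k then g (c i) else 0)"
        unfolding s_def by (rule sum.cong) (auto simp: iff indicator_def)
      then have "s x = g (c k)" using kl by simp
      moreover have "\<bar>g (c k) - g x\<bar> < e"
      proof (rule d(2))
        show "x \<in> {\<theta> - real K..\<theta> + real K}" using True by (auto simp: W_def)
        show "c k \<in> {\<theta> - real K..\<theta> + real K}" using cmono'[of 0 k] cmono'[of k "2*K*N"] kl cW by auto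
        have "x \<in> I k" using iff by simp
        then have "\<bar>c k - x\<bar> \<le> 1/N" by (auto simp: I_def c_def add_divide_distrib)
        then show "\<bar>c k - x\<bar> < d" using N by simp
      qed
      ultimately show ?thesis using True by simp
    qed
    have int_t: "integrable \<nu> (\<lambda>x. g (c i) * indicator (I i) x)" for i
      by (rule nu.integrable_const_bound[of _ "\<bar>g (c i)\<bar>"]) (auto simp: I_def indicator_def)
    have int_s: "integrable \<nu> s"
      unfolding s_def by (rule Bochner_Integration.integrable_sum[OF int_t])
    have spg: "s \<in> poly_growth"
      unfolding s_def by (intro poly_growth_sum poly_growth_vs poly_growth_indicator)
    have "(\<integral>x. s x \<partial>\<nu>) = (\<Sum>i<2*K*N. g (c i) * measure \<nu> (I i))"
      unfolding s_def Bochner_Integration.integral_sum[OF int_t]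
      by (intro sum.cong refl) (simp add: I_def)
    also have "\<dots> = (\<Sum>i<2*K*N. g (c i) * L (indicator (I i)))"
      unfolding I_def by (simp add: measure_Ioc[OF cgood cgood cmono])
    also have "\<dots> = L s" unfolding s_def by (rule sum[symmetric], rule poly_growth_indicator)
    finally have eq: "(\<integral>x. s x \<partial>\<nu>) = L s" .
    have "\<bar>(\<integral>x. s x \<partial>\<nu>) - ?I\<bar> \<le> e"
    proof -
      have "\<bar>(\<integral>x. s x \<partial>\<nu>) - ?I\<bar> = \<bar>\<integral>x. s x - g x * indicator W x \<partial>\<nu>\<bar>"
        using int_s int_gW by (simp add: W_def)
      also have "\<dots> \<le> (\<integral>x. \<bar>s x - g x * indicator W x\<bar> \<partial>\<nu>)" by (rule integral_abs_bound)
      also have "\<dots> \<le> (\<integral>x. e \<partial>\<nu>)"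
        using int_s int_gW near by (intro integral_mono) auto
      finally show ?thesis using nu.prob_space by simp
    qed
    moreover have "\<bar>L s - ?L\<bar> \<le> e"
    proof -
      have pg: "(\<lambda>x. g x * indicator W x) \<in> poly_growth" by (rule poly_growth_mult_indicator[OF g(2)])
      have "\<bar>L (\<lambda>x. s x - g x * indicator W x)\<bar> \<le> L (\<lambda>x. e * 1)"
        by (rule abs_le[OF poly_growth_vs(5)[OF spg pg]])
          (use near in \<open>auto intro: poly_growth_bounded[of _ e] simp: e less_imp_le\<close>)
      also have "\<dots> = e" using scale[OF poly_growth_bounded[of "\<lambda>_. 1" 1], of e] one by simp
      finally show ?thesis using diff[OF spg pg] by (simp add: W_def)
    qed
    ultimately show ?thesis using eq by linarith
  qed
  from this[of "e / 2" for e] have "\<bar>?I - ?L\<bar> \<le> 0 + e" if "e > 0" for e using that by simp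
  then have "\<bar>?I - ?L\<bar> \<le> 0" by (rule field_le_epsilon)
  then show ?thesis by simp
qed

text \<open>Outside the window of radius \<open>K\<close> about \<open>\<theta>\<close> the factor
  \<open>(x - \<theta>)\<^sup>2 / K\<^sup>2\<close> is at least one, so the remainder of
  \<open>g\<close> is bounded by \<open>r / K\<^sup>2\<close> with a polynomial \<open>r\<close>,
  and \<open>L\<close> of it tends to zero. On the side of \<open>\<nu>\<close>, monotone
  convergence makes the dominating polynomial integrable, after which dominated convergence handles
  \<open>g\<close>.\<close>

theorem represents:
  assumes g: "continuous_on UNIV g" "g \<in> poly_growth"
  shows "integrable \<nu> g" "(\<integral>x. g x \<partial>\<nu>) = L g"
proof -
  obtain \<theta> where \<theta>: "\<And>r. r \<in> \<rat> \<Longrightarrow> isCont F (\<theta> + r)" using continuity_grid by blast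
  define W where "W K = {\<theta> - real K<..\<theta> + real K}" for K
  have lim: "(\<lambda>K. L (\<lambda>x. g x * indicator (W K) x)) \<longlonglongrightarrow> L g"
    if g: "g \<in> poly_growth" for g
  proof -
    obtain q :: "real poly" where q: "\<And>x. \<bar>g x\<bar> \<le> poly q x" using g by (auto simp: poly_growth_def)
    have q0: "0 \<le> poly q x" for x using q[of x] by simp
    define r where "r = q * [:-\<theta>, 1:]^2"
    have pg: "(\<lambda>x. g x - g x * indicator (W K) x) \<in> poly_growth" for K
      by (intro poly_growth_vs g poly_growth_mult_indicator)
    have bound: "\<bar>L g - L (\<lambda>x. g x * indicator (W K) x)\<bar> \<le> 1/(real K)\<^sup>2 * L (poly r)" if "K > 0" for K
    proof -
      have "\<bar>g x - g x * indicator (W K) x\<bar> \<le> 1/(real K)\<^sup>2 * poly r x" for x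
      proof (cases "x \<in> W K")
        case True then show ?thesis using q0 by (simp add: r_def)
      next
        case False
        then have "real K \<le> \<bar>x - \<theta>\<bar>" by (auto simp: W_def)
        then have "(real K)\<^sup>2 \<le> (x - \<theta>)\<^sup>2" using abs_le_square_iff[of "real K" "x - \<theta>"] by simp
        then have "1 \<le> (x - \<theta>)\<^sup>2 / (real K)\<^sup>2" using that by simp
        then have "\<bar>g x\<bar> * 1 \<le> poly q x * ((x - \<theta>)\<^sup>2 / (real K)\<^sup>2)"
          by (intro mult_mono q) (use q0 in auto)
        moreover have "poly r x = poly q x * (x - \<theta>)\<^sup>2" by (simp add: r_def)
        ultimately show ?thesis using False by simp
      qed
      then have "\<bar>L (\<lambda>x. g x - g x * indicator (W K) x)\<bar> \<le> L (\<lambda>x. 1/(real K)\<^sup>2 * poly r x)"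
        by (rule abs_le[OF pg poly_growth_vs(3)[OF poly_growth_poly]])
      then show ?thesis
        by (simp only: diff[OF g poly_growth_mult_indicator[OF g]] scale[OF poly_growth_poly])
    qed
    have "(\<lambda>K. L g - L (\<lambda>x. g x * indicator (W K) x)) \<longlonglongrightarrow> 0"
    proof (rule Lim_null_comparison)
      show "\<forall>\<^sub>F K in sequentially. norm (L g - L (\<lambda>x. g x * indicator (W K) x)) \<le> 1/(real K)\<^sup>2 * L (poly r)"
        using bound by (auto intro!: eventually_sequentiallyI[of 1])
      show "(\<lambda>K. 1/(real K)\<^sup>2 * L (poly r)) \<longlonglongrightarrow> 0"
        by (rule tendsto_mult_left_zero) real_asymp
    qed
    from tendsto_diff[OF tendsto_const[of "L g"] this] show ?thesis by simp
  qed
  have intW: "integrable \<nu> (\<lambda>x. g x * indicator (W K) x)" if g: "continuous_on UNIV g" for g :: "real \<Rightarrow> real" and K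
  proof -
    have "compact (g ` {\<theta> - real K..\<theta> + real K})"
        by (intro compact_continuous_image continuous_on_subset[OF g]) auto
    then obtain C where C: "\<And>x. x \<in> {\<theta> - real K..\<theta> + real K} \<Longrightarrow> \<bar>g x\<bar> \<le> C"
      using compact_imp_bounded by (fastforce simp: bounded_iff)
    have "set_integrable \<nu> {\<theta> - real K..\<theta> + real K} g"
      unfolding set_integrable_def
    proof (rule nu.integrable_const_bound[of _ "max C 0"])
      from C have "norm (indicator {\<theta> - real K..\<theta> + real K} x *\<^sub>R g x) \<le> max C 0" for x
        by (cases "x \<in> {\<theta> - real K..\<theta> + real K}") (auto simp: max.coboundedI1)
      then show "AE x in \<nu>. norm (indicator {\<theta> - real K..\<theta> + real K} x *\<^sub>R g x) \<le> max C 0"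
        by (rule AE_I2)
    qed (use borel_measurable_continuous_onI[OF g] in auto)
    then have "set_integrable \<nu> (W K) g"
      by (rule set_integrable_subset) (auto simp: W_def)
    then show ?thesis by (simp add: set_integrable_def mult.commute)
  qed
  have eqW: "\<forall>\<^sub>F K in sequentially. (\<integral>x. g x * indicator (W K) x \<partial>\<nu>) = L (\<lambda>x. g x * indicator (W K) x)"
    if g: "continuous_on UNIV g" "g \<in> poly_growth" for g
    using window_integral[OF \<theta> g] by (intro eventually_sequentiallyI[of 1]) (auto simp: W_def)
  have limW: "(\<lambda>K. g x * indicator (W K) x) \<longlonglongrightarrow> g x" for g :: "real \<Rightarrow> real" and x
  proof (rule tendsto_eventually)
    obtain n where "\<bar>x - \<theta>\<bar> < real n" using reals_Archimedean2 by blast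
    then show "\<forall>\<^sub>F K in sequentially. g x * indicator (W K) x = g x"
      by (intro eventually_sequentiallyI[of n]) (auto simp: W_def indicator_def abs_less_iff)
  qed
  obtain q :: "real poly" where q: "\<And>x. \<bar>g x\<bar> \<le> poly q x" using g by (auto simp: poly_growth_def)
  have q0: "0 \<le> poly q x" for x using q[of x] by simp
  have cq: "continuous_on UNIV (poly q)" by (intro continuous_intros)
  have qi: "integrable \<nu> (poly q)"
  proof (rule integrable_monotone_convergence)
    show "integrable \<nu> (\<lambda>x. poly q x * indicator (W K) x)" for K by (rule intW[OF cq])
    show "AE x in \<nu>. mono (\<lambda>K. poly q x * indicator (W K) x)"
      using q0 by (auto intro!: monoI mult_left_mono simp: W_def indicator_def)
    show "AE x in \<nu>. (\<lambda>K. poly q x * indicator (W K) x) \<longlonglongrightarrow> poly q x" using limW by auto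
    show "(\<lambda>K. \<integral>x. poly q x * indicator (W K) x \<partial>\<nu>) \<longlonglongrightarrow> L (poly q)"
      using lim[OF poly_growth_poly] tendsto_cong[OF eqW[OF cq poly_growth_poly]] by blast
  qed (use borel_measurable_continuous_onI[OF cq] in auto)
  have gm: "g \<in> borel_measurable \<nu>" using borel_measurable_continuous_onI[OF g(1)] by auto
  show "integrable \<nu> g"
    by (rule Bochner_Integration.integrable_bound[OF qi gm]) (use q q0 in auto)
  have "(\<lambda>K. \<integral>x. g x * indicator (W K) x \<partial>\<nu>) \<longlonglongrightarrow> (\<integral>x. g x \<partial>\<nu>)"
  proof (rule integral_dominated_convergence[OF gm _ qi])
    show "AE x in \<nu>. norm (g x * indicator (W K) x) \<le> poly q x" for K
      using q q0 by (auto simp: indicator_def)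
  qed (use gm limW in \<open>auto simp: W_def\<close>)
  moreover have "(\<lambda>K. \<integral>x. g x * indicator (W K) x \<partial>\<nu>) \<longlonglongrightarrow> L g"
    using lim[OF g(2)] tendsto_cong[OF eqW[OF g]] by blast
  ultimately show "(\<integral>x. g x \<partial>\<nu>) = L g" by (rule LIMSEQ_unique)
qed

end

section \<open>Determinacy implies density of the polynomials\<close>

abbreviation cpoly :: "real poly \<Rightarrow> complex \<Rightarrow> complex" where
  "cpoly p \<equiv> poly (map_poly of_real p)"

lemma cpoly_add: "cpoly (p + q) z = cpoly p z + cpoly q z"
proof -
  have "map_poly complex_of_real (p + q) = map_poly of_real p + map_poly of_real q"
    by (intro poly_eqI) (simp add: coeff_map_poly)
  then show ?thesis by simp
qed

lemma cpoly_smult: "cpoly (Polynomial.smult c q) z = of_real c * cpoly q z"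
  by (simp add: map_poly_smult)

lemma cpoly_mult: "cpoly (p * q) z = cpoly p z * cpoly q z"
proof (induction p)
  case (pCons a p)
  then show ?case by (simp add: cpoly_add cpoly_smult map_poly_pCons algebra_simps)
qed simp

lemma cpoly_of_real: "cpoly p (of_real x) = of_real (poly p x)"
  by (induction p) (simp_all add: map_poly_pCons)

lemma degree_cpoly: "degree (map_poly complex_of_real p) = degree p"
  by (rule degree_map_poly) auto

lemma cpoly_root:
  assumes "degree p > 0"
  obtains z where "cpoly p z = 0"
  using fundamental_theorem_of_algebra[of "map_poly complex_of_real p"] assms
  by (metis constant_degree degree_cpoly less_not_refl)

text \<open>A nonnegative real polynomial is the squared modulus, on the real line, of a complex polynomial: split off a
  pair of conjugate roots or a double real root.\<close>

lemma nonneg_poly_squared_modulus: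
  fixes P :: "real poly"
  assumes "\<And>x. poly P x \<ge> 0"
  shows "\<exists>r :: complex poly. \<forall>z. cpoly P z = poly r z * cnj (poly r (cnj z))"
  using assms
proof (induction "degree P" arbitrary: P rule: less_induct)
  case less
  show ?case
  proof (cases "degree P = 0")
    case True
    then obtain c where c: "P = [:c:]" by (rule degree_eq_zeroE)
    then have "c \<ge> 0" using less.prems[of 0] by simp
    then have "of_real (sqrt c) * cnj (of_real (sqrt c)) = complex_of_real c"
      by (simp flip: of_real_mult)
    then show ?thesis using c by (intro exI[of _ "[:of_real (sqrt c):]"]) (simp add: map_poly_pCons)
  next
    case False
    then obtain w where w: "cpoly P w = 0" using cpoly_root by blast
    \<comment> \<open>The real quadratic with roots \<open>w\<close> and \<open>cnj w\<close>; for
      real \<open>w\<close> it is the square of \<open>x - w\<close>.\<close>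
    define m where "m = [:(Re w)\<^sup>2 + (Im w)\<^sup>2, - 2 * Re w, 1:]"
    have mz: "cpoly m z = (z - w) * (z - cnj w)" for z
      by (simp add: m_def map_poly_pCons complex_eq_iff power2_eq_square algebra_simps)
    have mpos: "poly m x = (x - Re w)\<^sup>2 + (Im w)\<^sup>2" for x
      by (simp add: m_def power2_eq_square algebra_simps)
    have "\<exists>Q. P = m * Q \<and> (\<forall>x. poly Q x \<ge> 0)"
    proof (cases "Im w = 0")
      case False
      \<comment> \<open>The remainder modulo \<open>m\<close> is real, has degree at most one and
        vanishes at the non-real \<open>w\<close>; hence it is zero.\<close>
      define R where "R = P mod m"
      have "m \<noteq> 0" by (simp add: m_def)
      then have "R = 0 \<or> degree R < degree m" unfolding R_def by (rule degree_mod_less)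
      then have "degree R \<le> 1" by (auto simp: m_def)
      obtain c R1 where R1: "R = pCons c R1" by (cases R)
      with \<open>degree R \<le> 1\<close> have "degree R1 = 0" by (simp add: degree_pCons_eq_if split: if_splits)
      then obtain d where R: "R = [:c, d:]" using R1 by (metis degree_eq_zeroE)
      have "P = m * (P div m) + R" by (simp add: R_def)
      then have "cpoly R w = 0" using w mz[of w] by (metis add_0 cpoly_add cpoly_mult diff_self mult_zero_left)
      then have "d = 0 \<and> c = 0" using False by (auto simp: R map_poly_pCons complex_eq_iff)
      then have P: "P = m * (P div m)" using R R_def by (metis div_mult_mod_eq add.right_neutral mult.commute pCons_0_0)
      moreover have "poly (P div m) x \<ge> 0" for x
      proof -
        have "poly m x > 0" using mpos[of x] False by (simp add: add_nonneg_pos)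
        moreover have "poly m x * poly (P div m) x \<ge> 0" using less.prems[of x] P by (metis poly_mult)
        ultimately show ?thesis by (simp add: zero_le_mult_iff)
      qed
      ultimately show ?thesis by blast
    next
      case True
      define a where "a = Re w"
      have wa: "w = of_real a" using True by (simp add: a_def complex_eq_iff)
      then have "poly P a = 0" using w by (simp add: cpoly_of_real)
      then obtain Q where Q: "P = [:-a, 1:] * Q" by (auto simp: poly_eq_0_iff_dvd elim: dvdE)
      \<comment> \<open>\<open>x - a\<close> changes sign at \<open>a\<close> while \<open>P\<close>
        does not, so \<open>Q\<close> is nonnegative to the right of \<open>a\<close> and
        nonpositive to the left. Continuity from both sides gives \<open>poly Q a = 0\<close>: the
        root is double.\<close>
      have cont: "(poly q \<longlongrightarrow> poly q a) (at_right a)" "(poly q \<longlongrightarrow> poly q a) (at_left a)" for q :: "real poly"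
        by (intro tendsto_intros; simp)+
      have PQ: "poly P x = (x - a) * poly Q x" for x by (simp add: Q algebra_simps)
      have "poly Q x \<ge> 0" if "x > a" for x
        using less.prems[of x] that PQ[of x] by (auto simp: zero_le_mult_iff)
      then have "poly Q a \<ge> 0"
        by (intro tendsto_lowerbound[OF cont(1)]) (auto intro!: eventually_at_rightI[of a "a+1"])
      moreover have "poly Q x \<le> 0" if "x < a" for x
        using less.prems[of x] that PQ[of x] by (auto simp: zero_le_mult_iff)
      then have "poly Q a \<le> 0"
        by (intro tendsto_upperbound[OF cont(2)]) (auto intro!: eventually_at_leftI[of "a-1" a])
      ultimately have "poly Q a = 0" by simp
      then obtain R where R: "Q = [:-a, 1:] * R" by (auto simp: poly_eq_0_iff_dvd elim: dvdE)
      have PR: "poly P x = (x - a)\<^sup>2 * poly R x" for x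
        by (simp add: Q R power2_eq_square algebra_simps)
      have Rpos: "poly R x \<ge> 0" if "x > a" for x
        using less.prems[of x] that PR[of x] by (auto simp: zero_le_mult_iff)
      then have Ra: "poly R a \<ge> 0"
        by (intro tendsto_lowerbound[OF cont(1)]) (auto intro!: eventually_at_rightI[of a "a+1"])
      have "poly R x \<ge> 0" if "x < a" for x
        using less.prems[of x] that PR[of x] by (auto simp: zero_le_mult_iff)
      then have "poly R x \<ge> 0" for x using Rpos Ra by (cases x a rule: linorder_cases) auto
      moreover have "P = m * R"
      proof -
        have "poly P = poly (m * R)" using True by (auto simp: fun_eq_iff PR mpos a_def)
        then show ?thesis by (simp only: poly_eq_poly_eq_iff)
      qed
      ultimately show ?thesis by blast
    qed
    then obtain Q where Q: "P = m * Q" "\<And>x. poly Q x \<ge> 0" by blast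
    have "P \<noteq> 0" using False by auto
    then have "degree P = degree m + degree Q" using Q by (simp add: degree_mult_eq)
    then have "degree Q < degree P" by (simp add: m_def)
    then obtain r where r: "\<And>z. cpoly Q z = poly r z * cnj (poly r (cnj z))"
      using less.hyps[of Q] Q(2) by blast
    show ?thesis
      \<comment> \<open>The new factor contributes
        \<open>(z - w) * cnj (cnj z - w) = (z - w) * (z - cnj w)\<close>, which is \<open>m\<close>
        at \<open>z\<close>.\<close>
      by (rule exI[of _ "[:-w, 1:] * r"]) (simp add: Q cpoly_mult mz r algebra_simps)
  qed
qed

lemma poly_Im: "poly (map_poly Im s) x = Im (poly s (of_real x))"
  by (induction s) (simp_all add: map_poly_pCons)

text \<open>The quality of the one-sided approximation \<open>q\<close> of \<open>1/m\<close>, for \<open>m = (x - a)\<^sup>2 + b\<^sup>2\<close>, controls a two-sided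
  approximation of \<open>b/m\<close>: writing \<open>m q - 1 = \<bar>r\<bar>\<^sup>2\<close> and \<open>z = a + \<i> b\<close> one has \<open>r(z) cnj (r (cnj z)) = -1\<close>, so that
  \<open>r(x)/r(z) = 1 - (x - z) s(x)\<close> with \<open>\<bar>r(z)\<bar> \<ge> 1\<close>, possibly after conjugating \<open>r\<close>.\<close>

lemma resolvent_approximation:
  fixes q :: "real poly" and a b :: real
  assumes b: "b \<noteq> 0" and q: "\<And>x. 1 / ((x - a)\<^sup>2 + b\<^sup>2) \<le> poly q x"
  shows "\<exists>B :: real poly. \<forall>x. (b / ((x - a)\<^sup>2 + b\<^sup>2) - poly B x)\<^sup>2 \<le> poly q x - 1 / ((x - a)\<^sup>2 + b\<^sup>2)"
proof -
  define z where "z = Complex a b"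
  define m where "m = [:a\<^sup>2 + b\<^sup>2, - 2 * a, 1:]"
  have m: "poly m x = (x - a)\<^sup>2 + b\<^sup>2" for x
    by (simp add: m_def power2_eq_square algebra_simps)
  have mpos: "(x - a)\<^sup>2 + b\<^sup>2 > 0" for x using b by (simp add: add_nonneg_pos)
  have mz: "cpoly m z = 0"
    by (simp add: m_def z_def map_poly_pCons complex_eq_iff power2_eq_square algebra_simps)
  define P where "P = m * q + [:-1:]"
  have P: "poly P x \<ge> 0" for x
    using q[of x] mpos[of x] by (simp add: P_def m field_simps)
  obtain r0 where r0: "\<And>z. cpoly P z = poly r0 z * cnj (poly r0 (cnj z))"
    using nonneg_poly_squared_modulus[OF P] by blast
  have "cpoly P z = -1" by (simp add: P_def cpoly_add cpoly_mult mz map_poly_pCons)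
  then have "cmod (poly r0 z) * cmod (poly r0 (cnj z)) = 1"
    using r0[of z] by (metis complex_mod_cnj norm_minus_cancel norm_mult norm_one)
  then have one: "cmod (poly r0 z) \<ge> 1 \<or> cmod (poly r0 (cnj z)) \<ge> 1"
    by (smt (verit) mult_le_one norm_ge_zero mult_left_le mult_less_cancel_left1 mult_less_cancel_right2)
  \<comment> \<open>Conjugating the coefficients exchanges the moduli at \<open>z\<close> and
    \<open>cnj z\<close> and keeps those on the real line.\<close>
  define r where "r = (if cmod (poly r0 z) \<ge> 1 then r0 else map_poly cnj r0)"
  have rz: "cmod (poly r z) \<ge> 1" using one by (auto simp: r_def)
  have rx: "(cmod (poly r (of_real x)))\<^sup>2 = poly P x" for x
  proof -
    have "complex_of_real ((cmod (poly r0 (of_real x)))\<^sup>2) = complex_of_real (poly P x)"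
      using r0[of "of_real x"] by (simp add: cpoly_of_real complex_norm_square[symmetric] del: of_real_power)
    then have "(cmod (poly r0 (of_real x)))\<^sup>2 = poly P x" by (simp only: of_real_eq_iff)
    then show ?thesis by (simp add: r_def)
  qed
  have "poly (1 - Polynomial.smult (1 / poly r z) r) z = 0" using rz by auto
  then obtain s where s: "1 - Polynomial.smult (1 / poly r z) r = [:-z, 1:] * s"
    by (meson poly_eq_0_iff_dvd dvdE)
  have "(b / ((x - a)\<^sup>2 + b\<^sup>2) - poly (map_poly Im s) x)\<^sup>2 \<le> poly q x - 1 / ((x - a)\<^sup>2 + b\<^sup>2)" for x
  proof -
    define y where "y = complex_of_real x"
    have yz: "y - z \<noteq> 0" using b by (auto simp: y_def z_def complex_eq_iff)
    have nyz: "(cmod (y - z))\<^sup>2 = (x - a)\<^sup>2 + b\<^sup>2"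
      by (simp add: y_def z_def cmod_power2)
    have "1 - poly r y / poly r z = (y - z) * poly s y"
      using arg_cong[OF s, of "\<lambda>p. poly p y"] by (simp add: algebra_simps)
    then have e: "1 / (y - z) - poly s y = poly r y / (poly r z * (y - z))"
      using yz rz by (simp add: field_simps)
    have "Im (1 / (y - z)) = b / ((x - a)\<^sup>2 + b\<^sup>2)"
      by (simp add: y_def z_def Im_divide)
    then have "(b / ((x - a)\<^sup>2 + b\<^sup>2) - poly (map_poly Im s) x)\<^sup>2 = (Im (1 / (y - z) - poly s y))\<^sup>2"
      by (simp add: poly_Im y_def)
    also have "\<dots> \<le> (cmod (1 / (y - z) - poly s y))\<^sup>2"
      using abs_Im_le_cmod by (metis abs_le_square_iff abs_norm_cancel)
    also have "\<dots> = (cmod (poly r y))\<^sup>2 / ((cmod (poly r z))\<^sup>2 * (cmod (y - z))\<^sup>2)"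
      by (simp add: e norm_divide norm_mult power_divide power_mult_distrib)
    also have "\<dots> \<le> (cmod (poly r y))\<^sup>2 / (1 * (cmod (y - z))\<^sup>2)"
    proof (intro divide_left_mono mult_right_mono)
      have "0 < cmod (poly r z)" "0 < cmod (y - z)" using rz yz by auto
      then show "0 < (cmod (poly r z))\<^sup>2 * (cmod (y - z))\<^sup>2 * (1 * (cmod (y - z))\<^sup>2)" by simp
    qed (use rz in \<open>auto simp: one_le_power\<close>)
    also have "\<dots> = poly P x / ((x - a)\<^sup>2 + b\<^sup>2)"
      using rx[of x] nyz by (simp add: y_def)
    also have "\<dots> = poly q x - 1 / ((x - a)\<^sup>2 + b\<^sup>2)"
    proof -
      have "poly P x = ((x - a)\<^sup>2 + b\<^sup>2) * poly q x - 1" by (simp add: P_def m)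
      then show ?thesis using mpos[of x] b by (simp add: diff_divide_distrib)
    qed
    finally show ?thesis .
  qed
  then show ?thesis by blast
qed

section \<open>Products of square integrable functions\<close>

lemma square_integrable_mult:
  fixes f g :: "'a \<Rightarrow> real"
  assumes [measurable]: "f \<in> borel_measurable M" "g \<in> borel_measurable M"
    and i: "integrable M (\<lambda>x. (f x)\<^sup>2)" "integrable M (\<lambda>x. (g x)\<^sup>2)"
  shows "integrable M (\<lambda>x. f x * g x)"
proof (rule Bochner_Integration.integrable_bound[OF Bochner_Integration.integrable_add[OF i]])
  have "\<bar>f x * g x\<bar> \<le> (f x)\<^sup>2 + (g x)\<^sup>2" for x
  proof -
    have "2 * (\<bar>f x\<bar> * \<bar>g x\<bar>) \<le> (f x)\<^sup>2 + (g x)\<^sup>2"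
      using zero_le_power2[of "\<bar>f x\<bar> - \<bar>g x\<bar>"] by (simp add: power2_diff)
    moreover have "0 \<le> \<bar>f x\<bar> * \<bar>g x\<bar>" by simp
    ultimately show ?thesis unfolding abs_mult by linarith
  qed
  then show "AE x in M. norm (f x * g x) \<le> norm ((f x)\<^sup>2 + (g x)\<^sup>2)" by simp
qed simp

lemma cauchy_schwarz_integral:
  fixes f g :: "'a \<Rightarrow> real"
  assumes [measurable]: "f \<in> borel_measurable M" "g \<in> borel_measurable M"
    and i: "integrable M (\<lambda>x. (f x)\<^sup>2)" "integrable M (\<lambda>x. (g x)\<^sup>2)"
  shows "(\<integral>x. f x * g x \<partial>M)\<^sup>2 \<le> (\<integral>x. (f x)\<^sup>2 \<partial>M) * (\<integral>x. (g x)\<^sup>2 \<partial>M)"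
proof -
  define A B C where "A = (\<integral>x. (f x)\<^sup>2 \<partial>M)" "B = (\<integral>x. f x * g x \<partial>M)" "C = (\<integral>x. (g x)\<^sup>2 \<partial>M)"
  note fg = square_integrable_mult[OF assms]
  have q: "0 \<le> A + 2 * l * B + l\<^sup>2 * C" for l
  proof -
    have "0 \<le> (\<integral>x. (f x + l * g x)\<^sup>2 \<partial>M)" by simp
    also have "(\<lambda>x. (f x + l * g x)\<^sup>2) = (\<lambda>x. (f x)\<^sup>2 + 2 * l * (f x * g x) + l\<^sup>2 * (g x)\<^sup>2)"
      by (auto simp: power2_eq_square algebra_simps)
    finally show ?thesis using i fg by (simp add: A_B_C_def)
  qed
  have "B\<^sup>2 \<le> A * C"
  proof (cases "C = 0")
    case True
    have "B = 0"
    proof (rule ccontr)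
      assume "B \<noteq> 0"
      \<comment> \<open>For \<open>C = 0\<close> the quadratic degenerates to
        \<open>A + 2 * l * B\<close>, which takes the value -1 at this \<open>l\<close>.\<close>
      then show False using q[of "- (A + 1) / (2 * B)"] True by (simp add: field_simps)
    qed
    then show ?thesis using True by simp
  next
    case False
    then have "C > 0" using A_B_C_def(3) by (simp add: order_less_le)
    then show ?thesis using q[of "- B / C"] by (simp add: field_simps power2_eq_square)
  qed
  then show ?thesis by (simp add: A_B_C_def)
qed

lemma borel_measurable_poly [measurable]:
  fixes q :: "real poly"
  assumes "f \<in> borel_measurable M"
  shows "(\<lambda>x. poly q (f x)) \<in> borel_measurable M"
  by (rule borel_measurable_continuous_on[OF _ assms]) (intro continuous_intros)

section \<open>Integrals of polynomial majorants\<close>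

locale moment_law = real_distribution \<mu> for \<mu> +
  assumes power_integrable: "integrable \<mu> (\<lambda>x. x ^ n)"
begin

lemma poly_integrable: "integrable \<mu> (poly q)"
  unfolding poly_altdef by (intro Bochner_Integration.integrable_sum integrable_mult_right power_integrable)

text \<open>The linear functionals below this one are exactly the positive ones that extend the
  integration of polynomials against \<open>\<mu>\<close>.\<close>

definition upper :: "(real \<Rightarrow> real) \<Rightarrow> real" where
  "upper f = (INF q\<in>{q. \<forall>x. f x \<le> poly q x}. \<integral>x. poly q x \<partial>\<mu>)"

lemma integral_poly_mono: "(\<And>x. poly p x \<le> poly q x) \<Longrightarrow> (\<integral>x. poly p x \<partial>\<mu>) \<le> (\<integral>x. poly q x \<partial>\<mu>)"
  by (intro integral_mono poly_integrable)

lemma upper_le: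
  assumes "f \<in> poly_growth" "\<And>x. f x \<le> poly q x"
  shows "upper f \<le> (\<integral>x. poly q x \<partial>\<mu>)"
proof -
  obtain p :: "real poly" where p: "\<And>x. \<bar>f x\<bar> \<le> poly p x" using assms(1) unfolding poly_growth_def by blast
  have "bdd_below ((\<lambda>q. \<integral>x. poly q x \<partial>\<mu>) ` {q. \<forall>x. f x \<le> poly q x})"
  proof (rule bdd_belowI2)
    fix r assume "r \<in> {q. \<forall>x. f x \<le> poly q x}"
    then have "poly (-p) x \<le> poly r x" for x using p[of x] by (auto simp: abs_le_iff intro: order_trans[of _ "f x"])
    then show "(\<integral>x. poly (-p) x \<partial>\<mu>) \<le> (\<integral>x. poly r x \<partial>\<mu>)" by (rule integral_poly_mono)
  qed
  then show ?thesis unfolding upper_def by (rule cINF_lower) (use assms in auto)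
qed

lemma upper_ge:
  assumes "f \<in> poly_growth" "\<And>q. (\<And>x. f x \<le> poly q x) \<Longrightarrow> c \<le> (\<integral>x. poly q x \<partial>\<mu>)"
  shows "c \<le> upper f"
proof -
  obtain p :: "real poly" where p: "\<And>x. \<bar>f x\<bar> \<le> poly p x" using assms(1) unfolding poly_growth_def by blast
  then have "f x \<le> poly p x" for x using abs_le_D1 by blast
  then show ?thesis unfolding upper_def using assms(2) by (intro cINF_greatest) auto
qed

lemma upper_poly: "upper (poly q) = (\<integral>x. poly q x \<partial>\<mu>)"
  by (intro antisym upper_le upper_ge poly_growth_poly integral_poly_mono) auto

lemma sublinear_upper: "sublinear_on poly_growth upper"
  unfolding sublinear_on_def
proof (intro conjI ballI allI impI)
  fix f g assume fg: "f \<in> poly_growth" "g \<in> poly_growth"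
  have *: "upper (\<lambda>x. f x + g x) \<le> (\<integral>x. poly q x \<partial>\<mu>) + (\<integral>x. poly r x \<partial>\<mu>)"
    if "\<And>x. f x \<le> poly q x" "\<And>x. g x \<le> poly r x" for q r
  proof -
    have "upper (\<lambda>x. f x + g x) \<le> (\<integral>x. poly (q + r) x \<partial>\<mu>)"
      by (rule upper_le) (use fg that in \<open>auto intro: poly_growth_vs add_mono\<close>)
    then show ?thesis using poly_integrable by simp
  qed
  have "upper (\<lambda>x. f x + g x) - (\<integral>x. poly r x \<partial>\<mu>) \<le> upper f" if "\<And>x. g x \<le> poly r x" for r
    by (rule upper_ge[OF fg(1)]) (use *[OF _ that] in \<open>simp add: algebra_simps\<close>)
  then have "upper (\<lambda>x. f x + g x) - upper f \<le> upper g"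
    by (intro upper_ge[OF fg(2)]) (simp add: algebra_simps)
  then show "upper (\<lambda>x. f x + g x) \<le> upper f + upper g" by simp
next
  have le: "upper (\<lambda>x. c * f x) \<le> c * upper f" if c: "c > 0" and f: "f \<in> poly_growth" for c f
  proof -
    have "upper (\<lambda>x. c * f x) / c \<le> upper f"
    proof (rule upper_ge[OF f])
      fix q assume q: "\<And>x. f x \<le> poly q x"
      have "upper (\<lambda>x. c * f x) \<le> (\<integral>x. poly (Polynomial.smult c q) x \<partial>\<mu>)"
        by (rule upper_le[OF poly_growth_vs(3)[OF f]]) (use q c in simp)
      then show "upper (\<lambda>x. c * f x) / c \<le> (\<integral>x. poly q x \<partial>\<mu>)" using c by (simp add: field_simps)
    qed
    then show ?thesis using c by (simp add: field_simps)
  qed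
  fix c :: real and f assume c: "c > 0" and f: "f \<in> poly_growth"
  show "upper (\<lambda>x. c * f x) = c * upper f"
  proof (rule antisym)
    have "upper (\<lambda>x. (1/c) * (c * f x)) \<le> (1/c) * upper (\<lambda>x. c * f x)"
      by (rule le) (use c f poly_growth_vs in auto)
    then show "c * upper f \<le> upper (\<lambda>x. c * f x)" using c by (simp add: field_simps)
  qed (rule le[OF c f])
next
  have "poly 0 = (\<lambda>x::real. 0)" by auto
  then show "upper (\<lambda>x. 0) = 0" using upper_poly[of 0] by simp
qed

text \<open>Since Hahn--Banach attains the value of \<open>upper\<close> at \<open>\<phi>\<close>,
  the argument is direct: the functional is positive with the moments of \<open>\<mu>\<close>, so
  its representing measure is \<open>\<mu>\<close>, and this evaluates
  \<open>upper \<phi>\<close>.\<close>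

theorem upper_eq_integral:
  assumes det: "moment_determinate \<mu>" and \<phi>: "continuous_on UNIV \<phi>" "\<phi> \<in> poly_growth"
  shows "upper \<phi> = (\<integral>x. \<phi> x \<partial>\<mu>)"
proof -
  obtain L where L: "\<And>f g. f \<in> poly_growth \<Longrightarrow> g \<in> poly_growth \<Longrightarrow> L (\<lambda>x. f x + g x) = L f + L g"
    "\<And>c f. f \<in> poly_growth \<Longrightarrow> L (\<lambda>x. c * f x) = c * L f"
    "\<And>f. f \<in> poly_growth \<Longrightarrow> L f \<le> upper f" "L \<phi> = upper \<phi>"
    by (rule hahn_banach_attained[OF function_space_poly_growth sublinear_upper \<phi>(2)])
      (rule that; (assumption | simp))
  have Lp: "L (poly q) = (\<integral>x. poly q x \<partial>\<mu>)" for q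
  proof (rule antisym)
    show "L (poly q) \<le> (\<integral>x. poly q x \<partial>\<mu>)" using L(3)[OF poly_growth_poly] upper_poly by simp
    have "L (\<lambda>x. (-1) * poly q x) = - L (poly q)" using L(2)[OF poly_growth_poly, of "-1"] by simp
    moreover have "(\<lambda>x. (-1) * poly q x) = poly (-q)" by auto
    ultimately have "- L (poly q) \<le> (\<integral>x. poly (-q) x \<partial>\<mu>)"
      using L(3)[OF poly_growth_poly, of "-q"] upper_poly[of "-q"] by simp
    then show "(\<integral>x. poly q x \<partial>\<mu>) \<le> L (poly q)" by simp
  qed
  interpret P: positive_functional L
  proof
    show "0 \<le> L f" if f: "f \<in> poly_growth" "\<And>x. 0 \<le> f x" for f
    proof -
      \<comment> \<open>The zero polynomial is a majorant of \<open>- f\<close>, so \<open>L\<close>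
        is nonpositive there.\<close>
      have "upper (\<lambda>x. (-1) * f x) \<le> (\<integral>x. poly 0 x \<partial>\<mu>)"
        by (rule upper_le[OF poly_growth_vs(3)[OF f(1)]]) (use f(2) in auto)
      then show ?thesis using L(3)[OF poly_growth_vs(3)[OF f(1)], of "-1"] L(2)[OF f(1), of "-1"] by simp
    qed
    have "poly 1 = (\<lambda>x::real. 1)" by auto
    then show "L (\<lambda>x. 1) = 1" using Lp[of 1] prob_space by simp
  qed (use L in auto)
  have pw: "(\<lambda>x::real. x ^ n) = poly (monom 1 n)" for n by (auto simp: poly_monom)
  have cp: "continuous_on UNIV (poly q)" for q :: "real poly" by (intro continuous_intros)
  have "P.\<nu> = \<mu>"
    using det unfolding moment_determinate_def
    using P.represents[OF cp poly_growth_poly] Lp P.nu.prob_space_axioms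
    by (auto simp: pw)
  then show ?thesis using P.represents(2)[OF \<phi>] L(4) by simp
qed

text \<open>If \<open>g\<close> is orthogonal to all polynomials, it is orthogonal to the Poisson kernels \<open>b / ((x - a)\<^sup>2 + b\<^sup>2)\<close>,
  hence to the differences of their primitives in \<open>a\<close>. These are arctangents, which tend to step functions as
  \<open>b\<close> tends to \<open>0\<close>.\<close>

context
  fixes g :: "real \<Rightarrow> real"
  assumes det: "moment_determinate \<mu>"
    and gm [measurable]: "g \<in> borel_measurable borel" and g2: "integrable \<mu> (\<lambda>x. (g x)\<^sup>2)"
    and orth: "\<And>q :: real poly. (\<integral>x. g x * poly q x \<partial>\<mu>) = 0"
begin

lemma integrable_bounded_mult:
  assumes [measurable]: "f \<in> borel_measurable borel" and "\<And>x. \<bar>f x\<bar> \<le> C"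
  shows "integrable \<mu> (\<lambda>x. g x * f x)"
proof -
  have "integrable \<mu> (\<lambda>x. (f x)\<^sup>2)"
    using assms(2) by (intro integrable_const_bound[of _ "C\<^sup>2"]) (auto simp: abs_le_square_iff[symmetric] intro: order_trans[OF _ abs_ge_self])
  then show ?thesis using g2 by (intro square_integrable_mult) auto
qed

lemma g_integrable: "integrable \<mu> g"
  using integrable_bounded_mult[of "\<lambda>_. 1" 1] by simp

text \<open>\<open>g\<close> sees only the error of a polynomial approximation \<open>B\<close> of
  the kernel: the integral equals that of \<open>g * (\<psi> - B)\<close>. Cauchy--Schwarz and
  \<open>resolvent_approximation\<close> bound its square by \<open>C\<close> times the excess of
  the integral of a majorant \<open>q\<close> over that of \<open>\<phi>\<close>, and
  \<open>upper_eq_integral\<close> makes this excess as small as desired.\<close>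

lemma orth_poisson:
  assumes b: "b \<noteq> 0"
  shows "(\<integral>x. g x * (b / ((x - a)\<^sup>2 + b\<^sup>2)) \<partial>\<mu>) = 0" (is "?J = 0")
proof -
  have mpos: "(x - a)\<^sup>2 + b\<^sup>2 > 0" for x using b by (simp add: add_nonneg_pos)
  have mge: "(x - a)\<^sup>2 + b\<^sup>2 \<ge> b\<^sup>2" for x by simp
  define \<phi> where "\<phi> x = 1 / ((x - a)\<^sup>2 + b\<^sup>2)" for x
  have [measurable]: "\<phi> \<in> borel_measurable borel" unfolding \<phi>_def by measurable
  have \<phi>b: "\<bar>\<phi> x\<bar> \<le> 1 / b\<^sup>2" for x
    using mpos[of x] mge[of x] b by (auto simp: \<phi>_def intro!: divide_left_mono)
  have \<phi>c: "continuous_on UNIV \<phi>"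
    unfolding \<phi>_def by (intro continuous_intros) (use mpos in \<open>metis less_irrefl\<close>)
  have \<phi>i: "integrable \<mu> \<phi>" using \<phi>b by (intro integrable_const_bound[of _ "1 / b\<^sup>2"]) auto
  define \<psi> where "\<psi> x = b / ((x - a)\<^sup>2 + b\<^sup>2)" for x
  have \<psi>: "\<psi> = (\<lambda>x. b * \<phi> x)" by (auto simp: \<psi>_def \<phi>_def)
  have \<psi>b: "\<bar>\<psi> x\<bar> \<le> \<bar>b\<bar> * (1 / b\<^sup>2)" for x
    unfolding \<psi> abs_mult by (intro mult_left_mono \<phi>b) auto
  define C where "C = (\<integral>x. (g x)\<^sup>2 \<partial>\<mu>)"
  have C0: "C \<ge> 0" by (simp add: C_def)
  have "?J\<^sup>2 \<le> 0 + e" if e: "e > 0" for e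
  proof -
    \<comment> \<open>The denominator is \<open>C + 1\<close> because \<open>C\<close> may
      vanish.\<close>
    define d where "d = e / (C + 1)"
    have d: "d > 0" using e C0 by (simp add: d_def)
    have "upper \<phi> < (\<integral>x. \<phi> x \<partial>\<mu>) + d"
      using upper_eq_integral[OF det \<phi>c poly_growth_bounded[OF \<phi>b]] d by simp
    then obtain q where q: "\<And>x. \<phi> x \<le> poly q x" "(\<integral>x. poly q x \<partial>\<mu>) < (\<integral>x. \<phi> x \<partial>\<mu>) + d"
      using upper_ge[OF poly_growth_bounded[OF \<phi>b], where c="(\<integral>x. \<phi> x \<partial>\<mu>) + d"] by (meson not_le)
    obtain B :: "real poly" where B: "\<And>x. (\<psi> x - poly B x)\<^sup>2 \<le> poly q x - \<phi> x"
      using resolvent_approximation[OF b, of a q] q(1) unfolding \<phi>_def \<psi>_def by blast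
    have i1: "integrable \<mu> (\<lambda>x. poly q x - \<phi> x)" using poly_integrable \<phi>i by simp
    have i2: "integrable \<mu> (\<lambda>x. (\<psi> x - poly B x)\<^sup>2)"
      by (rule Bochner_Integration.integrable_bound[OF i1]) (use B order_trans[OF zero_le_power2 B] in \<open>auto simp: \<psi>\<close>)
    have i3: "integrable \<mu> (\<lambda>x. (poly B x)\<^sup>2)"
      using poly_integrable[of "B * B"] by (simp add: power2_eq_square[abs_def] poly_mult[abs_def])
    have "?J = (\<integral>x. g x * \<psi> x \<partial>\<mu>) - (\<integral>x. g x * poly B x \<partial>\<mu>)" using orth by (simp add: \<psi>_def)
    also have "\<dots> = (\<integral>x. g x * (\<psi> x - poly B x) \<partial>\<mu>)"
      using integrable_bounded_mult[of \<psi>, OF _ \<psi>b] square_integrable_mult[OF _ _ g2 i3]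
      by (simp add: right_diff_distrib \<psi>)
    finally have "?J\<^sup>2 \<le> C * (\<integral>x. (\<psi> x - poly B x)\<^sup>2 \<partial>\<mu>)"
      unfolding C_def using cauchy_schwarz_integral[OF _ _ g2 i2] by (simp add: \<psi>)
    also have "\<dots> \<le> C * (\<integral>x. poly q x - \<phi> x \<partial>\<mu>)"
      by (intro mult_left_mono integral_mono i1 i2 B C0)
    also have "\<dots> \<le> C * d" using q(2) poly_integrable \<phi>i C0 by (intro mult_left_mono) auto
    also have "\<dots> \<le> e" using e C0 by (simp add: d_def field_simps)
    finally show ?thesis by simp
  qed
  then have "?J\<^sup>2 \<le> 0" by (rule field_le_epsilon)
  then show ?thesis by simp
qed

text \<open>The derivative in \<open>c\<close> of \<open>arctan (n * (c - x))\<close> is the Poisson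
  kernel at \<open>c\<close> with \<open>b = 1/n\<close>, to which \<open>g\<close> is orthogonal.
  Differentiation under the integral is justified by a bound \<open>h\<^sup>2\<close> for the
  first-order Taylor remainder of the arctangent, uniform in the base point.\<close>

lemma orth_arctan:
  assumes n: "n > 0"
  shows "(\<integral>x. g x * arctan (n * (c - x)) \<partial>\<mu>) = (\<integral>x. g x * arctan (n * (d - x)) \<partial>\<mu>)"
proof -
  define \<Phi> where "\<Phi> c = (\<integral>x. g x * arctan (n * (c - x)) \<partial>\<mu>)" for c
  have atb: "\<bar>arctan u\<bar> \<le> pi / 2" for u using arctan_bounded[of u] by linarith
  have ia: "integrable \<mu> (\<lambda>x. g x * arctan (n * (c - x)))" for c
    by (rule integrable_bounded_mult[OF _ atb]) simp
  have tay: "\<bar>arctan (u + h) - arctan u - h * (1 / (1 + u\<^sup>2))\<bar> \<le> h\<^sup>2" for u h :: real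
  proof (cases "h = 0")
    case False
    \<comment> \<open>The derivative of the arctangent is Lipschitz with constant one, and the
      intermediate point of the mean value theorem is within \<open>\<bar>h\<bar>\<close> of
      \<open>u\<close>; this yields the remainder \<open>h\<^sup>2\<close>.\<close>
    have rec: "\<bar>1 / (1 + s\<^sup>2) - 1 / (1 + u\<^sup>2)\<bar> \<le> \<bar>s - u\<bar>" for s u :: real
    proof -
      have p: "0 < 1 + s\<^sup>2" "0 < 1 + u\<^sup>2" by (auto simp: add_pos_nonneg)
      have "1 / (1 + s\<^sup>2) - 1 / (1 + u\<^sup>2) = (u - s) * (u + s) / ((1 + s\<^sup>2) * (1 + u\<^sup>2))"
        using p by (simp add: field_simps power2_eq_square)
      then have "\<bar>1 / (1 + s\<^sup>2) - 1 / (1 + u\<^sup>2)\<bar> = \<bar>s - u\<bar> * (\<bar>u + s\<bar> / ((1 + s\<^sup>2) * (1 + u\<^sup>2)))"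
        using p by (simp add: abs_mult abs_divide abs_minus_commute)
      also have "\<dots> \<le> \<bar>s - u\<bar> * 1"
      proof (rule mult_left_mono)
        have "\<bar>u + s\<bar> \<le> 1 + s\<^sup>2 + u\<^sup>2"
          using zero_le_power2[of "\<bar>u\<bar> - 1/2"] zero_le_power2[of "\<bar>s\<bar> - 1/2"] abs_triangle_ineq[of u s]
          by (simp add: power2_diff power_divide)
        also have "\<dots> \<le> (1 + s\<^sup>2) * (1 + u\<^sup>2)" by (simp add: algebra_simps)
        finally show "\<bar>u + s\<bar> / ((1 + s\<^sup>2) * (1 + u\<^sup>2)) \<le> 1" using p by simp
      qed simp
      finally show ?thesis by simp
    qed
    have "\<exists>s. \<bar>s - u\<bar> \<le> \<bar>h\<bar> \<and> arctan (u + h) - arctan u = h * (1 / (1 + s\<^sup>2))"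
    proof (cases "h > 0")
      case True
      then obtain z where "z > u" "z < u + h" "arctan (u + h) - arctan u = (u + h - u) * inverse (1 + z\<^sup>2)"
        using MVT2[of u "u + h" arctan "\<lambda>x. inverse (1 + x\<^sup>2)"] DERIV_arctan by auto
      then show ?thesis by (intro exI[of _ z]) (auto simp: divide_inverse)
    next
      case neg: False
      then obtain z where "z > u + h" "z < u" "arctan u - arctan (u + h) = (u - (u + h)) * inverse (1 + z\<^sup>2)"
        using MVT2[of "u + h" u arctan "\<lambda>x. inverse (1 + x\<^sup>2)"] DERIV_arctan False by auto
      then show ?thesis using neg by (intro exI[of _ z]) (auto simp: divide_inverse)
    qed
    then obtain s where s: "\<bar>s - u\<bar> \<le> \<bar>h\<bar>" "arctan (u + h) - arctan u = h * (1 / (1 + s\<^sup>2))" by blast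
    have "\<bar>h * (1 / (1 + s\<^sup>2)) - h * (1 / (1 + u\<^sup>2))\<bar> = \<bar>h\<bar> * \<bar>1 / (1 + s\<^sup>2) - 1 / (1 + u\<^sup>2)\<bar>"
      by (simp add: abs_mult[symmetric] right_diff_distrib)
    also have "\<dots> \<le> \<bar>h\<bar> * \<bar>h\<bar>" using rec[of s u] s(1) by (intro mult_left_mono) auto
    finally show ?thesis using s(2) by (simp add: power2_eq_square)
  qed simp
  have "(\<Phi> has_real_derivative 0) (at c)" for c
  proof -
    define D where "D = n\<^sup>2 * (\<integral>x. \<bar>g x\<bar> \<partial>\<mu>)"
    have D: "\<bar>\<Phi> (c + h) - \<Phi> c\<bar> \<le> D * h\<^sup>2" for h
    proof -
      have "(\<integral>x. g x * ((1/n) / ((x - c)\<^sup>2 + (1/n)\<^sup>2)) \<partial>\<mu>) = 0"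
        by (rule orth_poisson) (use n in auto)
      also have "(\<lambda>x. (1/n) / ((x - c)\<^sup>2 + (1/n)\<^sup>2)) = (\<lambda>x. n * (1 / (1 + (n * (c - x))\<^sup>2)))"
      proof
        fix x
        have T: "(1/n) / ((1 + T) / n\<^sup>2) = n * (1 / (1 + T))" if "T \<ge> 0" for T
          using n that by (simp add: power2_eq_square)
        have "(1/n) / ((1 + (n * (c - x))\<^sup>2) / n\<^sup>2) = n * (1 / (1 + (n * (c - x))\<^sup>2))"
          by (rule T) simp
        moreover have "(x - c)\<^sup>2 + (1/n)\<^sup>2 = (1 + (n * (c - x))\<^sup>2) / n\<^sup>2"
          using n by (simp add: field_simps power2_eq_square)
        ultimately show "(1/n) / ((x - c)\<^sup>2 + (1/n)\<^sup>2) = n * (1 / (1 + (n * (c - x))\<^sup>2))"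
          by (simp only:)
      qed
      finally have z: "(\<integral>x. g x * (n * (1 / (1 + (n * (c - x))\<^sup>2))) \<partial>\<mu>) = 0"  by meson
      have zi: "integrable \<mu> (\<lambda>x. g x * (n * (1 / (1 + (n * (c - x))\<^sup>2))))"
      proof (rule integrable_bounded_mult)
        have p: "1 \<le> 1 + (n * (c - x))\<^sup>2" for x by simp
        have "1 / (1 + (n * (c - x))\<^sup>2) \<le> 1" for x using frac_le[OF _ order_refl _ p[of x], of 1] by simp
        then show "\<bar>n * (1 / (1 + (n * (c - x))\<^sup>2))\<bar> \<le> n * 1" for x
          unfolding abs_mult using n by (intro mult_mono) auto
      qed simp
      define K where "K x = g x * arctan (n * (c + h - x)) - g x * arctan (n * (c - x)) - h * (g x * (n * (1 / (1 + (n * (c - x))\<^sup>2))))" for x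
      have "\<Phi> (c + h) - \<Phi> c = \<Phi> (c + h) - \<Phi> c - h * (\<integral>x. g x * (n * (1 / (1 + (n * (c - x))\<^sup>2))) \<partial>\<mu>)"
        by (simp only: z mult_zero_right diff_0_right)
      also have "\<dots> = (\<integral>x. K x \<partial>\<mu>)"
        unfolding \<Phi>_def K_def
        by (simp only: Bochner_Integration.integral_diff[OF Bochner_Integration.integrable_diff[OF ia ia] integrable_mult_right[OF zi]]
            Bochner_Integration.integral_diff[OF ia ia] integral_mult_right_zero)
      finally have eq: "\<Phi> (c + h) - \<Phi> c = (\<integral>x. K x \<partial>\<mu>)" .
      have "\<bar>\<integral>x. K x \<partial>\<mu>\<bar> \<le> (\<integral>x. n\<^sup>2 * h\<^sup>2 * \<bar>g x\<bar> \<partial>\<mu>)"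
      proof (rule order_trans[OF integral_abs_bound], rule integral_mono)
        show "integrable \<mu> (\<lambda>x. \<bar>K x\<bar>)"
          unfolding K_def by (intro integrable_abs Bochner_Integration.integrable_diff ia integrable_mult_right zi)
        show "integrable \<mu> (\<lambda>x. n\<^sup>2 * h\<^sup>2 * \<bar>g x\<bar>)" using g_integrable by auto
        fix x
        have "n * (c + h - x) = n * (c - x) + n * h" by (simp add: algebra_simps)
        then have "\<bar>K x\<bar> = \<bar>g x\<bar> * \<bar>arctan (n * (c - x) + n * h) - arctan (n * (c - x)) - (n * h) * (1 / (1 + (n * (c - x))\<^sup>2))\<bar>"
          unfolding K_def by (simp only: abs_mult[symmetric]) (simp add: algebra_simps)
        also have "\<dots> \<le> \<bar>g x\<bar> * (n * h)\<^sup>2" by (intro mult_left_mono tay) auto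
        finally show "\<bar>K x\<bar> \<le> n\<^sup>2 * h\<^sup>2 * \<bar>g x\<bar>"
          by (simp add: power_mult_distrib mult_ac)
      qed
      then show ?thesis by (simp add: eq D_def mult_ac)
    qed
    have D0: "D \<ge> 0" by (simp add: D_def)
    have "((\<lambda>h. (\<Phi> (c + h) - \<Phi> c) / h) \<longlongrightarrow> 0) (at 0)"
    proof (rule Lim_null_comparison)
      have "norm ((\<Phi> (c + h) - \<Phi> c) / h) \<le> D * \<bar>h\<bar>" if "h \<noteq> 0" for h
      proof -
        have "h\<^sup>2 = \<bar>h\<bar> * \<bar>h\<bar>" by (simp add: power2_eq_square)
        then show ?thesis using D[of h] that by (simp add: abs_divide divide_le_eq mult.assoc)
      qed
      then show "\<forall>\<^sub>F h in at 0. norm ((\<Phi> (c + h) - \<Phi> c) / h) \<le> D * \<bar>h\<bar>"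
        by (auto simp: eventually_at_filter)
      show "((\<lambda>h. D * \<bar>h\<bar>) \<longlongrightarrow> 0) (at 0)" by (intro tendsto_eq_intros) auto
    qed
    then show ?thesis by (simp add: DERIV_def)
  qed
  then have "\<Phi> c = \<Phi> d" by (intro DERIV_isconst_all allI)
  then show ?thesis by (simp add: \<Phi>_def)
qed

text \<open>As \<open>n\<close> grows, the arctangents tend to \<open>pi/2 * sgn\<close>, so the
  integral does not depend on \<open>d\<close>. Along \<open>d = - n\<close> it tends to
  \<open>- pi/2\<close> times the integral of \<open>g\<close>, which vanishes because constants are
  polynomials.\<close>

lemma orth_sgn: "(\<integral>x. g x * sgn (d - x) \<partial>\<mu>) = 0"
proof -
  have lim1: "(\<lambda>n. \<integral>x. g x * arctan (real (Suc n) * (d - x)) \<partial>\<mu>) \<longlonglongrightarrow> (\<integral>x. g x * (pi/2 * sgn (d - x)) \<partial>\<mu>)" for d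
  proof (rule integral_dominated_convergence[where w="\<lambda>x. \<bar>g x\<bar> * (pi/2)"])
    show "integrable \<mu> (\<lambda>x. \<bar>g x\<bar> * (pi/2))" using g_integrable by simp
    have "(\<lambda>n. arctan (real (Suc n) * u)) \<longlonglongrightarrow> pi/2 * sgn u" for u :: real
    proof (cases u "0::real" rule: linorder_cases)
      case equal then show ?thesis by simp
    next
      case greater
      then have "filterlim (\<lambda>n. real (Suc n) * u) at_top sequentially" by real_asymp
      then show ?thesis using tendsto_arctan_at_top greater by (auto intro: filterlim_compose)
    next
      case less
      then have "filterlim (\<lambda>n. real (Suc n) * u) at_bot sequentially" by real_asymp
      then show ?thesis using tendsto_arctan_at_bot less by (auto intro: filterlim_compose)
    qed
    then show "AE x in \<mu>. (\<lambda>n. g x * arctan (real (Suc n) * (d - x))) \<longlonglongrightarrow> g x * (pi/2 * sgn (d - x))"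
      by (intro AE_I2 tendsto_mult_left)
    have "\<bar>arctan u\<bar> \<le> pi / 2" for u using arctan_bounded[of u] by linarith
    then show "AE x in \<mu>. norm (g x * arctan (real (Suc n) * (d - x))) \<le> \<bar>g x\<bar> * (pi/2)" for n
      unfolding real_norm_def abs_mult by (intro AE_I2 mult_left_mono) auto
  qed auto
  have eq: "(\<integral>x. g x * (pi/2 * sgn (d - x)) \<partial>\<mu>) = (\<integral>x. g x * (pi/2 * sgn (c - x)) \<partial>\<mu>)" for c d
  proof -
    have *: "(\<lambda>n. \<integral>x. g x * arctan (real (Suc n) * (d - x)) \<partial>\<mu>) = (\<lambda>n. \<integral>x. g x * arctan (real (Suc n) * (c - x)) \<partial>\<mu>)"
      by (intro ext orth_arctan) simp
    show ?thesis using lim1[of d] lim1[of c] unfolding * by (rule LIMSEQ_unique)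
  qed
  have "(\<lambda>n. \<integral>x. g x * (pi/2 * sgn (- real n - x)) \<partial>\<mu>) \<longlonglongrightarrow> (\<integral>x. g x * (pi/2 * - 1) \<partial>\<mu>)"
  proof (rule integral_dominated_convergence[where w="\<lambda>x. \<bar>g x\<bar> * (pi/2)"])
    show "integrable \<mu> (\<lambda>x. \<bar>g x\<bar> * (pi/2))" using g_integrable by simp
    have "(\<lambda>n. g x * (pi/2 * sgn (- real n - x))) \<longlonglongrightarrow> g x * (pi/2 * -1)" for x
    proof (rule tendsto_eventually)
      obtain N where "- x < real N" using reals_Archimedean2 by blast
      then show "\<forall>\<^sub>F n in sequentially. g x * (pi/2 * sgn (- real n - x)) = g x * (pi/2 * -1)"
        by (intro eventually_sequentiallyI[of N]) (auto simp: sgn_if)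
    qed
    then show "AE x in \<mu>. (\<lambda>n. g x * (pi/2 * sgn (- real n - x))) \<longlonglongrightarrow> g x * (pi/2 * -1)" by blast
    show "AE x in \<mu>. norm (g x * (pi/2 * sgn (- real n - x))) \<le> \<bar>g x\<bar> * (pi/2)" for n
      by (intro AE_I2) (auto simp: abs_mult sgn_if intro!: mult_left_mono)
  qed auto
  then have "(\<lambda>n. \<integral>x. g x * (pi/2 * sgn (d - x)) \<partial>\<mu>) \<longlonglongrightarrow> (\<integral>x. g x * (pi/2 * - 1) \<partial>\<mu>)"
    by (simp only: eq[of "- real n" d for n])
  then have "(\<integral>x. g x * (pi/2 * sgn (d - x)) \<partial>\<mu>) = (\<integral>x. g x * (pi/2 * - 1) \<partial>\<mu>)"
    by (simp add: LIMSEQ_const_iff)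
  moreover have "(\<integral>x. g x \<partial>\<mu>) = 0" using orth[of 1] by simp
  ultimately have "(pi/2) * (\<integral>x. g x * sgn (d - x) \<partial>\<mu>) = 0"
    by (subst integral_mult_right_zero[symmetric]) (simp add: mult_ac)
  then show ?thesis by simp
qed

text \<open>Since \<open>sgn 0 = 0\<close>, a jump placed at \<open>d\<close> would count an atom
  there by half. Approaching \<open>d\<close> from the right gives the limit
  \<open>2 * indicator {..d} x - 1\<close>, with value one at \<open>d\<close> itself.\<close>

lemma orth_atMost: "(\<integral>x. g x * indicator {..d} x \<partial>\<mu>) = 0"
proof -
  have "(\<lambda>n. \<integral>x. g x * sgn (d + 1 / real (Suc n) - x) \<partial>\<mu>) \<longlonglongrightarrow> (\<integral>x. g x * (2 * indicator {..d} x - 1) \<partial>\<mu>)"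
  proof (rule integral_dominated_convergence[where w="\<lambda>x. \<bar>g x\<bar>"])
    show "integrable \<mu> (\<lambda>x. \<bar>g x\<bar>)" using g_integrable by simp
    have "(\<lambda>n. g x * sgn (d + 1 / real (Suc n) - x)) \<longlonglongrightarrow> g x * (2 * indicator {..d} x - 1)" for x
    proof (rule tendsto_eventually, cases "x \<le> d")
      case True
      have "0 < d + 1 / real (Suc n) - x" for n
      proof -
        have "0 < 1 / real (Suc n)" by simp
        then show ?thesis using True by linarith
      qed
      then show "\<forall>\<^sub>F n in sequentially. g x * sgn (d + 1 / real (Suc n) - x) = g x * (2 * indicator {..d} x - 1)"
        using True by simp
    next
      case False
      then obtain N where N: "1 / real (Suc N) < x - d" using nat_approx_posE[of "x - d"] by auto
      have "d + 1 / real (Suc n) - x < 0" if "n \<ge> N" for n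
      proof -
        have "1 / real (Suc n) \<le> 1 / real (Suc N)" using that by (simp add: frac_le)
        then show ?thesis using N by linarith
      qed
      then show "\<forall>\<^sub>F n in sequentially. g x * sgn (d + 1 / real (Suc n) - x) = g x * (2 * indicator {..d} x - 1)"
        using False by (intro eventually_sequentiallyI[of N]) simp
    qed
    then show "AE x in \<mu>. (\<lambda>n. g x * sgn (d + 1 / real (Suc n) - x)) \<longlonglongrightarrow> g x * (2 * indicator {..d} x - 1)" by blast
    show "AE x in \<mu>. norm (g x * sgn (d + 1 / real (Suc n) - x)) \<le> \<bar>g x\<bar>" for n
      by (intro AE_I2) (auto simp: abs_mult sgn_if)
  qed auto
  moreover have "(\<lambda>x. g x * (2 * indicator {..d} x - 1)) = (\<lambda>x. 2 * (g x * indicator {..d} x) - g x)"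
    by (auto simp: algebra_simps)
  ultimately have "(\<integral>x. 2 * (g x * indicator {..d} x) - g x \<partial>\<mu>) = 0" by (simp add: orth_sgn LIMSEQ_const_iff)
  moreover have "integrable \<mu> (\<lambda>x. g x * indicator {..d} x)"
    by (rule integrable_bounded_mult[of _ 1]) (auto simp: indicator_def)
  moreover have "(\<integral>x. g x \<partial>\<mu>) = 0" using orth[of 1] by simp
  ultimately show ?thesis using g_integrable by simp
qed

text \<open>\<open>ennreal\<close> cuts off negative values, so \<open>N 1\<close> and
  \<open>N (-1)\<close> have the positive and the negative part of \<open>g\<close> as densities.
  Equal distribution functions make these measures equal, and two parts that are never positive
  together agree only where both vanish.\<close>

theorem orthogonal_to_polynomials_AE_zero: "AE x in \<mu>. g x = 0"
proof -
  define N where "N s = density \<mu> (\<lambda>x. ennreal (s * g x))" for s :: real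
  have fin: "(\<integral>\<^sup>+x. ennreal (s * g x) \<partial>\<mu>) < \<infinity>" for s
    using integrable_mult_right[OF g_integrable, of s] unfolding integrable_iff_bounded
    by (auto intro!: le_less_trans[OF nn_integral_mono[of \<mu> "\<lambda>x. ennreal (s * g x)" "\<lambda>x. ennreal \<bar>s * g x\<bar>"]])
  have fb: "finite_borel_measure (N s)" for s
    unfolding N_def finite_borel_measure_def finite_borel_measure_axioms_def
  proof (intro conjI finite_measureI)
    show "emeasure (density \<mu> (\<lambda>x. ennreal (s * g x))) (space (density \<mu> (\<lambda>x. ennreal (s * g x)))) \<noteq> \<infinity>"
      using fin[of s] by (subst emeasure_density) (auto simp: less_top[symmetric])
  qed simp
  have "cdf (N 1) d = cdf (N (-1)) d" for d
  proof -
    have "emeasure (N s) {..d} = (\<integral>\<^sup>+x. ennreal (s * g x * indicator {..d} x) \<partial>\<mu>)" for s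
      unfolding N_def by (subst emeasure_density) (auto intro!: nn_integral_cong simp: indicator_def)
    then have m: "measure (N s) {..d} = enn2real (\<integral>\<^sup>+x. ennreal (s * g x * indicator {..d} x) \<partial>\<mu>)" for s
      by (simp add: measure_def)
    have "integrable \<mu> (\<lambda>x. g x * indicator {..d} x)"
      by (rule integrable_bounded_mult[of _ 1]) (auto simp: indicator_def)
    from real_lebesgue_integral_def[OF this] orth_atMost[of d] show ?thesis by (simp add: m cdf_def)
  qed
  then have "N 1 = N (-1)" by (intro cdf_unique' fb) auto
  then have "AE x in \<mu>. ennreal (1 * g x) = ennreal (-1 * g x)"
    unfolding N_def by (subst (asm) density_unique_iff) auto
  then show ?thesis
  proof eventually_elim
    fix x assume *: "ennreal (1 * g x) = ennreal (-1 * g x)"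
    show "g x = 0"
      by (cases "g x" "0 :: real" rule: linorder_cases) (use * in \<open>auto simp: ennreal_neg\<close>)
  qed
qed

end

end

section \<open>Expansions in $L_2(\mu)$\<close>

lemma L2_measurable: "f \<in> L2 M \<Longrightarrow> f \<in> borel_measurable M"
  and L2_integrable: "f \<in> L2 M \<Longrightarrow> integrable M (\<lambda>x. (f x)\<^sup>2)"
  by (auto simp: L2_def)

lemma L2I: "f \<in> borel_measurable M \<Longrightarrow> integrable M (\<lambda>x. (f x)\<^sup>2) \<Longrightarrow> f \<in> L2 M"
  by (auto simp: L2_def)

lemma L2_mult_integrable: "f \<in> L2 M \<Longrightarrow> g \<in> L2 M \<Longrightarrow> integrable M (\<lambda>x. f x * g x)"
  by (intro square_integrable_mult L2_measurable L2_integrable)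

lemma L2_scale: "f \<in> L2 M \<Longrightarrow> (\<lambda>x. c * f x) \<in> L2 M"
  by (auto simp: L2_def power_mult_distrib)

lemma L2_add: assumes "f \<in> L2 M" "g \<in> L2 M" shows "(\<lambda>x. f x + g x) \<in> L2 M"
proof (rule L2I)
  show "(\<lambda>x. f x + g x) \<in> borel_measurable M"
    by (intro borel_measurable_add assms[THEN L2_measurable])
  have "integrable M (\<lambda>x. (f x)\<^sup>2 + 2 * (f x * g x) + (g x)\<^sup>2)"
    by (intro Bochner_Integration.integrable_add L2_integrable integrable_mult_right L2_mult_integrable assms)
  then show "integrable M (\<lambda>x. (f x + g x)\<^sup>2)" by (simp add: power2_sum mult.assoc add_ac)
qed

lemma L2_uminus: "f \<in> L2 M \<Longrightarrow> (\<lambda>x. - f x) \<in> L2 M"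
  using L2_scale[of f M "-1"] by simp

lemma L2_diff: "f \<in> L2 M \<Longrightarrow> g \<in> L2 M \<Longrightarrow> (\<lambda>x. f x - g x) \<in> L2 M"
  using L2_add[of f M "\<lambda>x. - g x"] L2_uminus[of g M] by simp

lemma L2_norm_nonneg [simp]: "0 \<le> L2_norm M f"
  by (simp add: L2_norm_def)

lemma L2_norm_power2: "(L2_norm M f)\<^sup>2 = (\<integral>x. (f x)\<^sup>2 \<partial>M)"
  by (simp add: L2_norm_def)

lemma L2_norm_cong_AE:
  assumes "f \<in> borel_measurable M" "g \<in> borel_measurable M" "AE x in M. f x = g x"
  shows "L2_norm M f = L2_norm M g"
  unfolding L2_norm_def using assms by (intro arg_cong[of _ _ sqrt] integral_cong_AE) auto

lemma L2_cong_AE: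
  assumes "f \<in> L2 M" "g \<in> borel_measurable M" "AE x in M. f x = g x"
  shows "g \<in> L2 M"
proof (rule L2I[OF assms(2)])
  have fm: "f \<in> borel_measurable M" using assms(1) by (rule L2_measurable)
  have "integrable M (\<lambda>x. (f x)\<^sup>2) = integrable M (\<lambda>x. (g x)\<^sup>2)"
    using fm assms(2,3) by (intro integrable_cong_AE) auto
  then show "integrable M (\<lambda>x. (g x)\<^sup>2)" using L2_integrable[OF assms(1)] by simp
qed

lemma L2_norm_scale: "L2_norm M (\<lambda>x. c * f x) = \<bar>c\<bar> * L2_norm M f"
  by (simp add: L2_norm_def power_mult_distrib real_sqrt_mult)

lemma L2_norm_minus: "L2_norm M (\<lambda>x. f x - g x) = L2_norm M (\<lambda>x. g x - f x)"
  by (simp add: L2_norm_def power2_commute)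

lemma abs_inner_le_L2_norm:
  assumes "f \<in> L2 M" "g \<in> L2 M"
  shows "\<bar>\<integral>x. f x * g x \<partial>M\<bar> \<le> L2_norm M f * L2_norm M g"
proof -
  have "\<bar>\<integral>x. f x * g x \<partial>M\<bar>\<^sup>2 \<le> (L2_norm M f * L2_norm M g)\<^sup>2"
    using cauchy_schwarz_integral[OF assms[THEN L2_measurable] assms[THEN L2_integrable]]
    by (simp add: power_mult_distrib L2_norm_power2)
  then show ?thesis by (rule power2_le_imp_le) simp
qed

lemma L2_norm_add_le:
  assumes f: "f \<in> L2 M" and g: "g \<in> L2 M"
  shows "L2_norm M (\<lambda>x. f x + g x) \<le> L2_norm M f + L2_norm M g"
proof (rule power2_le_imp_le)
  have "(L2_norm M (\<lambda>x. f x + g x))\<^sup>2 = (\<integral>x. (f x)\<^sup>2 + 2 * (f x * g x) + (g x)\<^sup>2 \<partial>M)"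
    unfolding L2_norm_power2 by (intro Bochner_Integration.integral_cong) (auto simp: power2_sum)
  also have "\<dots> = (L2_norm M f)\<^sup>2 + 2 * (\<integral>x. f x * g x \<partial>M) + (L2_norm M g)\<^sup>2"
    using L2_integrable[OF f] L2_integrable[OF g] L2_mult_integrable[OF f g] by (simp add: L2_norm_power2)
  also have "\<dots> \<le> (L2_norm M f + L2_norm M g)\<^sup>2"
    using abs_inner_le_L2_norm[OF f g] by (simp add: power2_sum)
  finally show "(L2_norm M (\<lambda>x. f x + g x))\<^sup>2 \<le> (L2_norm M f + L2_norm M g)\<^sup>2" .
qed simp

lemma L2_norm_zero_iff:
  assumes "f \<in> L2 M"
  shows "L2_norm M f = 0 \<longleftrightarrow> (AE x in M. f x = 0)"
  using integral_nonneg_eq_0_iff_AE[OF L2_integrable[OF assms]] by (simp add: L2_norm_def)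

text \<open>Each point off the support has a null neighbourhood, which may be taken from a countable
  basis; so countably many null sets cover the complement.\<close>

lemma (in real_distribution) AE_supp: "AE x in M. x \<in> supp M"
proof -
  obtain B :: "real set set" where B: "countable B" "topological_basis B"
    using ex_countable_basis by blast
  define N where "N = {b \<in> B. emeasure M b = 0}"
  have "\<Union>N \<in> null_sets M"
  proof (rule null_sets_UN'[of N "\<lambda>b. b", simplified])
    show "countable N" using B(1) by (auto simp: N_def intro: countable_subset)
    show "b \<in> null_sets M" if "b \<in> N" for b
      using that topological_basis_open[OF B(2)] by (auto simp: N_def)
  qed
  moreover have "x \<in> \<Union>N" if x: "x \<notin> supp M" for x
  proof -
    obtain U where U: "open U" "x \<in> U" "emeasure M U = 0" using x unfolding supp_def by (auto simp: zero_less_iff_neq_zero)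
    then obtain b where b: "b \<in> B" "x \<in> b" "b \<subseteq> U" using topological_basisE[OF B(2)] by metis
    have "emeasure M b \<le> emeasure M U" using b U by (intro emeasure_mono) auto
    then show ?thesis using b U by (auto simp: N_def)
  qed
  ultimately show ?thesis by (intro AE_I'[of "\<Union>N"]) auto
qed

lemma (in real_distribution) supp_size_pos: "0 < supp_size M"
proof -
  have "supp M \<noteq> {}"
  proof
    assume "supp M = {}"
    then have "AE x in M. False" using AE_supp by simp
    then show False using AE_False by simp
  qed
  then show ?thesis by (auto simp: supp_size_def card_gt_0_iff zero_enat_def)
qed

lemma (in real_distribution) AE_poly_zero_imp:
  assumes "AE x in M. poly p x = 0" "x \<in> supp M"
  shows "poly p x = 0"
proof (rule ccontr)
  assume "poly p x \<noteq> 0"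
  moreover have "open {y. poly p y \<noteq> 0}" by (intro open_Collect_neq continuous_intros)
  ultimately have "0 < emeasure M {y. poly p y \<noteq> 0}" using assms(2) by (auto simp: supp_def)
  moreover have "emeasure M {y. poly p y \<noteq> 0} = 0"
    using assms(1) by (subst (asm) AE_iff_measurable[OF _ refl]) auto
  ultimately show False by simp
qed

text \<open>The origin of the bound \<open>n < v\<close>: the support would consist of roots, of
  which a nonzero polynomial has at most as many as its degree. Below that degree, monic polynomials
  can therefore be normalised.\<close>

lemma (in real_distribution) AE_poly_zero_imp_zero:
  assumes "AE x in M. poly p x = 0" "enat (degree p) < supp_size M"
  shows "p = 0"
proof (rule ccontr)
  assume p: "p \<noteq> 0"
  have sub: "supp M \<subseteq> {x. poly p x = 0}" using AE_poly_zero_imp[OF assms(1)] by auto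
  have fin: "finite {x. poly p x = 0}" using poly_roots_finite[OF p] by simp
  then have "card (supp M) \<le> degree p"
    using card_mono[OF fin sub] card_poly_roots_bound[OF p] by simp
  then show False using assms(2) finite_subset[OF sub fin] by (simp add: supp_size_def)
qed

context moment_law
begin

lemma poly_L2: "poly p \<in> L2 \<mu>"
proof (rule L2I)
  have "(\<lambda>x. (poly p x)\<^sup>2) = poly (p * p)" by (auto simp: power2_eq_square)
  then show "integrable \<mu> (\<lambda>x. (poly p x)\<^sup>2)" using poly_integrable by simp
qed simp

end

locale poly_basis = moment_law \<mu> for \<mu> +
  fixes h :: "nat \<Rightarrow> real poly"
  assumes det: "moment_determinate \<mu>" and on: "orthonormal_polys \<mu> h"
begin

definition I :: "nat set" where "I = {n. enat n < supp_size \<mu>}"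

lemma inner_h: "m \<in> I \<Longrightarrow> n \<in> I \<Longrightarrow> (\<integral>x. poly (h m) x * poly (h n) x \<partial>\<mu>) = (if m = n then 1 else 0)"
  using on by (auto simp: orthonormal_polys_def I_def)

lemma degree_h: "n \<in> I \<Longrightarrow> degree (h n) = n"
  using on by (auto simp: orthonormal_polys_def I_def)

lemma h_0: "h 0 = 1" using on by (simp add: orthonormal_polys_def)

lemma zero_in_I: "0 \<in> I" using supp_size_pos by (simp add: I_def zero_enat_def)

lemma I_down: "n \<in> I \<Longrightarrow> m \<le> n \<Longrightarrow> m \<in> I"
  unfolding I_def by (auto intro: le_less_trans[of "enat m" "enat n"])

text \<open>When the support is finite, polynomials are reduced modulo the one that vanishes on it.\<close>

lemma poly_induct_basis:
  assumes add: "\<And>p q. P p \<Longrightarrow> P q \<Longrightarrow> P (p + q)" and smult: "\<And>c p. P p \<Longrightarrow> P (Polynomial.smult c p)"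
    and cong: "\<And>p q. (\<And>x. x \<in> supp \<mu> \<Longrightarrow> poly p x = poly q x) \<Longrightarrow> P p \<Longrightarrow> P q"
    and basis: "\<And>n. n \<in> I \<Longrightarrow> P (h n)"
  shows "P p"
proof -
  have P0: "P 0" using smult[OF basis[OF zero_in_I], of 0] by simp
  have low: "P p" if "degree p \<in> I" for p
    using that
  proof (induction "degree p" arbitrary: p rule: less_induct)
    case less
    define n where "n = degree p"
    define c where "c = lead_coeff p / lead_coeff (h n)"
    define q where "q = p - Polynomial.smult c (h n)"
    have hn: "degree (h n) = n" using less.prems degree_h n_def by simp
    have hnz: "h n \<noteq> 0"
    proof
      assume "h n = 0"
      then show False using inner_h[of n n] less.prems by (simp add: n_def)
    qed
    \<comment> \<open>Subtracting the multiple of \<open>h n\<close> removes the leading term. For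
      \<open>n = 0\<close> the degree cannot drop, and the difference is zero.\<close>
    have "P q"
    proof (cases "n = 0")
      case True
      then have "degree q = 0" using hn n_def degree_diff_le[of p 0 "Polynomial.smult c (h n)"] by (simp add: q_def)
      moreover have "Polynomial.coeff q 0 = 0" using True hn hnz n_def leading_coeff_neq_0[OF hnz] by (simp add: q_def c_def)
      ultimately have "q = 0" by (metis leading_coeff_0_iff)
      then show ?thesis using P0 by simp
    next
      case False
      have "degree q \<le> n" unfolding q_def by (rule degree_diff_le) (use n_def hn in \<open>auto intro: order_trans[OF degree_smult_le]\<close>)
      moreover have "Polynomial.coeff q n = 0" using hn hnz n_def leading_coeff_neq_0[OF hnz] by (simp add: q_def c_def)
      ultimately have "degree q < n" using False by (metis leading_coeff_0_iff le_neq_implies_less degree_0 gr0I)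
      then show ?thesis using less.hyps[of q] less.prems I_down n_def by auto
    qed
    moreover have "p = q + Polynomial.smult c (h n)" by (simp add: q_def)
    ultimately show ?case using add[OF \<open>P q\<close> smult[OF basis[of n]]] less.prems n_def by metis
  qed
  show ?thesis
  proof (cases "finite (supp \<mu>)")
    case False
    then show ?thesis using low by (simp add: I_def supp_size_def)
  next
    case True
    define m where "m = (\<Prod>a\<in>supp \<mu>. [:-a, 1:])"
    have m: "degree m = card (supp \<mu>)" "m \<noteq> 0"
      using True by (auto simp: m_def degree_prod_eq_sum_degree)
    have "degree (p mod m) \<in> I"
    proof -
      have "card (supp \<mu>) > 0" using supp_size_pos True by (simp add: supp_size_def zero_enat_def)
      then have "degree (p mod m) < card (supp \<mu>)"
        using degree_mod_less[OF m(2), of p] m(1) by auto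
      then show ?thesis using True by (simp add: I_def supp_size_def)
    qed
    then have "P (p mod m)" by (rule low)
    moreover have "poly (p mod m) x = poly p x" if "x \<in> supp \<mu>" for x
    proof -
      have "poly m x = 0" unfolding m_def poly_prod using True that by (auto simp: prod_zero_iff)
      moreover have "p = m * (p div m) + p mod m" by simp
      ultimately show ?thesis by (metis add_0 mult_zero_left poly_add poly_mult)
    qed
    ultimately show ?thesis by (rule cong[rotated])
  qed
qed

lemma orthogonal_to_basis_AE_zero:
  assumes g: "g \<in> L2 \<mu>" and orth: "\<And>n. n \<in> I \<Longrightarrow> (\<integral>x. g x * poly (h n) x \<partial>\<mu>) = 0"
  shows "AE x in \<mu>. g x = 0"
proof (rule orthogonal_to_polynomials_AE_zero[OF det])
  show "g \<in> borel_measurable borel" using L2_measurable[OF g] by simp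
  show "integrable \<mu> (\<lambda>x. (g x)\<^sup>2)" by (rule L2_integrable[OF g])
  have gp: "integrable \<mu> (\<lambda>x. g x * poly q x)" for q by (rule L2_mult_integrable[OF g poly_L2])
  show "(\<integral>x. g x * poly q x \<partial>\<mu>) = 0" for q
  proof (rule poly_induct_basis[where P="\<lambda>q. (\<integral>x. g x * poly q x \<partial>\<mu>) = 0"])
    show "(\<integral>x. g x * poly (p + q) x \<partial>\<mu>) = 0" if "(\<integral>x. g x * poly p x \<partial>\<mu>) = 0" "(\<integral>x. g x * poly q x \<partial>\<mu>) = 0" for p q
      using that gp by (simp add: distrib_left)
    show "(\<integral>x. g x * poly (Polynomial.smult c p) x \<partial>\<mu>) = 0" if "(\<integral>x. g x * poly p x \<partial>\<mu>) = 0" for c p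
      using that by (simp add: mult.left_commute)
    show "(\<integral>x. g x * poly q x \<partial>\<mu>) = 0"
      if "\<And>x. x \<in> supp \<mu> \<Longrightarrow> poly p x = poly q x" "(\<integral>x. g x * poly p x \<partial>\<mu>) = 0" for p q
    proof -
      have "(\<integral>x. g x * poly q x \<partial>\<mu>) = (\<integral>x. g x * poly p x \<partial>\<mu>)"
        using AE_supp that(1) L2_measurable[OF g] by (intro integral_cong_AE) auto
      then show ?thesis using that by simp
    qed
  qed (rule orth)
qed

section \<open>Fourier coefficients and partial sums\<close>

definition psum :: "(nat \<Rightarrow> real) \<Rightarrow> nat set \<Rightarrow> real \<Rightarrow> real" where
  "psum c A x = (\<Sum>n\<in>A. c n * poly (h n) x)"

definition J :: "nat \<Rightarrow> nat set" where "J N = {n. n < N \<and> enat n < supp_size \<mu>}"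

definition coef :: "(real \<Rightarrow> real) \<Rightarrow> nat \<Rightarrow> real" where
  "coef f n = (\<integral>x. f x * poly (h n) x \<partial>\<mu>)"

lemma finite_J [simp]: "finite (J N)" by (simp add: J_def)
lemma J_sub: "J N \<subseteq> I" by (auto simp: J_def I_def)
lemma J_mono: "M \<le> N \<Longrightarrow> J M \<subseteq> J N" by (auto simp: J_def)

lemma has_expansion_iff:
  "has_expansion \<mu> h c f \<longleftrightarrow> f \<in> L2 \<mu> \<and> (\<lambda>N. L2_norm \<mu> (\<lambda>x. f x - psum c (J N) x)) \<longlonglongrightarrow> 0"
  by (simp add: has_expansion_def psum_def J_def)

lemma psum_L2: "psum c A \<in> L2 \<mu>"
proof -
  have "psum c A = poly (\<Sum>n\<in>A. Polynomial.smult (c n) (h n))" by (auto simp: psum_def poly_sum)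
  then show ?thesis using poly_L2 by metis
qed

lemma coef_psum:
  assumes "finite A" "A \<subseteq> I" "m \<in> I"
  shows "coef (psum c A) m = (if m \<in> A then c m else 0)"
proof -
  have "coef (psum c A) m = (\<Sum>n\<in>A. c n * (\<integral>x. poly (h n) x * poly (h m) x \<partial>\<mu>))"
    unfolding coef_def psum_def sum_distrib_right mult.assoc
    by (subst Bochner_Integration.integral_sum) (auto intro: L2_mult_integrable[OF poly_L2 poly_L2])
  also have "\<dots> = (\<Sum>n\<in>A. if n = m then c n else 0)"
    by (intro sum.cong refl) (use assms inner_h in auto)
  finally show ?thesis using assms by simp
qed

lemma coef_diff: "f \<in> L2 \<mu> \<Longrightarrow> g \<in> L2 \<mu> \<Longrightarrow> coef (\<lambda>x. f x - g x) n = coef f n - coef g n"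
  unfolding coef_def using L2_mult_integrable[OF _ poly_L2] by (simp add: left_diff_distrib)

lemma coef_scale: "coef (\<lambda>x. a * f x) n = a * coef f n"
  unfolding coef_def by (simp add: mult.assoc)

lemma inner_psum:
  assumes "f \<in> L2 \<mu>"
  shows "(\<integral>x. f x * psum c A x \<partial>\<mu>) = (\<Sum>n\<in>A. c n * coef f n)"
  unfolding coef_def psum_def sum_distrib_left mult.left_commute[of "f _"]
  by (subst Bochner_Integration.integral_sum) (auto intro: L2_mult_integrable[OF assms poly_L2])

lemma norm_psum:
  assumes "finite A" "A \<subseteq> I"
  shows "(L2_norm \<mu> (psum c A))\<^sup>2 = (\<Sum>n\<in>A. (c n)\<^sup>2)"
proof -
  have "(L2_norm \<mu> (psum c A))\<^sup>2 = (\<Sum>n\<in>A. c n * coef (psum c A) n)"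
    using inner_psum[OF psum_L2, of c A c A] unfolding L2_norm_power2 by (simp add: power2_eq_square)
  also have "\<dots> = (\<Sum>n\<in>A. (c n)\<^sup>2)"
    by (rule sum.cong) (use coef_psum[OF assms] assms(2) in \<open>auto simp: power2_eq_square subset_iff\<close>)
  finally show ?thesis .
qed

lemma norm_diff_psum:
  assumes f: "f \<in> L2 \<mu>" and A: "finite A" "A \<subseteq> I"
  shows "(L2_norm \<mu> (\<lambda>x. f x - psum (coef f) A x))\<^sup>2 = (L2_norm \<mu> f)\<^sup>2 - (\<Sum>n\<in>A. (coef f n)\<^sup>2)"
proof -
  have "(L2_norm \<mu> (\<lambda>x. f x - psum (coef f) A x))\<^sup>2
      = (\<integral>x. (f x)\<^sup>2 - 2 * (f x * psum (coef f) A x) + (psum (coef f) A x)\<^sup>2 \<partial>\<mu>)"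
    unfolding L2_norm_power2 by (intro Bochner_Integration.integral_cong) (auto simp: power2_diff)
  also have "\<dots> = (L2_norm \<mu> f)\<^sup>2 - 2 * (\<integral>x. f x * psum (coef f) A x \<partial>\<mu>) + (L2_norm \<mu> (psum (coef f) A))\<^sup>2"
    using L2_integrable[OF f] L2_integrable[OF psum_L2] L2_mult_integrable[OF f psum_L2] by (simp add: L2_norm_power2)
  finally show ?thesis
    by (simp add: norm_psum[OF A] inner_psum[OF f]) (simp add: power2_eq_square)
qed

lemma psum_diff: "finite B \<Longrightarrow> A \<subseteq> B \<Longrightarrow> psum c B x - psum c A x = psum c (B - A) x"
  by (simp add: psum_def sum_diff)

text \<open>Cauchy--Schwarz against \<open>h n\<close>. The filter is arbitrary because limits are
  taken both along partial sums and as \<open>t\<close> tends to zero.\<close>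

lemma coef_tendsto:
  assumes "f \<in> L2 \<mu>" "\<And>N. u N \<in> L2 \<mu>" "((\<lambda>N. L2_norm \<mu> (\<lambda>x. f x - u N x)) \<longlongrightarrow> 0) F"
  shows "((\<lambda>N. coef (u N) n) \<longlongrightarrow> coef f n) F"
proof -
  have "((\<lambda>N. coef f n - coef (u N) n) \<longlongrightarrow> 0) F"
  proof (rule Lim_null_comparison)
    show "\<forall>\<^sub>F N in F. norm (coef f n - coef (u N) n) \<le> L2_norm \<mu> (\<lambda>x. f x - u N x) * L2_norm \<mu> (poly (h n))"
      using abs_inner_le_L2_norm[OF L2_diff[OF assms(1,2)] poly_L2]
        coef_diff[OF assms(1,2)] unfolding coef_def real_norm_def by (intro always_eventually allI) metis
    show "((\<lambda>N. L2_norm \<mu> (\<lambda>x. f x - u N x) * L2_norm \<mu> (poly (h n))) \<longlongrightarrow> 0) F"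
      by (rule tendsto_mult_left_zero[OF assms(3)])
  qed
  from tendsto_diff[OF tendsto_const[of "coef f n"] this] show ?thesis by simp
qed

lemma has_expansion_L2: "has_expansion \<mu> h c f \<Longrightarrow> f \<in> L2 \<mu>"
  by (simp add: has_expansion_def)

lemma has_expansion_coef:
  assumes "has_expansion \<mu> h c f" "n \<in> I"
  shows "coef f n = c n"
proof -
  have "(\<lambda>N. coef (psum c (J N)) n) \<longlonglongrightarrow> coef f n"
    by (rule coef_tendsto) (use assms psum_L2 in \<open>auto simp: has_expansion_iff\<close>)
  moreover have "(\<lambda>N. coef (psum c (J N)) n) \<longlonglongrightarrow> c n"
  proof (rule tendsto_eventually, rule eventually_sequentiallyI[of "Suc n"])
    fix N assume "Suc n \<le> N"
    then have "n \<in> J N" using assms(2) by (simp add: J_def I_def)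
    then show "coef (psum c (J N)) n = c n" by (simp add: coef_psum[OF finite_J J_sub assms(2)])
  qed
  ultimately show ?thesis by (rule LIMSEQ_unique)
qed

text \<open>Completeness in its working form: the difference is orthogonal to every
  \<open>h n\<close>. Uniqueness of expansions, linearity of the operators and the semigroup law all
  come down to comparing coefficients.\<close>

lemma AE_eq_if_coef_eq:
  assumes "f \<in> L2 \<mu>" "g \<in> L2 \<mu>" "\<And>n. n \<in> I \<Longrightarrow> coef f n = coef g n"
  shows "AE x in \<mu>. f x = g x"
proof -
  have "AE x in \<mu>. f x - g x = 0"
    by (rule orthogonal_to_basis_AE_zero[OF L2_diff[OF assms(1,2)]])
      (use assms coef_diff[OF assms(1,2)] in \<open>auto simp: coef_def\<close>)
  then show ?thesis by simp
qed

lemma has_expansion_unique: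
  assumes "has_expansion \<mu> h c f" "has_expansion \<mu> h c g"
  shows "AE x in \<mu>. f x = g x"
  by (rule AE_eq_if_coef_eq) (use assms has_expansion_coef has_expansion_L2 in auto)

lemma bessel:
  assumes "f \<in> L2 \<mu>" "finite A" "A \<subseteq> I"
  shows "(\<Sum>n\<in>A. (coef f n)\<^sup>2) \<le> (L2_norm \<mu> f)\<^sup>2"
  using norm_diff_psum[OF assms] zero_le_power2[of "L2_norm \<mu> (\<lambda>x. f x - psum (coef f) A x)"] by linarith

text \<open>From \<open>v\<close> on, the \<open>h n\<close> are unspecified. Extension by zero
  turns sums over \<open>I\<close>, finite or not, into ordinary series over the natural
  numbers.\<close>

definition cut :: "(nat \<Rightarrow> real) \<Rightarrow> nat \<Rightarrow> real" where "cut c n = (if n \<in> I then c n else 0)"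

lemma sum_J: "(\<Sum>n\<in>J N. (c n)\<^sup>2) = (\<Sum>n<N. (cut c n)\<^sup>2)"
  by (intro sum.mono_neutral_cong_left) (auto simp: J_def I_def cut_def)

lemma psum_tail:
  assumes s: "summable (\<lambda>n. (cut c n)\<^sup>2)" and MN: "M \<le> N"
  shows "(L2_norm \<mu> (\<lambda>x. psum c (J N) x - psum c (J M) x))\<^sup>2 \<le> (\<Sum>n. (cut c (n + M))\<^sup>2)"
proof -
  have "(L2_norm \<mu> (\<lambda>x. psum c (J N) x - psum c (J M) x))\<^sup>2 = (\<Sum>n\<in>J N - J M. (c n)\<^sup>2)"
    using norm_psum[of "J N - J M" c] J_sub by (subst psum_diff) (auto simp: J_mono[OF MN])
  also have "\<dots> = (\<Sum>n<N. (cut c n)\<^sup>2) - (\<Sum>n<M. (cut c n)\<^sup>2)"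
    using sum_diff[OF finite_J J_mono[OF MN], of "\<lambda>n. (c n)\<^sup>2"] by (simp add: sum_J)
  also have "\<dots> \<le> (\<Sum>n. (cut c n)\<^sup>2) - (\<Sum>n<M. (cut c n)\<^sup>2)"
    using sum_le_suminf[OF s, of "{..<N}"] by auto
  also have "\<dots> = (\<Sum>n. (cut c (n + M))\<^sup>2)" using suminf_minus_initial_segment[OF s, of M] by simp
  finally show ?thesis .
qed

text \<open>Along the indices \<open>r k\<close> consecutive partial sums differ by at most
  \<open>(1/2) ^ k\<close> in L2, hence in L1, as \<open>\<mu>\<close> has mass one. The increments
  are then absolutely summable almost everywhere, and Fatou's lemma carries the tail bound
  \<open>T\<close> over to the limit.\<close>

theorem riesz_fischer:
  assumes s: "summable (\<lambda>n. (cut c n)\<^sup>2)"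
  shows "\<exists>g. has_expansion \<mu> h c g"
proof -
  define T where "T M = (\<Sum>n. (cut c (n + M))\<^sup>2)" for M
  have T0: "T \<longlonglongrightarrow> 0" unfolding T_def by (rule suminf_exist_split2[OF s])
  have T_nonneg: "T M \<ge> 0" for M
    unfolding T_def by (rule suminf_nonneg) (use summable_ignore_initial_segment[OF s] in auto)
  have "\<exists>M. \<forall>m\<ge>M. T m < (1/4) ^ k" for k
  proof -
    have "\<forall>\<^sub>F m in sequentially. T m < (1/4) ^ k" by (rule order_tendstoD(2)[OF T0]) simp
    then show ?thesis by (simp add: eventually_sequentially)
  qed
  then obtain r0 where r0: "\<And>k m. m \<ge> r0 k \<Longrightarrow> T m < (1/4) ^ k" by metis
  \<comment> \<open>The sum makes \<open>r\<close> increasing and keeps it above \<open>r0\<close>;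
    the summand \<open>k\<close> makes it unbounded.\<close>
  define r where "r k = (\<Sum>i\<le>k. r0 i) + k" for k
  have r_ge: "r0 k \<le> r k" for k unfolding r_def by (auto intro: trans_le_add1 member_le_sum)
  have r_mono: "r k \<le> r (Suc k)" for k by (simp add: r_def)
  have r_k: "k \<le> r k" for k by (simp add: r_def)
  define u where "u k x = psum c (J (r k)) x" for k x
  have uL2: "u k \<in> L2 \<mu>" for k unfolding u_def using psum_L2 by (simp add: eta_contract_eq)
  note um [measurable] = L2_measurable[OF uL2]
  have um' [measurable]: "u k \<in> borel_measurable borel" for k using um[of k] by simp
  define d where "d k x = \<bar>u (Suc k) x - u k x\<bar>" for k x
  have [measurable]: "d k \<in> borel_measurable borel" for k unfolding d_def by measurable
  have dL1: "(\<integral>\<^sup>+x. ennreal (d k x) \<partial>\<mu>) \<le> ennreal ((1/2) ^ k)" for k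
  proof -
    have L: "(\<lambda>x. u (Suc k) x - u k x) \<in> L2 \<mu>" by (rule L2_diff[OF uL2 uL2])
    have dL: "d k \<in> L2 \<mu>" using L unfolding d_def L2_def by auto
    have one: "(\<lambda>x. 1) \<in> L2 \<mu>" by (simp add: L2_def)
    have int: "integrable \<mu> (d k)" using L2_mult_integrable[OF dL one] by simp
    have "(\<integral>x. d k x \<partial>\<mu>) \<le> L2_norm \<mu> (d k) * L2_norm \<mu> (\<lambda>x. 1)"
      using abs_inner_le_L2_norm[OF dL one] by simp
    also have "\<dots> = L2_norm \<mu> (\<lambda>x. u (Suc k) x - u k x)"
      using prob_space by (simp add: L2_norm_def d_def)
    also have "\<dots> \<le> (1/2) ^ k"
    proof (rule power2_le_imp_le)
      have "(L2_norm \<mu> (\<lambda>x. u (Suc k) x - u k x))\<^sup>2 \<le> T (r k)"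
        unfolding u_def T_def by (rule psum_tail[OF s r_mono])
      also have "\<dots> \<le> (1/4) ^ k" using r0[OF r_ge] by (simp add: less_imp_le)
      also have "\<dots> = ((1/2) ^ k)\<^sup>2" by (simp add: power2_eq_square power_mult_distrib[symmetric])
      finally show "(L2_norm \<mu> (\<lambda>x. u (Suc k) x - u k x))\<^sup>2 \<le> ((1/2) ^ k)\<^sup>2" .
    qed simp
    finally have "(\<integral>x. d k x \<partial>\<mu>) \<le> (1/2) ^ k" .
    moreover have "0 \<le> d k x" for x by (simp add: d_def)
    ultimately show ?thesis
      by (subst nn_integral_eq_integral[OF int]) (auto intro!: ennreal_leI)
  qed
  have "(\<integral>\<^sup>+x. (\<Sum>k. ennreal (d k x)) \<partial>\<mu>) = (\<Sum>k. \<integral>\<^sup>+x. ennreal (d k x) \<partial>\<mu>)"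
    by (rule nn_integral_suminf) simp
  also have "\<dots> \<le> (\<Sum>k. ennreal ((1/2) ^ k))" by (intro suminf_le dL1) auto
  also have "\<dots> = ennreal (\<Sum>k. (1/2) ^ k)" by (intro suminf_ennreal2 summable_geometric) auto
  also have "\<dots> < \<infinity>" by simp
  finally have "AE x in \<mu>. (\<Sum>k. ennreal (d k x)) \<noteq> \<infinity>"
    by (intro nn_integral_PInf_AE) auto
  then have conv: "AE x in \<mu>. convergent (\<lambda>k. u k x)"
  proof eventually_elim
    case (elim x)
    have "summable (\<lambda>k. d k x)"
      by (rule summable_suminf_not_top) (use elim in \<open>auto simp: d_def\<close>)
    then have "summable (\<lambda>k. u (Suc k) x - u k x)"
      by (intro summable_norm_cancel[of "\<lambda>k. u (Suc k) x - u k x"]) (simp add: d_def)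
    then have "(\<lambda>n. \<Sum>k<n. u (Suc k) x - u k x) \<longlonglongrightarrow> (\<Sum>k. u (Suc k) x - u k x)"
      by (rule summable_LIMSEQ)
    then have "(\<lambda>n. u n x - u 0 x) \<longlonglongrightarrow> (\<Sum>k. u (Suc k) x - u k x)"
      by (simp only: sum_lessThan_telescope[of "\<lambda>k. u k x"])
    from tendsto_add[OF this tendsto_const[of "u 0 x"]] show ?case by (auto simp: convergent_def)
  qed
  define g where "g x = lim (\<lambda>k. u k x)" for x
  have gm [measurable]: "g \<in> borel_measurable borel" unfolding g_def by measurable
  have lim: "AE x in \<mu>. (\<lambda>k. u k x) \<longlonglongrightarrow> g x"
    using conv by eventually_elim (simp add: g_def convergent_LIMSEQ_iff)
  have close: "(\<integral>\<^sup>+x. ennreal ((g x - psum c (J M) x)\<^sup>2) \<partial>\<mu>) \<le> ennreal (T M)" for M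
  proof -
    have [measurable]: "psum c (J M) \<in> borel_measurable borel" using L2_measurable[OF psum_L2] by simp
    have "(\<integral>\<^sup>+x. ennreal ((g x - psum c (J M) x)\<^sup>2) \<partial>\<mu>) = (\<integral>\<^sup>+x. liminf (\<lambda>k. ennreal ((u k x - psum c (J M) x)\<^sup>2)) \<partial>\<mu>)"
    proof (rule nn_integral_cong_AE)
      show "AE x in \<mu>. ennreal ((g x - psum c (J M) x)\<^sup>2) = liminf (\<lambda>k. ennreal ((u k x - psum c (J M) x)\<^sup>2))"
        using lim
      proof eventually_elim
        case (elim x)
        have "(\<lambda>k. ennreal ((u k x - psum c (J M) x)\<^sup>2)) \<longlonglongrightarrow> ennreal ((g x - psum c (J M) x)\<^sup>2)"
          by (intro tendsto_intros elim)
        then show ?case by (intro lim_imp_Liminf[symmetric]) auto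
      qed
    qed
    also have "\<dots> \<le> liminf (\<lambda>k. \<integral>\<^sup>+x. ennreal ((u k x - psum c (J M) x)\<^sup>2) \<partial>\<mu>)"
      by (rule nn_integral_liminf) simp
    also have "\<dots> \<le> ennreal (T M)"
    proof -
      have "(\<integral>\<^sup>+x. ennreal ((u k x - psum c (J M) x)\<^sup>2) \<partial>\<mu>) \<le> ennreal (T M)" if "k \<ge> M" for k
      proof -
        have "(\<integral>\<^sup>+x. ennreal ((u k x - psum c (J M) x)\<^sup>2) \<partial>\<mu>) = ennreal ((L2_norm \<mu> (\<lambda>x. u k x - psum c (J M) x))\<^sup>2)"
          unfolding L2_norm_power2
          by (rule nn_integral_eq_integral[OF L2_integrable[OF L2_diff[OF uL2 psum_L2]]]) simp
        also have "\<dots> \<le> ennreal (T M)"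
          unfolding u_def T_def using psum_tail[OF s, of M "r k"] r_k[of k] that by (intro ennreal_leI) auto
        finally show ?thesis .
      qed
      then have "\<forall>\<^sub>F k in sequentially. (\<integral>\<^sup>+x. ennreal ((u k x - psum c (J M) x)\<^sup>2) \<partial>\<mu>) \<le> ennreal (T M)"
        by (intro eventually_sequentiallyI[of M])
      then have "Limsup sequentially (\<lambda>k. \<integral>\<^sup>+x. ennreal ((u k x - psum c (J M) x)\<^sup>2) \<partial>\<mu>) \<le> ennreal (T M)"
        by (rule Limsup_bounded)
      then show ?thesis by (rule order_trans[OF Liminf_le_Limsup, rotated]) simp
    qed
    finally show ?thesis .
  qed
  have dL2: "(\<lambda>x. g x - psum c (J M) x) \<in> L2 \<mu>" for M
  proof (rule L2I)
    show m: "(\<lambda>x. g x - psum c (J M) x) \<in> borel_measurable \<mu>" using L2_measurable[OF psum_L2] by simp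
    show "integrable \<mu> (\<lambda>x. (g x - psum c (J M) x)\<^sup>2)"
      unfolding integrable_iff_bounded using m le_less_trans[OF close[of M]] by simp
  qed
  have "(\<lambda>x. (g x - psum c (J 0) x) + psum c (J 0) x) \<in> L2 \<mu>" by (rule L2_add[OF dL2 psum_L2])
  then have gL2: "g \<in> L2 \<mu>" by simp
  have le: "(L2_norm \<mu> (\<lambda>x. g x - psum c (J M) x))\<^sup>2 \<le> T M" for M
    using close[of M] T_nonneg[of M] unfolding L2_norm_power2
    by (subst (asm) nn_integral_eq_integral[OF L2_integrable[OF dL2]]) auto
  have "(\<lambda>M. (L2_norm \<mu> (\<lambda>x. g x - psum c (J M) x))\<^sup>2) \<longlonglongrightarrow> 0"
    by (rule tendsto_sandwich[OF _ _ tendsto_const T0]) (use le in auto)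
  from tendsto_real_sqrt[OF this] have "(\<lambda>M. L2_norm \<mu> (\<lambda>x. g x - psum c (J M) x)) \<longlonglongrightarrow> 0" by simp
  then show ?thesis using gL2 has_expansion_iff by blast
qed

lemma has_expansion_cong_AE:
  assumes "has_expansion \<mu> h c f" "g \<in> borel_measurable \<mu>" "AE x in \<mu>. f x = g x"
  shows "has_expansion \<mu> h c g"
proof -
  have f: "f \<in> L2 \<mu>" using assms by (simp add: has_expansion_iff)
  have "L2_norm \<mu> (\<lambda>x. g x - psum c (J N) x) = L2_norm \<mu> (\<lambda>x. f x - psum c (J N) x)" for N
    using assms(2,3) L2_measurable[OF f] L2_measurable[OF psum_L2] by (intro L2_norm_cong_AE) auto
  then show ?thesis using assms L2_cong_AE[OF f] by (simp add: has_expansion_iff)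
qed

lemma has_expansion_cong_coef:
  assumes "has_expansion \<mu> h c f" "\<And>n. n \<in> I \<Longrightarrow> c n = d n"
  shows "has_expansion \<mu> h d f"
proof -
  have "psum c (J N) = psum d (J N)" for N
    unfolding psum_def fun_eq_iff using assms(2) J_sub by (intro allI sum.cong refl) (metis subsetD)
  then show ?thesis using assms(1) by (simp add: has_expansion_iff)
qed

text \<open>By Bessel's inequality the coefficients of \<open>f\<close> are square summable, so
  Riesz--Fischer produces some \<open>g\<close> with these coefficients, and completeness identifies
  \<open>g\<close> with \<open>f\<close>.\<close>

theorem has_expansion_self:
  assumes f: "f \<in> L2 \<mu>"
  shows "has_expansion \<mu> h (coef f) f"
proof -
  have "summable (\<lambda>n. (cut (coef f) n)\<^sup>2)"
  proof (rule summableI_nonneg_bounded)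
    show "(\<Sum>n<N. (cut (coef f) n)\<^sup>2) \<le> (L2_norm \<mu> f)\<^sup>2" for N
      using bessel[OF f finite_J J_sub] sum_J by metis
  qed simp
  then obtain g where g: "has_expansion \<mu> h (coef f) g" using riesz_fischer by blast
  have "AE x in \<mu>. g x = f x"
    by (rule AE_eq_if_coef_eq[OF has_expansion_L2[OF g] f]) (rule has_expansion_coef[OF g])
  then show ?thesis by (rule has_expansion_cong_AE[OF g L2_measurable[OF f]])
qed

lemma has_expansionI: "f \<in> L2 \<mu> \<Longrightarrow> (\<And>n. n \<in> I \<Longrightarrow> coef f n = c n) \<Longrightarrow> has_expansion \<mu> h c f"
  by (rule has_expansion_cong_coef[OF has_expansion_self])

theorem parseval:
  assumes f: "f \<in> L2 \<mu>"
  shows "(\<lambda>n. (cut (coef f) n)\<^sup>2) sums (L2_norm \<mu> f)\<^sup>2"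
proof -
  have "(\<lambda>N. (L2_norm \<mu> (\<lambda>x. f x - psum (coef f) (J N) x))\<^sup>2) \<longlonglongrightarrow> 0\<^sup>2"
    using has_expansion_self[OF f] by (intro tendsto_power) (simp add: has_expansion_iff)
  then have "(\<lambda>N. (L2_norm \<mu> f)\<^sup>2 - (\<Sum>n<N. (cut (coef f) n)\<^sup>2)) \<longlonglongrightarrow> 0"
    by (simp add: norm_diff_psum[OF f finite_J J_sub] sum_J)
  from tendsto_diff[OF tendsto_const[of "(L2_norm \<mu> f)\<^sup>2"] this] show ?thesis by (simp add: sums_def)
qed

end

section \<open>The diagonal semigroup and its generator\<close>

context poly_basis
begin

lemma coef_add: "f \<in> L2 \<mu> \<Longrightarrow> g \<in> L2 \<mu> \<Longrightarrow> coef (\<lambda>x. f x + g x) n = coef f n + coef g n"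
  unfolding coef_def using L2_mult_integrable[OF _ poly_L2] by (simp add: distrib_right)

lemma summable_coef: "f \<in> L2 \<mu> \<Longrightarrow> summable (\<lambda>n. (cut (coef f) n)\<^sup>2)"
  using parseval sums_summable by blast

lemma L2_norm_suminf: "f \<in> L2 \<mu> \<Longrightarrow> (L2_norm \<mu> f)\<^sup>2 = (\<Sum>n. (cut (coef f) n)\<^sup>2)"
  using parseval sums_unique by blast

lemma L2_norm_le_if_coef_le:
  assumes f: "f \<in> L2 \<mu>" and g: "g \<in> L2 \<mu>" and le: "\<And>n. n \<in> I \<Longrightarrow> \<bar>coef f n\<bar> \<le> \<bar>coef g n\<bar>"
  shows "L2_norm \<mu> f \<le> L2_norm \<mu> g"
proof (rule power2_le_imp_le)
  have "(cut (coef f) n)\<^sup>2 \<le> (cut (coef g) n)\<^sup>2" for n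
    using le[of n] by (auto simp: cut_def abs_le_square_iff)
  then show "(L2_norm \<mu> f)\<^sup>2 \<le> (L2_norm \<mu> g)\<^sup>2"
    unfolding L2_norm_suminf[OF f] L2_norm_suminf[OF g]
    by (intro suminf_le summable_coef f g)
qed simp

text \<open>Dominated convergence in coordinates: Parseval turns the norm into a series, and
  Tannery's theorem exchanges limit and sum. The majorant \<open>b\<close> is \<open>coef f\<close>
  for strong continuity and \<open>\<alpha> n * coef f n\<close> for the generator.\<close>

lemma L2_norm_tendsto_zero:
  assumes u: "\<forall>\<^sub>F t in F. u t \<in> L2 \<mu> \<and> (\<forall>n\<in>I. \<bar>coef (u t) n\<bar> \<le> \<bar>b n\<bar>)"
    and b: "summable (\<lambda>n. (cut b n)\<^sup>2)" and lim: "\<And>n. n \<in> I \<Longrightarrow> ((\<lambda>t. coef (u t) n) \<longlongrightarrow> 0) F"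
    and F: "F \<noteq> bot"
  shows "((\<lambda>t. L2_norm \<mu> (u t)) \<longlongrightarrow> 0) F"
proof -
  have "((\<lambda>t. \<Sum>n. (cut (coef (u t)) n)\<^sup>2) \<longlongrightarrow> (\<Sum>n. (0::real))) F"
  proof (rule tannerys_theorem[THEN conjunct2, THEN conjunct2, OF _ _ b F])
    show "((\<lambda>t. (cut (coef (u t)) n)\<^sup>2) \<longlongrightarrow> 0) F" for n
      using tendsto_power[OF lim[of n], of 2] by (cases "n \<in> I") (auto simp: cut_def)
    have "\<forall>\<^sub>F t in F. \<forall>n. norm ((cut (coef (u t)) n)\<^sup>2) \<le> (cut b n)\<^sup>2"
      using u by eventually_elim (auto simp: cut_def abs_le_square_iff)
    then show "\<forall>\<^sub>F (n, t) in at_top \<times>\<^sub>F F. norm ((cut (coef (u t)) n)\<^sup>2) \<le> (cut b n)\<^sup>2"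
      unfolding eventually_prod_filter
      by (intro exI[of _ "\<lambda>_. True"] exI[of _ "\<lambda>t. \<forall>n. norm ((cut (coef (u t)) n)\<^sup>2) \<le> (cut b n)\<^sup>2"]) auto
  qed
  moreover have "\<forall>\<^sub>F t in F. (\<Sum>n. (cut (coef (u t)) n)\<^sup>2) = (L2_norm \<mu> (u t))\<^sup>2"
    using u by eventually_elim (simp add: L2_norm_suminf)
  ultimately have "((\<lambda>t. (L2_norm \<mu> (u t))\<^sup>2) \<longlongrightarrow> 0) F"
    by (simp add: tendsto_cong)
  from tendsto_real_sqrt[OF this] show ?thesis by simp
qed

end

text \<open>At positive times \<open>U\<close> is prescribed through expansions and hence only up to
  null sets. The process can thus supply its own transition operators as versions, and identities
  are proved by comparing coefficients.\<close>

locale poly_semigroup = poly_basis \<mu> h for \<mu> h +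
  fixes \<alpha> :: "nat \<Rightarrow> real" and U :: "real \<Rightarrow> (real \<Rightarrow> real) \<Rightarrow> real \<Rightarrow> real"
  assumes \<alpha>_nonneg: "n \<in> I \<Longrightarrow> 0 \<le> \<alpha> n"
    and U_zero: "U 0 = id"
    and U_expansion: "0 \<le> t \<Longrightarrow> has_expansion \<mu> h c f \<Longrightarrow> has_expansion \<mu> h (\<lambda>n. exp (- \<alpha> n * t) * c n) (U t f)"
begin

lemma U_L2: "0 \<le> t \<Longrightarrow> f \<in> L2 \<mu> \<Longrightarrow> U t f \<in> L2 \<mu>"
  using has_expansion_L2 U_expansion has_expansion_self by blast

lemma coef_U: "0 \<le> t \<Longrightarrow> f \<in> L2 \<mu> \<Longrightarrow> n \<in> I \<Longrightarrow> coef (U t f) n = exp (- \<alpha> n * t) * coef f n"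
  using has_expansion_coef[OF U_expansion[OF _ has_expansion_self]] by blast

theorem strongly_continuous: "strongly_continuous_semigroup \<mu> U"
  unfolding strongly_continuous_semigroup_def
proof (intro conjI allI impI ballI)
  fix t :: real assume t: "0 \<le> t"
  have bound: "L2_norm \<mu> (U t f) \<le> 1 * L2_norm \<mu> f" if f: "f \<in> L2 \<mu>" for f
  proof -
    have "\<bar>exp (- \<alpha> n * t) * coef f n\<bar> \<le> 1 * \<bar>coef f n\<bar>" if "n \<in> I" for n
      unfolding abs_mult using \<alpha>_nonneg[OF that] t by (intro mult_right_mono) auto
    then show ?thesis using L2_norm_le_if_coef_le[OF U_L2[OF t f] f] coef_U[OF t f] by simp
  qed
  show "bounded_L2_operator \<mu> (U t)"
    unfolding bounded_L2_operator_def
  proof (intro conjI ballI impI allI)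
    show "U t f \<in> L2 \<mu>" if "f \<in> L2 \<mu>" for f by (rule U_L2[OF t that])
    show "AE x in \<mu>. U t f x = U t g x" if fg: "f \<in> L2 \<mu>" "g \<in> L2 \<mu>" and "AE x in \<mu>. f x = g x" for f g
    proof (rule AE_eq_if_coef_eq[OF U_L2[OF t fg(1)] U_L2[OF t fg(2)]])
      have "coef f n = coef g n" for n
        unfolding coef_def using fg[THEN L2_measurable] that(3) by (intro integral_cong_AE) auto
      then show "coef (U t f) n = coef (U t g) n" if "n \<in> I" for n using coef_U t fg that by simp
    qed
    show "AE x in \<mu>. U t (\<lambda>x'. a * f x' + b * g x') x = a * U t f x + b * U t g x"
      if fg: "f \<in> L2 \<mu>" "g \<in> L2 \<mu>" for f g a b
    proof (rule AE_eq_if_coef_eq)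
      have L: "(\<lambda>x'. a * f x' + b * g x') \<in> L2 \<mu>" by (intro L2_add L2_scale fg)
      then show "U t (\<lambda>x'. a * f x' + b * g x') \<in> L2 \<mu>" by (rule U_L2[OF t])
      show "(\<lambda>x. a * U t f x + b * U t g x) \<in> L2 \<mu>" by (intro L2_add L2_scale U_L2 t fg)
      show "coef (U t (\<lambda>x'. a * f x' + b * g x')) n = coef (\<lambda>x. a * U t f x + b * U t g x) n"
        if "n \<in> I" for n
        using that coef_U[OF t] fg L U_L2[OF t]
        by (simp add: coef_add coef_scale L2_scale algebra_simps)
    qed
    show "\<exists>K. \<forall>f\<in>L2 \<mu>. L2_norm \<mu> (U t f) \<le> K * L2_norm \<mu> f" using bound by blast
  qed
next
  show "AE x in \<mu>. U 0 f x = f x" for f by (simp add: U_zero)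
next
  fix s t :: real and f assume st: "0 \<le> s" "0 \<le> t" and f: "f \<in> L2 \<mu>"
  show "AE x in \<mu>. U (s + t) f x = U s (U t f) x"
    by (rule AE_eq_if_coef_eq) (use st f in \<open>auto simp: U_L2 coef_U algebra_simps exp_add[symmetric]\<close>)
next
  fix f assume f: "f \<in> L2 \<mu>"
  show "((\<lambda>t. L2_norm \<mu> (\<lambda>x. U t f x - f x)) \<longlongrightarrow> 0) (at_right 0)"
  proof (rule L2_norm_tendsto_zero[where b = "coef f"])
    have c: "coef (\<lambda>x. U t f x - f x) n = (exp (- \<alpha> n * t) - 1) * coef f n" if "0 < t" "n \<in> I" for t n
      using that f coef_U[of t f n] U_L2[of t f] by (simp add: coef_diff algebra_simps)
    have "\<bar>exp (- \<alpha> n * t) - 1\<bar> \<le> 1" if "0 < t" "n \<in> I" for t n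
      using \<alpha>_nonneg[OF that(2)] that(1) by (auto simp: abs_le_iff intro: order_trans[of _ 1])
    then have "\<bar>coef (\<lambda>x. U t f x - f x) n\<bar> \<le> \<bar>coef f n\<bar>" if "0 < t" "n \<in> I" for t n
      using that c[OF that] by (simp add: abs_mult mult_left_le_one_le)
    then show "\<forall>\<^sub>F t in at_right 0. (\<lambda>x. U t f x - f x) \<in> L2 \<mu> \<and> (\<forall>n\<in>I. \<bar>coef (\<lambda>x. U t f x - f x) n\<bar> \<le> \<bar>coef f n\<bar>)"
      using f by (auto intro!: eventually_at_rightI[of 0 1] L2_diff U_L2)
    show "((\<lambda>t. coef (\<lambda>x. U t f x - f x) n) \<longlongrightarrow> 0) (at_right 0)" if n: "n \<in> I" for n
    proof (rule Lim_transform_eventually)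
      show "((\<lambda>t. (exp (- \<alpha> n * t) - 1) * coef f n) \<longlongrightarrow> 0) (at_right 0)"
        by (rule tendsto_eq_intros refl | simp)+
      show "\<forall>\<^sub>F t in at_right 0. (exp (- \<alpha> n * t) - 1) * coef f n = coef (\<lambda>x. U t f x - f x) n"
        using c n by (auto intro!: eventually_at_rightI[of 0 1])
    qed
  qed (use f in \<open>auto intro: summable_coef\<close>)
qed

section \<open>The generator and its domain\<close>

lemma summable_on_iff_cut:
  "(\<lambda>n. (c n)\<^sup>2 * (\<alpha> n)\<^sup>2) summable_on {n. enat n < supp_size \<mu>} \<longleftrightarrow> summable (\<lambda>n. (cut (\<lambda>n. \<alpha> n * c n) n)\<^sup>2)"
proof -
  have "(\<lambda>n. (c n)\<^sup>2 * (\<alpha> n)\<^sup>2) summable_on {n. enat n < supp_size \<mu>}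
      \<longleftrightarrow> (\<lambda>n. (cut (\<lambda>n. \<alpha> n * c n) n)\<^sup>2) summable_on UNIV"
    by (rule summable_on_cong_neutral) (auto simp: cut_def I_def power_mult_distrib)
  then show ?thesis by (simp add: summable_on_UNIV_nonneg_real_iff)
qed

text \<open>Coefficients on \<open>I\<close> are unique, so \<open>coef f\<close> may replace the
  existentially quantified sequence of the domain.\<close>

lemma spectral_domain_iff:
  "f \<in> spectral_domain \<mu> h \<alpha> \<longleftrightarrow> f \<in> L2 \<mu> \<and> summable (\<lambda>n. (cut (\<lambda>n. \<alpha> n * coef f n) n)\<^sup>2)"
proof -
  have "cut (\<lambda>n. \<alpha> n * c n) = cut (\<lambda>n. \<alpha> n * coef f n)" if "has_expansion \<mu> h c f" for c
    using has_expansion_coef[OF that] by (auto simp: cut_def)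
  then show ?thesis
    unfolding spectral_domain_def summable_on_iff_cut mem_Collect_eq
    using has_expansion_self by metis
qed

text \<open>The series converges in L2 and determines only a class of functions; the choice operator
  picks a representative, an arbitrary function when there is none.\<close>

definition A :: "(real \<Rightarrow> real) \<Rightarrow> real \<Rightarrow> real" where
  "A f = (SOME g. has_expansion \<mu> h (\<lambda>n. - (\<alpha> n * coef f n)) g)"

lemma A_expansion:
  assumes "f \<in> spectral_domain \<mu> h \<alpha>"
  shows "has_expansion \<mu> h (\<lambda>n. - (\<alpha> n * coef f n)) (A f)"
proof -
  have "(cut (\<lambda>n. - (\<alpha> n * coef f n)) n)\<^sup>2 = (cut (\<lambda>n. \<alpha> n * coef f n) n)\<^sup>2" for n
    by (simp add: cut_def)
  then have "\<exists>g. has_expansion \<mu> h (\<lambda>n. - (\<alpha> n * coef f n)) g"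
    using assms by (intro riesz_fischer) (simp add: spectral_domain_iff)
  then show ?thesis unfolding A_def by (rule someI_ex)
qed

lemma A_expansion':
  assumes "f \<in> spectral_domain \<mu> h \<alpha>" "has_expansion \<mu> h c f"
  shows "has_expansion \<mu> h (\<lambda>n. - (\<alpha> n * c n)) (A f)"
  by (rule has_expansion_cong_coef[OF A_expansion[OF assms(1)]]) (use has_expansion_coef[OF assms(2)] in simp)

lemma coef_difference_quotient:
  assumes "f \<in> L2 \<mu>" "0 < t" "n \<in> I"
  shows "coef (\<lambda>x. (U t f x - f x) / t) n = (exp (- \<alpha> n * t) - 1) / t * coef f n"
proof -
  have "coef (\<lambda>x. (1/t) * (U t f x - f x)) n = (1/t) * (exp (- \<alpha> n * t) * coef f n - coef f n)"
    using assms coef_U[of t f n] U_L2[of t f] by (simp only: coef_scale) (simp add: coef_diff)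
  then show ?thesis using assms(2) by (simp add: field_simps)
qed

lemma difference_quotient_L2: "f \<in> L2 \<mu> \<Longrightarrow> 0 < t \<Longrightarrow> (\<lambda>x. (U t f x - f x) / t) \<in> L2 \<mu>"
  using L2_scale[OF L2_diff[OF U_L2], of t f f "1/t"] by simp

lemma exp_quotient_tendsto: "((\<lambda>t. (exp (- a * t) - 1) / t) \<longlongrightarrow> - a) (at_right (0::real))"
proof -
  have "((\<lambda>t. exp (- a * t)) has_real_derivative - a) (at 0)"
    by (auto intro!: derivative_eq_intros)
  then have "((\<lambda>t. (exp (- a * t) - 1) / t) \<longlongrightarrow> - a) (at 0)" by (simp add: DERIV_def)
  then show ?thesis by (rule filterlim_mono) (auto simp: at_le)
qed

text \<open>For \<open>f\<close> in the domain the difference quotients converge coordinate by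
  coordinate under a square summable majorant. Conversely, if they converge to some
  \<open>g\<close>, continuity of the coefficients gives
  \<open>coef g n = - (\<alpha> n * coef f n)\<close>, and square summability of the coefficients of
  \<open>g\<close> is the condition defining the domain.\<close>

theorem generator: "is_generator \<mu> U (spectral_domain \<mu> h \<alpha>) A"
  unfolding is_generator_def
proof (intro conjI ballI)
  have deriv: "derivative_at_0 \<mu> U f (A f)" if f: "f \<in> spectral_domain \<mu> h \<alpha>" for f
  proof -
    have fL: "f \<in> L2 \<mu>" and fs: "summable (\<lambda>n. (cut (\<lambda>n. \<alpha> n * coef f n) n)\<^sup>2)"
      using f spectral_domain_iff by auto
    have AL: "A f \<in> L2 \<mu>" by (rule has_expansion_L2[OF A_expansion[OF f]])
    have cA: "coef (A f) n = - (\<alpha> n * coef f n)" if "n \<in> I" for n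
      by (rule has_expansion_coef[OF A_expansion[OF f] that])
    have c: "coef (\<lambda>x. (U t f x - f x) / t - A f x) n = ((exp (- \<alpha> n * t) - 1) / t + \<alpha> n) * coef f n"
      if "0 < t" "n \<in> I" for t n
      using coef_difference_quotient[OF fL that] difference_quotient_L2[OF fL that(1)] AL cA[OF that(2)]
      by (simp add: coef_diff algebra_simps)
    \<comment> \<open>From \<open>1 - a * t \<le> exp (- a * t) \<le> 1\<close>. This makes
      \<open>\<alpha> n * coef f n\<close> a majorant that is independent of
      \<open>t\<close>.\<close>
    have le: "\<bar>(exp (- a * t) - 1) / t + a\<bar> \<le> a" if "0 < t" "0 \<le> a" for t a :: real
    proof -
      have "exp (- a * t) \<ge> 1 + (- a * t)" by (rule exp_ge_add_one_self)
      then have "0 \<le> (exp (- a * t) - 1) / t + a" using that by (simp add: field_simps)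
      moreover have "(exp (- a * t) - 1) / t \<le> 0" using that by (simp add: divide_le_0_iff)
      ultimately show ?thesis by simp
    qed
    have "\<bar>coef (\<lambda>x. (U t f x - f x) / t - A f x) n\<bar> \<le> \<bar>\<alpha> n * coef f n\<bar>" if "0 < t" "n \<in> I" for t n
      unfolding c[OF that] abs_mult using le[OF that(1) \<alpha>_nonneg[OF that(2)]] by (intro mult_right_mono) auto
    then have ev: "\<forall>\<^sub>F t in at_right 0. (\<lambda>x. (U t f x - f x) / t - A f x) \<in> L2 \<mu>
        \<and> (\<forall>n\<in>I. \<bar>coef (\<lambda>x. (U t f x - f x) / t - A f x) n\<bar> \<le> \<bar>\<alpha> n * coef f n\<bar>)"
      by (auto intro!: eventually_at_rightI[of 0 1] L2_diff difference_quotient_L2 fL AL)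
    have "((\<lambda>t. L2_norm \<mu> (\<lambda>x. (U t f x - f x) / t - A f x)) \<longlongrightarrow> 0) (at_right 0)"
    proof (rule L2_norm_tendsto_zero[OF ev fs])
      show "((\<lambda>t. coef (\<lambda>x. (U t f x - f x) / t - A f x) n) \<longlongrightarrow> 0) (at_right 0)" if n: "n \<in> I" for n
      proof (rule Lim_transform_eventually)
        have "((\<lambda>t. ((exp (- \<alpha> n * t) - 1) / t + \<alpha> n) * coef f n) \<longlongrightarrow> (- \<alpha> n + \<alpha> n) * coef f n) (at_right 0)"
          by (intro tendsto_intros exp_quotient_tendsto)
        then show "((\<lambda>t. ((exp (- \<alpha> n * t) - 1) / t + \<alpha> n) * coef f n) \<longlongrightarrow> 0) (at_right 0)" by simp
        show "\<forall>\<^sub>F t in at_right 0. ((exp (- \<alpha> n * t) - 1) / t + \<alpha> n) * coef f n = coef (\<lambda>x. (U t f x - f x) / t - A f x) n"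
          using c n by (auto intro!: eventually_at_rightI[of 0 1])
      qed
    qed simp
    then show ?thesis using AL by (simp add: derivative_at_0_def)
  qed
  then show "derivative_at_0 \<mu> U f (A f)" if "f \<in> spectral_domain \<mu> h \<alpha>" for f using that .
  have "f \<in> spectral_domain \<mu> h \<alpha>" if f: "f \<in> L2 \<mu>" and g: "derivative_at_0 \<mu> U f g" for f g
  proof -
    have gL: "g \<in> L2 \<mu>" and lim: "((\<lambda>t. L2_norm \<mu> (\<lambda>x. (U t f x - f x) / t - g x)) \<longlongrightarrow> 0) (at_right 0)"
      using g by (auto simp: derivative_at_0_def)
    \<comment> \<open>\<open>coef_tendsto\<close> wants a member of L2 for every \<open>t\<close>;
      the value \<open>g\<close> at \<open>t \<le> 0\<close> does not affect the right
      limit.\<close>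
    define u where "u t = (if 0 < t then (\<lambda>x. (U t f x - f x) / t) else g)" for t
    have uL: "u t \<in> L2 \<mu>" for t using difference_quotient_L2[OF f, of t] gL by (simp add: u_def)
    have lim': "((\<lambda>t. L2_norm \<mu> (\<lambda>x. g x - u t x)) \<longlongrightarrow> 0) (at_right 0)"
      by (rule Lim_transform_eventually[OF lim])
        (auto intro!: eventually_at_rightI[of 0 1] L2_norm_minus simp: u_def)
    have cg: "coef g n = - (\<alpha> n * coef f n)" if n: "n \<in> I" for n
    proof -
      have l1: "((\<lambda>t. coef (u t) n) \<longlongrightarrow> coef g n) (at_right 0)"
        by (rule coef_tendsto[OF gL uL lim'])
      have "((\<lambda>t. (exp (- \<alpha> n * t) - 1) / t * coef f n) \<longlongrightarrow> - \<alpha> n * coef f n) (at_right 0)"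
        by (intro tendsto_intros exp_quotient_tendsto)
      then have "((\<lambda>t. coef (u t) n) \<longlongrightarrow> - \<alpha> n * coef f n) (at_right 0)"
        by (rule Lim_transform_eventually)
          (use coef_difference_quotient[OF f _ n] in \<open>auto intro!: eventually_at_rightI[of 0 1] simp: u_def\<close>)
      from tendsto_unique[OF _ l1 this] show ?thesis by simp
    qed
    have "(cut (\<lambda>n. \<alpha> n * coef f n) n)\<^sup>2 = (cut (coef g) n)\<^sup>2" for n
      by (simp add: cut_def cg)
    then show ?thesis using summable_coef[OF gL] f by (simp add: spectral_domain_iff)
  qed
  moreover have "f \<in> L2 \<mu>" if "f \<in> spectral_domain \<mu> h \<alpha>" for f
    using that by (simp add: spectral_domain_iff)
  ultimately show "spectral_domain \<mu> h \<alpha> = {f \<in> L2 \<mu>. \<exists>g. derivative_at_0 \<mu> U f g}"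
    using deriv by blast
qed

end

section \<open>Transition operators of the process\<close>

context smpr_process
begin

abbreviation \<mu> where "\<mu> \<equiv> stationary_law M X"

section \<open>The filtration and the one-dimensional laws\<close>

lemma measurable_X [measurable]: "X t \<in> borel_measurable M"
  by (rule measurable_process)

lemma space_past [simp]: "space (past M X s) = space M"
  unfolding past_def by (rule space_measure_of) auto

lemma sets_past: "sets (past M X s) = sigma_sets (space M) (\<Union>r\<in>{..s}. {X r -` B \<inter> space M | B. B \<in> sets borel})"
  unfolding past_def by (rule sets_measure_of) auto

lemma subalgebra_past: "subalgebra M (past M X s)"
  unfolding subalgebra_def sets_past space_past
proof
  show "sigma_sets (space M) (\<Union>r\<in>{..s}. {X r -` B \<inter> space M | B. B \<in> sets borel}) \<subseteq> sets M"
    by (rule sets.sigma_sets_subset) auto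
qed simp

lemma measurable_past: "r \<le> s \<Longrightarrow> X r \<in> borel_measurable (past M X s)"
  by (rule measurableI) (auto simp: sets_past)

lemma sets_past_mono: "s \<le> t \<Longrightarrow> sets (past M X s) \<subseteq> sets (past M X t)"
  unfolding sets_past by (intro sigma_sets_mono') force

lemma filtration_past: "filtration (space M) (past M X)"
  by unfold_locales (auto dest: sets_past_mono)

lemma space_sigma_gen [simp]: "space (sigma_gen M (X s)) = space M"
  by (simp add: sigma_gen_def)

lemma measurable_sigma_gen: "X s \<in> borel_measurable (sigma_gen M (X s))"
  unfolding sigma_gen_def by (rule measurable_vimage_algebra1) simp

lemma sets_sigma_gen_past: "sets (sigma_gen M (X s)) \<subseteq> sets (past M X s)"
proof
  fix A assume "A \<in> sets (sigma_gen M (X s))"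
  then obtain B where "B \<in> sets borel" "A = X s -` B \<inter> space M"
    by (auto simp: sigma_gen_def sets_vimage_algebra2)
  then show "A \<in> sets (past M X s)" using measurable_sets[OF measurable_past[OF order_refl], of B s] by simp
qed

lemma subalgebra_sigma_gen: "subalgebra M (sigma_gen M (X s))"
  using sets_sigma_gen_past[of s] subalgebra_past[of s] by (auto simp: subalgebra_def)

lemma finite_subalgebra: "subalgebra M F \<Longrightarrow> sigma_finite_subalgebra M F"
  by (rule finite_measure_subalgebra_is_sigma_finite)
    (simp add: finite_measure_subalgebra_def finite_measure_subalgebra_axioms_def finite_measure_axioms)

lemma law_eq: "distr M borel (X t) = \<mu>" by (rule stationary)

lemma AE_law: "AE y in \<mu>. P y \<Longrightarrow> AE \<omega> in M. P (X t \<omega>)"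
  unfolding law_eq[of t, symmetric] by (rule AE_distrD) auto

lemma AE_law_iff: "{y. P y} \<in> sets borel \<Longrightarrow> (AE y in \<mu>. P y) \<longleftrightarrow> (AE \<omega> in M. P (X t \<omega>))"
  unfolding law_eq[of t, symmetric] by (rule AE_distr_iff) auto

lemma integrable_law_iff: "f \<in> borel_measurable borel \<Longrightarrow> integrable \<mu> f \<longleftrightarrow> integrable M (\<lambda>\<omega>. f (X t \<omega>))"
  for f :: "real \<Rightarrow> real"
  unfolding law_eq[of t, symmetric] by (rule integrable_distr_eq) auto

lemma integral_law: "f \<in> borel_measurable borel \<Longrightarrow> (\<integral>y. f y \<partial>\<mu>) = (\<integral>\<omega>. f (X t \<omega>) \<partial>M)"
  for f :: "real \<Rightarrow> real"
  unfolding law_eq[of t, symmetric] by (rule integral_distr) auto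

lemma nn_integral_law: "f \<in> borel_measurable borel \<Longrightarrow> (\<integral>\<^sup>+y. f y \<partial>\<mu>) = (\<integral>\<^sup>+\<omega>. f (X t \<omega>) \<partial>M)"
  unfolding law_eq[of t, symmetric] by (rule nn_integral_distr) auto

sublocale mu: moment_law \<mu>
proof -
  interpret D: real_distribution \<mu>
    unfolding stationary_law_def by (rule real_distribution_distr) simp
  show "moment_law \<mu>"
  proof
    show "integrable \<mu> (\<lambda>x. x ^ n)" for n
      using finite_moments[of n] integrable_law_iff[of "\<lambda>x. x ^ n" 0] by simp
  qed
qed

section \<open>Integration against the transition kernel\<close>

lemma sets_kernel: assumes "0 < t" shows "sets (\<eta> y t) = sets borel"
  and prob_kernel: "prob_space (\<eta> y t)"
  using measurable_space[OF kernel[OF assms], of y] by (auto simp: space_prob_algebra)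

lemma kernel_subprob: "0 < t \<Longrightarrow> (\<lambda>y. \<eta> y t) \<in> borel \<rightarrow>\<^sub>M subprob_algebra borel"
  by (rule measurable_prob_algebraD[OF kernel])

lemma measurable_kernel_eq: "0 < t \<Longrightarrow> measurable (\<eta> y t) N = measurable borel N"
  by (rule measurable_cong_sets) (simp_all add: sets_kernel)

lemma measurable_kernel_nn_integral:
  "0 < t \<Longrightarrow> f \<in> borel_measurable borel \<Longrightarrow> (\<lambda>y. \<integral>\<^sup>+x. f x \<partial>\<eta> y t) \<in> borel_measurable borel"
  using measurable_compose[OF kernel_subprob nn_integral_measurable_subprob_algebra] by simp

lemma measurable_kernel_integral:
  fixes f :: "real \<Rightarrow> real"
  assumes t: "0 < t" and f: "f \<in> borel_measurable borel"
  shows "(\<lambda>y. \<integral>x. f x \<partial>\<eta> y t) \<in> borel_measurable borel"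
  using measurable_compose[OF kernel_subprob[OF t] integral_measurable_subprob_algebra[OF f]] .

text \<open>Markov property and transition law are given for single Borel sets, as equalities of
  conditional expectations. Testing against an event \<open>A\<close> of the past yields an identity
  of nonnegative integrals, which extends to functions without integrability questions.\<close>

lemma kernel_set:
  assumes st: "s < t" and A: "A \<in> sets (past M X s)" and B: "B \<in> sets borel"
  shows "(\<integral>\<^sup>+\<omega>. indicator B (X t \<omega>) * indicator A \<omega> \<partial>M)
    = (\<integral>\<^sup>+\<omega>. emeasure (\<eta> (X s \<omega>) (t - s)) B * indicator A \<omega> \<partial>M)"
proof -
  interpret P: sigma_finite_subalgebra M "past M X s" by (rule finite_subalgebra[OF subalgebra_past])
  have AM: "A \<in> sets M" using A subalgebra_past by (auto simp: subalgebra_def)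
  have ts: "0 < t - s" using st by simp
  define Z where "Z = (indicator (X t -` B \<inter> space M) :: 'a \<Rightarrow> real)"
  have Zs: "X t -` B \<inter> space M \<in> sets M" using measurable_sets[OF measurable_X B] .
  have Zi: "integrable M Z" unfolding Z_def using Zs by (intro integrable_real_indicator) (auto simp: less_top[symmetric])
  have k: "measure (\<eta> y (t - s)) B \<le> 1" "0 \<le> measure (\<eta> y (t - s)) B" for y
    using prob_space.prob_le_1[OF prob_kernel[OF ts]] by auto
  have [measurable]: "(\<lambda>y. measure (\<eta> y (t - s)) B) \<in> borel_measurable borel"
    using measurable_compose[OF kernel_subprob[OF ts] measurable_measure_subprob_algebra[OF B]] .
  have ki: "integrable M (\<lambda>\<omega>. measure (\<eta> (X s \<omega>) (t - s)) B)"
    using k by (intro integrable_const_bound[of _ 1]) auto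
  have ae: "AE \<omega> in M. real_cond_exp M (past M X s) Z \<omega> = measure (\<eta> (X s \<omega>) (t - s)) B"
    using markov[OF st B] transition_law[OF st B] unfolding Z_def by eventually_elim simp
  have "(\<integral>\<omega>. Z \<omega> * indicator A \<omega> \<partial>M) = (\<integral>\<omega>. real_cond_exp M (past M X s) Z \<omega> * indicator A \<omega> \<partial>M)"
    using P.real_cond_exp_intA[OF Zi A] by (simp add: set_lebesgue_integral_def mult.commute)
  also have "\<dots> = (\<integral>\<omega>. measure (\<eta> (X s \<omega>) (t - s)) B * indicator A \<omega> \<partial>M)"
    by (rule integral_cong_AE) (use ae AM in auto)
  finally have eq: "(\<integral>\<omega>. Z \<omega> * indicator A \<omega> \<partial>M) = (\<integral>\<omega>. measure (\<eta> (X s \<omega>) (t - s)) B * indicator A \<omega> \<partial>M)" .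
  have "(\<integral>\<^sup>+\<omega>. indicator B (X t \<omega>) * indicator A \<omega> \<partial>M) = (\<integral>\<^sup>+\<omega>. ennreal (Z \<omega> * indicator A \<omega>) \<partial>M)"
    by (intro nn_integral_cong) (auto simp: Z_def indicator_def)
  also have "\<dots> = ennreal (\<integral>\<omega>. Z \<omega> * indicator A \<omega> \<partial>M)"
    using integrable_real_mult_indicator[OF AM Zi] by (intro nn_integral_eq_integral) (auto simp: Z_def)
  also have "\<dots> = (\<integral>\<^sup>+\<omega>. ennreal (measure (\<eta> (X s \<omega>) (t - s)) B * indicator A \<omega>) \<partial>M)"
    unfolding eq using integrable_real_mult_indicator[OF AM ki] k by (intro nn_integral_eq_integral[symmetric]) auto
  also have "\<dots> = (\<integral>\<^sup>+\<omega>. emeasure (\<eta> (X s \<omega>) (t - s)) B * indicator A \<omega> \<partial>M)"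
  proof (intro nn_integral_cong)
    fix \<omega>
    interpret K: prob_space "\<eta> (X s \<omega>) (t - s)" by (rule prob_kernel[OF ts])
    show "ennreal (measure (\<eta> (X s \<omega>) (t - s)) B * indicator A \<omega>) = emeasure (\<eta> (X s \<omega>) (t - s)) B * indicator A \<omega>"
      by (simp add: K.emeasure_eq_measure indicator_def)
  qed
  finally show ?thesis .
qed

lemma kernel_nn_integral:
  assumes st: "s < t" and A: "A \<in> sets (past M X s)" and f: "f \<in> borel_measurable borel"
  shows "(\<integral>\<^sup>+\<omega>. f (X t \<omega>) * indicator A \<omega> \<partial>M)
    = (\<integral>\<^sup>+\<omega>. (\<integral>\<^sup>+x. f x \<partial>\<eta> (X s \<omega>) (t - s)) * indicator A \<omega> \<partial>M)"
  using f
proof (induction rule: borel_measurable_induct)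
  have ts: "0 < t - s" using st by simp
  have AM [measurable]: "A \<in> sets M" using A subalgebra_past by (auto simp: subalgebra_def)
  note [measurable] = measurable_kernel_nn_integral[OF ts]
  note mk = measurable_kernel_eq[OF ts]
  {
    case (cong f g)
    then have "f = g" by auto
    then show ?case using cong by simp
  next
    case (set B)
    then show ?case using kernel_set[OF st A, of B] by (simp add: nn_integral_indicator sets_kernel[OF ts])
  next
    case (mult u c)
    have [measurable]: "u \<in> borel_measurable borel" by fact
    show ?case using mult
      by (simp add: nn_integral_cmult mk mult.assoc)
  next
    case (add u v)
    have [measurable]: "u \<in> borel_measurable borel" "v \<in> borel_measurable borel" by fact+
    show ?case using add
      by (simp add: nn_integral_add mk distrib_right)
  next
    case (seq F)
    have [measurable]: "F i \<in> borel_measurable borel" for i by fact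
    have inc: "incseq F" by fact
    have "(\<integral>\<^sup>+\<omega>. (SUP i. F i) (X t \<omega>) * indicator A \<omega> \<partial>M) = (\<integral>\<^sup>+\<omega>. (SUP i. F i (X t \<omega>) * indicator A \<omega>) \<partial>M)"
      by (simp add: SUP_mult_right_ennreal image_comp)
    also have "\<dots> = (SUP i. \<integral>\<^sup>+\<omega>. F i (X t \<omega>) * indicator A \<omega> \<partial>M)"
      using inc by (intro nn_integral_monotone_convergence_SUP) (auto simp: incseq_def le_fun_def intro!: mult_right_mono)
    also have "\<dots> = (SUP i. \<integral>\<^sup>+\<omega>. (\<integral>\<^sup>+x. F i x \<partial>\<eta> (X s \<omega>) (t - s)) * indicator A \<omega> \<partial>M)"
      using seq by simp
    also have "\<dots> = (\<integral>\<^sup>+\<omega>. (SUP i. (\<integral>\<^sup>+x. F i x \<partial>\<eta> (X s \<omega>) (t - s)) * indicator A \<omega>) \<partial>M)"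
      using inc by (intro nn_integral_monotone_convergence_SUP[symmetric])
        (auto simp: incseq_def le_fun_def intro!: mult_right_mono nn_integral_mono)
    also have "\<dots> = (\<integral>\<^sup>+\<omega>. (\<integral>\<^sup>+x. (SUP i. F i) x \<partial>\<eta> (X s \<omega>) (t - s)) * indicator A \<omega> \<partial>M)"
    proof (intro nn_integral_cong)
      fix \<omega>
      have "(\<integral>\<^sup>+x. (SUP i. F i) x \<partial>\<eta> (X s \<omega>) (t - s)) = (SUP i. \<integral>\<^sup>+x. F i x \<partial>\<eta> (X s \<omega>) (t - s))"
        unfolding SUP_apply using inc by (intro nn_integral_monotone_convergence_SUP) (auto simp: mk)
      then show "(SUP i. (\<integral>\<^sup>+x. F i x \<partial>\<eta> (X s \<omega>) (t - s)) * indicator A \<omega>)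
          = (\<integral>\<^sup>+x. (SUP i. F i) x \<partial>\<eta> (X s \<omega>) (t - s)) * indicator A \<omega>"
        by (simp add: SUP_mult_right_ennreal)
    qed
    finally show ?case .
  }
qed

text \<open>Invariance of \<open>\<mu>\<close> under the kernel: the whole space is an event of the
  past, and \<open>X 0\<close> and \<open>X t\<close> both have the law
  \<open>\<mu>\<close>.\<close>

lemma kernel_nn_integral_law:
  assumes t: "0 < t" and f [measurable]: "f \<in> borel_measurable borel"
  shows "(\<integral>\<^sup>+y. (\<integral>\<^sup>+x. f x \<partial>\<eta> y t) \<partial>\<mu>) = (\<integral>\<^sup>+x. f x \<partial>\<mu>)"
proof -
  note [measurable] = measurable_kernel_nn_integral[OF t]
  have "(\<integral>\<^sup>+\<omega>. f (X t \<omega>) * indicator (space M) \<omega> \<partial>M)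
      = (\<integral>\<^sup>+\<omega>. (\<integral>\<^sup>+x. f x \<partial>\<eta> (X 0 \<omega>) t) * indicator (space M) \<omega> \<partial>M)"
    using kernel_nn_integral[OF t _ f, of "space M"] sets.top[of "past M X 0"] by simp
  then have "(\<integral>\<^sup>+\<omega>. f (X t \<omega>) \<partial>M) = (\<integral>\<^sup>+\<omega>. (\<integral>\<^sup>+x. f x \<partial>\<eta> (X 0 \<omega>) t) \<partial>M)"
    by (simp add: indicator_def cong: nn_integral_cong)
  then show ?thesis using nn_integral_law[of f t] nn_integral_law[of "\<lambda>y. \<integral>\<^sup>+x. f x \<partial>\<eta> y t" 0] by simp
qed

text \<open>The Bochner integral takes the value 0 where \<open>f\<close> is not integrable under
  the kernel; for integrable \<open>f\<close> such \<open>y\<close> form a null set, by invariance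
  of \<open>\<mu>\<close> applied to \<open>\<bar>f\<bar>\<close>.\<close>

definition kernel_op :: "real \<Rightarrow> (real \<Rightarrow> real) \<Rightarrow> real \<Rightarrow> real" where
  "kernel_op t f y = (\<integral>x. f x \<partial>\<eta> y t)"

lemma kernel_op_measurable: "0 < t \<Longrightarrow> f \<in> borel_measurable borel \<Longrightarrow> kernel_op t f \<in> borel_measurable borel"
  unfolding kernel_op_def by (rule measurable_kernel_integral)

lemma AE_kernel_integrable:
  fixes f :: "real \<Rightarrow> real"
  assumes t: "0 < t" and f: "integrable \<mu> f"
  shows "AE y in \<mu>. integrable (\<eta> y t) f"
proof -
  have [measurable]: "f \<in> borel_measurable borel" using borel_measurable_integrable[OF f] by simp
  have "(\<integral>\<^sup>+y. (\<integral>\<^sup>+x. ennreal (norm (f x)) \<partial>\<eta> y t) \<partial>\<mu>) < \<infinity>"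
  proof -
    have "(\<integral>\<^sup>+x. ennreal (norm (f x)) \<partial>\<mu>) < \<infinity>"
      using f unfolding integrable_iff_bounded by (rule conjunct2)
    then show ?thesis by (subst kernel_nn_integral_law[OF t]) simp_all
  qed
  then have "AE y in \<mu>. (\<integral>\<^sup>+x. ennreal (norm (f x)) \<partial>\<eta> y t) \<noteq> \<infinity>"
    using measurable_kernel_nn_integral[OF t, of "\<lambda>x. ennreal (norm (f x))"] by (intro nn_integral_PInf_AE) auto
  then show ?thesis
    by eventually_elim (simp add: integrable_iff_bounded measurable_kernel_eq[OF t] less_top)
qed

text \<open>\<open>F\<close> lies between the sigma-algebra of \<open>X s\<close> and the past up to
  \<open>s\<close>, so that one proof covers conditioning on the whole past and on the present value
  alone.\<close>

lemma cond_exp_kernel_nonneg: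
  assumes st: "s < t" and f: "integrable \<mu> f" "\<And>x. 0 \<le> f x"
    and F: "subalgebra M F" "sets F \<subseteq> sets (past M X s)" "X s \<in> borel_measurable F"
  shows "integrable M (\<lambda>\<omega>. kernel_op (t - s) f (X s \<omega>))"
    "AE \<omega> in M. real_cond_exp M F (\<lambda>\<omega>. f (X t \<omega>)) \<omega> = kernel_op (t - s) f (X s \<omega>)"
proof -
  interpret P: sigma_finite_subalgebra M F by (rule finite_subalgebra[OF F(1)])
  have ts: "0 < t - s" using st by simp
  have [measurable]: "f \<in> borel_measurable borel" using borel_measurable_integrable[OF f(1)] by simp
  have [measurable]: "kernel_op (t - s) f \<in> borel_measurable borel" by (rule kernel_op_measurable[OF ts]) simp
  have k0: "0 \<le> kernel_op (t - s) f y" for y unfolding kernel_op_def using f(2) by simp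
  have ae: "AE \<omega> in M. (\<integral>\<^sup>+x. ennreal (f x) \<partial>\<eta> (X s \<omega>) (t - s)) = ennreal (kernel_op (t - s) f (X s \<omega>))"
    using AE_law[OF AE_kernel_integrable[OF ts f(1)], of s]
    by eventually_elim (simp add: kernel_op_def nn_integral_eq_integral f(2))
  have eq: "(\<integral>\<^sup>+\<omega>. ennreal (f (X t \<omega>) * indicator A \<omega>) \<partial>M) = (\<integral>\<^sup>+\<omega>. ennreal (kernel_op (t - s) f (X s \<omega>) * indicator A \<omega>) \<partial>M)"
    if A: "A \<in> sets (past M X s)" for A
  proof -
    have "(\<integral>\<^sup>+\<omega>. ennreal (f (X t \<omega>) * indicator A \<omega>) \<partial>M) = (\<integral>\<^sup>+\<omega>. ennreal (f (X t \<omega>)) * indicator A \<omega> \<partial>M)"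
      by (intro nn_integral_cong) (simp add: indicator_def)
    also have "\<dots> = (\<integral>\<^sup>+\<omega>. (\<integral>\<^sup>+x. ennreal (f x) \<partial>\<eta> (X s \<omega>) (t - s)) * indicator A \<omega> \<partial>M)"
      by (rule kernel_nn_integral[OF st A]) simp
    also have "\<dots> = (\<integral>\<^sup>+\<omega>. ennreal (kernel_op (t - s) f (X s \<omega>) * indicator A \<omega>) \<partial>M)"
      by (rule nn_integral_cong_AE, use ae in eventually_elim) (simp add: indicator_def)
    finally show ?thesis .
  qed
  have fi: "integrable M (\<lambda>\<omega>. f (X t \<omega>))" using f(1) integrable_law_iff[of f t] by simp
  have sp: "space M \<in> sets (past M X s)" using sets.top[of "past M X s"] by simp
  have "(\<integral>\<^sup>+\<omega>. ennreal (kernel_op (t - s) f (X s \<omega>)) \<partial>M) = (\<integral>\<^sup>+\<omega>. ennreal (f (X t \<omega>)) \<partial>M)"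
    using eq[OF sp] by (simp cong: nn_integral_cong)
  also have "\<dots> < \<infinity>" using fi f(2) by (simp add: integrable_iff_bounded)
  finally show ki: "integrable M (\<lambda>\<omega>. kernel_op (t - s) f (X s \<omega>))"
    using k0 by (simp add: integrable_iff_bounded)
  show "AE \<omega> in M. real_cond_exp M F (\<lambda>\<omega>. f (X t \<omega>)) \<omega> = kernel_op (t - s) f (X s \<omega>)"
  proof (rule P.real_cond_exp_charact[OF _ fi ki])
    fix A assume A: "A \<in> sets F"
    have AM: "A \<in> sets M" using A F(1) by (auto simp: subalgebra_def)
    have "(\<integral>\<omega>. f (X t \<omega>) * indicator A \<omega> \<partial>M) = (\<integral>\<omega>. kernel_op (t - s) f (X s \<omega>) * indicator A \<omega> \<partial>M)"
      using eq[of A] A F(2) f(2) k0 AM by (subst (1 2) integral_eq_nn_integral) auto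
    then show "(LINT \<omega>:A|M. f (X t \<omega>)) = (LINT \<omega>:A|M. kernel_op (t - s) f (X s \<omega>))"
      by (simp add: set_lebesgue_integral_def mult.commute)
  next
    show "(\<lambda>\<omega>. kernel_op (t - s) f (X s \<omega>)) \<in> borel_measurable F"
      by (rule measurable_compose[OF F(3)]) simp
  qed
qed

text \<open>The operator respects the splitting into positive and negative part only where the
  kernel integrates both, that is, almost everywhere.\<close>

lemma cond_exp_kernel:
  assumes st: "s < t" and f: "integrable \<mu> f"
    and F: "subalgebra M F" "sets F \<subseteq> sets (past M X s)" "X s \<in> borel_measurable F"
  shows "integrable M (\<lambda>\<omega>. kernel_op (t - s) f (X s \<omega>))"
    "AE \<omega> in M. real_cond_exp M F (\<lambda>\<omega>. f (X t \<omega>)) \<omega> = kernel_op (t - s) f (X s \<omega>)"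
proof -
  interpret P: sigma_finite_subalgebra M F by (rule finite_subalgebra[OF F(1)])
  have ts: "0 < t - s" using st by simp
  have [measurable]: "f \<in> borel_measurable borel" using borel_measurable_integrable[OF f] by simp
  define p where "p x = max 0 (f x)" for x
  define n where "n x = max 0 (- f x)" for x
  have pn: "integrable \<mu> p" "integrable \<mu> n" unfolding p_def n_def using f by auto
  have f_eq: "f x = p x - n x" for x by (simp add: p_def n_def)
  have nn: "0 \<le> p x" "0 \<le> n x" for x by (auto simp: p_def n_def)
  note P = cond_exp_kernel_nonneg[OF st pn(1) nn(1) F] and N = cond_exp_kernel_nonneg[OF st pn(2) nn(2) F]
  have ae: "AE \<omega> in M. kernel_op (t - s) f (X s \<omega>) = kernel_op (t - s) p (X s \<omega>) - kernel_op (t - s) n (X s \<omega>)"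
    using AE_law[OF AE_kernel_integrable[OF ts pn(1)], of s] AE_law[OF AE_kernel_integrable[OF ts pn(2)], of s]
    by eventually_elim (simp add: kernel_op_def f_eq)
  have [measurable]: "kernel_op (t - s) f \<in> borel_measurable borel" by (rule kernel_op_measurable[OF ts]) simp
  show "integrable M (\<lambda>\<omega>. kernel_op (t - s) f (X s \<omega>))"
    by (rule integrable_cong_AE_imp[OF Bochner_Integration.integrable_diff[OF P(1) N(1)]]) (use ae in auto)
  have "integrable M (\<lambda>\<omega>. p (X t \<omega>))" "integrable M (\<lambda>\<omega>. n (X t \<omega>))"
    using pn integrable_law_iff[of _ t] borel_measurable_integrable[OF pn(1)] borel_measurable_integrable[OF pn(2)] by auto
  from P.real_cond_exp_diff[OF this] P(2) N(2) ae
  show "AE \<omega> in M. real_cond_exp M F (\<lambda>\<omega>. f (X t \<omega>)) \<omega> = kernel_op (t - s) f (X s \<omega>)"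
    unfolding f_eq[abs_def, symmetric] f_eq[symmetric] by eventually_elim simp
qed

lemma cond_exp_past:
  assumes "s < t" "integrable \<mu> f"
  shows "AE \<omega> in M. real_cond_exp M (past M X s) (\<lambda>\<omega>. f (X t \<omega>)) \<omega> = kernel_op (t - s) f (X s \<omega>)"
  by (rule cond_exp_kernel(2)[OF assms subalgebra_past _ measurable_past]) auto

lemma cond_exp_given_kernel:
  assumes t: "0 < t" and f: "integrable \<mu> f"
  shows "cond_exp_given M (\<lambda>\<omega>. f (X t \<omega>)) (X 0) (kernel_op t f)"
  unfolding cond_exp_given_def
proof (intro conjI)
  have [measurable]: "f \<in> borel_measurable borel" using borel_measurable_integrable[OF f] by simp
  show "integrable M (\<lambda>\<omega>. f (X t \<omega>))" using f integrable_law_iff[of f t] by simp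
  show "kernel_op t f \<in> borel_measurable borel" by (rule kernel_op_measurable[OF t]) simp
  show "AE \<omega> in M. real_cond_exp M (sigma_gen M (X 0)) (\<lambda>\<omega>. f (X t \<omega>)) \<omega> = kernel_op t f (X 0 \<omega>)"
    using cond_exp_kernel(2)[OF t f subalgebra_sigma_gen sets_sigma_gen_past measurable_sigma_gen] by simp
qed

text \<open>Jensen's inequality for the square. Where \<open>f\<close> is not integrable and the
  default value of the integral enters, the right-hand side is infinite.\<close>

lemma kernel_op_square_le:
  assumes t: "0 < t" and f: "f \<in> borel_measurable borel"
  shows "ennreal ((kernel_op t f y)\<^sup>2) \<le> (\<integral>\<^sup>+x. ennreal ((f x)\<^sup>2) \<partial>\<eta> y t)"
proof (cases "(\<integral>\<^sup>+x. ennreal ((f x)\<^sup>2) \<partial>\<eta> y t) = \<infinity>")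
  case False
  interpret K: prob_space "\<eta> y t" by (rule prob_kernel[OF t])
  have [measurable]: "f \<in> borel_measurable (\<eta> y t)" using f by (simp add: measurable_kernel_eq[OF t])
  have i: "integrable (\<eta> y t) (\<lambda>x. (f x)\<^sup>2)" using False by (simp add: integrable_iff_bounded less_top)
  have "(kernel_op t f y)\<^sup>2 \<le> (\<integral>x. (f x)\<^sup>2 \<partial>\<eta> y t)"
    using cauchy_schwarz_integral[of f "\<eta> y t" "\<lambda>_. 1"] i K.prob_space by (simp add: kernel_op_def)
  then show ?thesis using nn_integral_eq_integral[OF i] by (simp add: ennreal_leI)
qed simp

lemma L2_integrable_law: "f \<in> L2 \<mu> \<Longrightarrow> integrable \<mu> f"
  using L2_mult_integrable[of f \<mu> "\<lambda>_. 1"] by (simp add: L2_def)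

lemma kernel_op_L2:
  assumes t: "0 < t" and f: "f \<in> L2 \<mu>"
  shows "kernel_op t f \<in> L2 \<mu>" "L2_norm \<mu> (kernel_op t f) \<le> L2_norm \<mu> f"
proof -
  have fm [measurable]: "f \<in> borel_measurable borel" using L2_measurable[OF f] by simp
  have [measurable]: "kernel_op t f \<in> borel_measurable borel" by (rule kernel_op_measurable[OF t]) simp
  have "(\<integral>\<^sup>+y. ennreal ((kernel_op t f y)\<^sup>2) \<partial>\<mu>) \<le> (\<integral>\<^sup>+y. (\<integral>\<^sup>+x. ennreal ((f x)\<^sup>2) \<partial>\<eta> y t) \<partial>\<mu>)"
    by (intro nn_integral_mono kernel_op_square_le[OF t fm])
  also have "\<dots> = (\<integral>\<^sup>+x. ennreal ((f x)\<^sup>2) \<partial>\<mu>)" by (rule kernel_nn_integral_law[OF t]) simp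
  also have "\<dots> = ennreal (\<integral>x. (f x)\<^sup>2 \<partial>\<mu>)" by (rule nn_integral_eq_integral[OF L2_integrable[OF f]]) simp
  finally have le: "(\<integral>\<^sup>+y. ennreal ((kernel_op t f y)\<^sup>2) \<partial>\<mu>) \<le> ennreal (\<integral>x. (f x)\<^sup>2 \<partial>\<mu>)" .
  have i: "integrable \<mu> (\<lambda>y. (kernel_op t f y)\<^sup>2)"
    using le_less_trans[OF le] by (simp add: integrable_iff_bounded)
  then show "kernel_op t f \<in> L2 \<mu>" by (intro L2I) auto
  show "L2_norm \<mu> (kernel_op t f) \<le> L2_norm \<mu> f"
    using le nn_integral_eq_integral[OF i] by (simp add: L2_norm_def)
qed

lemma integral_two_times:
  assumes st: "s < t" and f: "f \<in> L2 \<mu>" and g: "g \<in> L2 \<mu>"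
  shows "(\<integral>\<omega>. g (X s \<omega>) * f (X t \<omega>) \<partial>M) = (\<integral>y. g y * kernel_op (t - s) f y \<partial>\<mu>)"
proof -
  interpret P: sigma_finite_subalgebra M "past M X s" by (rule finite_subalgebra[OF subalgebra_past])
  have ts: "0 < t - s" using st by simp
  have [measurable]: "f \<in> borel_measurable borel" "g \<in> borel_measurable borel"
    using L2_measurable[OF f] L2_measurable[OF g] by auto
  have [measurable]: "kernel_op (t - s) f \<in> borel_measurable borel" by (rule kernel_op_measurable[OF ts]) simp
  have [measurable]: "(\<lambda>\<omega>. g (X s \<omega>)) \<in> borel_measurable (past M X s)"
    by (rule measurable_compose[OF measurable_past[OF order_refl]]) simp
  have i: "integrable M (\<lambda>\<omega>. g (X s \<omega>) * f (X t \<omega>))"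
  proof (rule square_integrable_mult)
    show "integrable M (\<lambda>\<omega>. (g (X s \<omega>))\<^sup>2)"
      using L2_integrable[OF g] integrable_law_iff[of "\<lambda>x. (g x)\<^sup>2" s] by simp
    show "integrable M (\<lambda>\<omega>. (f (X t \<omega>))\<^sup>2)"
      using L2_integrable[OF f] integrable_law_iff[of "\<lambda>x. (f x)\<^sup>2" t] by simp
  qed auto
  have "(\<integral>\<omega>. g (X s \<omega>) * f (X t \<omega>) \<partial>M) = (\<integral>\<omega>. g (X s \<omega>) * real_cond_exp M (past M X s) (\<lambda>\<omega>. f (X t \<omega>)) \<omega> \<partial>M)"
    by (rule P.real_cond_exp_intg(2)[OF i, symmetric]) auto
  also have "\<dots> = (\<integral>\<omega>. g (X s \<omega>) * kernel_op (t - s) f (X s \<omega>) \<partial>M)"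
    by (rule integral_cong_AE) (use cond_exp_past[OF st L2_integrable_law[OF f]] in auto)
  also have "\<dots> = (\<integral>y. g y * kernel_op (t - s) f y \<partial>\<mu>)"
    by (rule integral_law[symmetric]) simp
  finally show ?thesis .
qed

end

section \<open>Spectral representation of the process\<close>

text \<open>\<open>h\<close> and \<open>\<alpha>\<close> are parameters rather than witnesses, so
  that two processes sharing them can be interpreted side by side.\<close>

locale spectral_process = smpr_process M X \<eta> for M :: "'a measure" and X \<eta> +
  fixes h :: "nat \<Rightarrow> real poly" and \<alpha> :: "nat \<Rightarrow> real"
  assumes spectral: "spectral_data M X h \<alpha>"
begin

sublocale basis: poly_basis \<mu> h
  using determinate spectral by unfold_locales (auto simp: spectral_data_def)

lemma eigen_past:
  "n \<in> basis.I \<Longrightarrow> s < t \<Longrightarrow> AE \<omega> in M. real_cond_exp M (past M X s) (\<lambda>\<omega>. poly (h n) (X t \<omega>)) \<omega>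
     = exp (- \<alpha> n * (t - s)) * poly (h n) (X s \<omega>)"
  using spectral by (auto simp: spectral_data_def eigen_regression_def basis.I_def)

text \<open>The eigenvalue relation is given along the process; it moves to almost every
  \<open>y\<close> because \<open>X 0\<close> has the law \<open>\<mu>\<close>.\<close>

lemma kernel_op_h:
  assumes n: "n \<in> basis.I" and t: "0 < t"
  shows "AE y in \<mu>. kernel_op t (poly (h n)) y = exp (- \<alpha> n * t) * poly (h n) y"
proof -
  have [measurable]: "kernel_op t (poly (h n)) \<in> borel_measurable borel"
    by (rule kernel_op_measurable[OF t]) simp
  have "AE \<omega> in M. kernel_op t (poly (h n)) (X 0 \<omega>) = exp (- \<alpha> n * t) * poly (h n) (X 0 \<omega>)"
    using cond_exp_past[OF t mu.poly_integrable[of "h n"]] eigen_past[OF n t] by eventually_elim simp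
  then show ?thesis by (subst AE_law_iff[of _ 0]) auto
qed

lemma norm_h: "n \<in> basis.I \<Longrightarrow> L2_norm \<mu> (poly (h n)) = 1"
  using basis.inner_h[of n n] by (simp add: L2_norm_def power2_eq_square)

text \<open>At time one the operator multiplies the unit vector \<open>h n\<close> by
  \<open>exp (- \<alpha> n)\<close> and does not increase norms.\<close>

lemma \<alpha>_nonneg:
  assumes n: "n \<in> basis.I" shows "0 \<le> \<alpha> n"
proof -
  have "L2_norm \<mu> (kernel_op 1 (poly (h n))) = L2_norm \<mu> (\<lambda>y. exp (- \<alpha> n * 1) * poly (h n) y)"
    by (rule L2_norm_cong_AE[OF _ _ kernel_op_h[OF n]]) (use kernel_op_measurable[of 1 "poly (h n)"] in auto)
  then have "exp (- \<alpha> n) \<le> 1"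
    using kernel_op_L2(2)[of 1 "poly (h n)"] mu.poly_L2[of "h n"] norm_h[OF n] by (simp add: L2_norm_scale)
  then show ?thesis by simp
qed

text \<open>The kernel carries information at positive times only, hence the separate value at
  zero.\<close>

definition U :: "real \<Rightarrow> (real \<Rightarrow> real) \<Rightarrow> real \<Rightarrow> real" where
  "U t = (if t = 0 then id else kernel_op t)"

lemma kernel_op_psum:
  assumes t: "0 < t" and A: "finite A" "A \<subseteq> basis.I"
  shows "AE y in \<mu>. kernel_op t (basis.psum c A) y = basis.psum (\<lambda>n. exp (- \<alpha> n * t) * c n) A y"
proof -
  have "AE y in \<mu>. \<forall>n\<in>A. integrable (\<eta> y t) (poly (h n)) \<and> kernel_op t (poly (h n)) y = exp (- \<alpha> n * t) * poly (h n) y"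
    using A kernel_op_h[OF _ t] AE_kernel_integrable[OF t mu.poly_integrable]
    by (intro AE_finite_allI) auto
  then show ?thesis
  proof eventually_elim
    case (elim y)
    have "kernel_op t (basis.psum c A) y = (\<Sum>n\<in>A. c n * kernel_op t (poly (h n)) y)"
      unfolding kernel_op_def basis.psum_def
      using elim by (subst Bochner_Integration.integral_sum) auto
    also have "\<dots> = basis.psum (\<lambda>n. exp (- \<alpha> n * t) * c n) A y"
      unfolding basis.psum_def by (rule sum.cong) (use elim in auto)
    finally show ?case .
  qed
qed

text \<open>On partial sums the operator acts term by term. Being a contraction, it carries their
  convergence to \<open>f\<close> over to the images.\<close>

lemma kernel_op_expansion:
  assumes t: "0 < t" and c: "has_expansion \<mu> h c f"
  shows "has_expansion \<mu> h (\<lambda>n. exp (- \<alpha> n * t) * c n) (kernel_op t f)"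
  unfolding basis.has_expansion_iff
proof
  have f: "f \<in> L2 \<mu>" by (rule basis.has_expansion_L2[OF c])
  have fm [measurable]: "f \<in> borel_measurable borel" using L2_measurable[OF f] by simp
  show "kernel_op t f \<in> L2 \<mu>" by (rule kernel_op_L2(1)[OF t f])
  let ?p = "\<lambda>N. basis.psum c (basis.J N)" and ?q = "\<lambda>N. basis.psum (\<lambda>n. exp (- \<alpha> n * t) * c n) (basis.J N)"
  have pm [measurable]: "basis.psum d A \<in> borel_measurable borel" for d A
    using L2_measurable[OF basis.psum_L2] by simp
  have le: "L2_norm \<mu> (\<lambda>x. kernel_op t f x - ?q N x) \<le> L2_norm \<mu> (\<lambda>x. f x - ?p N x)" for N
  proof -
    have L: "(\<lambda>x. f x - ?p N x) \<in> L2 \<mu>" by (intro L2_diff f basis.psum_L2)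
    have "AE y in \<mu>. kernel_op t f y - ?q N y = kernel_op t (\<lambda>x. f x - ?p N x) y"
      using kernel_op_psum[OF t basis.finite_J[of N] basis.J_sub[of N], of c]
        AE_kernel_integrable[OF t L2_integrable_law[OF f]]
        AE_kernel_integrable[OF t L2_integrable_law[OF basis.psum_L2[of c "basis.J N"]]]
      by eventually_elim (simp add: kernel_op_def)
    then have "L2_norm \<mu> (\<lambda>x. kernel_op t f x - ?q N x) = L2_norm \<mu> (kernel_op t (\<lambda>x. f x - ?p N x))"
      using kernel_op_measurable[OF t fm] kernel_op_measurable[OF t, of "\<lambda>x. f x - ?p N x"]
      by (intro L2_norm_cong_AE) auto
    also have "\<dots> \<le> L2_norm \<mu> (\<lambda>x. f x - ?p N x)" by (rule kernel_op_L2(2)[OF t L])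
    finally show ?thesis .
  qed
  have "(\<lambda>N. L2_norm \<mu> (\<lambda>x. f x - ?p N x)) \<longlonglongrightarrow> 0" using c by (simp add: basis.has_expansion_iff)
  then show "(\<lambda>N. L2_norm \<mu> (\<lambda>x. kernel_op t f x - ?q N x)) \<longlonglongrightarrow> 0"
    by (rule tendsto_sandwich[OF _ _ tendsto_const, rotated 2]) (use le in auto)
qed

sublocale semigroup: poly_semigroup \<mu> h \<alpha> U
proof
  show "U 0 = id" by (simp add: U_def)
  show "has_expansion \<mu> h (\<lambda>n. exp (- \<alpha> n * t) * c n) (U t f)"
    if "0 \<le> t" "has_expansion \<mu> h c f" for t c f
    using that kernel_op_expansion[of t c f] by (cases "t = 0") (auto simp: U_def)
qed (rule \<alpha>_nonneg)

lemma cond_exp_given_U: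
  assumes t: "0 \<le> t" and f: "f \<in> L2 \<mu>"
  shows "cond_exp_given M (\<lambda>\<omega>. f (X t \<omega>)) (X 0) (U t f)"
proof (cases "t = 0")
  case False
  then show ?thesis using cond_exp_given_kernel[of t f] t L2_integrable_law[OF f] by (simp add: U_def)
next
  case True
  interpret P: sigma_finite_subalgebra M "sigma_gen M (X 0)" by (rule finite_subalgebra[OF subalgebra_sigma_gen])
  have fm: "f \<in> borel_measurable borel" using L2_measurable[OF f] by simp
  have i: "integrable M (\<lambda>\<omega>. f (X 0 \<omega>))" using integrable_law_iff[OF fm, of 0] L2_integrable_law[OF f] by simp
  have "AE \<omega> in M. real_cond_exp M (sigma_gen M (X 0)) (\<lambda>\<omega>. f (X 0 \<omega>)) \<omega> = f (X 0 \<omega>)"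
    by (rule P.real_cond_exp_F_meas[OF i]) (rule measurable_compose[OF measurable_sigma_gen fm])
  then show ?thesis using True i fm by (simp add: cond_exp_given_def U_def)
qed

section \<open>Two-time moments and vanishing indices\<close>

lemma integral_h_two_times:
  assumes m: "m \<in> basis.I" and n: "n \<in> basis.I" and st: "s \<le> t"
  shows "(\<integral>\<omega>. poly (h m) (X s \<omega>) * poly (h n) (X t \<omega>) \<partial>M) = (if m = n then exp (- \<alpha> n * (t - s)) else 0)"
proof (cases "s = t")
  case True
  then show ?thesis using integral_law[of "\<lambda>x. poly (h m) x * poly (h n) x" t] basis.inner_h[OF m n]
    by (cases "m = n") auto
next
  case False
  then have st: "s < t" using st by simp
  have "(\<integral>\<omega>. poly (h m) (X s \<omega>) * poly (h n) (X t \<omega>) \<partial>M) = (\<integral>y. poly (h m) y * kernel_op (t - s) (poly (h n)) y \<partial>\<mu>)"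
    by (rule integral_two_times[OF st mu.poly_L2 mu.poly_L2])
  also have "\<dots> = (\<integral>y. exp (- \<alpha> n * (t - s)) * (poly (h m) y * poly (h n) y) \<partial>\<mu>)"
    by (rule integral_cong_AE) (use kernel_op_h[OF n, of "t - s"] kernel_op_measurable[of "t - s" "poly (h n)"] st in auto)
  also have "\<dots> = (if m = n then exp (- \<alpha> n * (t - s)) else 0)"
    using basis.inner_h[OF m n] by simp
  finally show ?thesis .
qed

lemma integrable_poly_X: "integrable M (\<lambda>\<omega>. poly p (X t \<omega>))"
  using integrable_law_iff[of "poly p" t] mu.poly_integrable by simp

lemma integrable_poly_X_mult: "integrable M (\<lambda>\<omega>. poly p (X s \<omega>) * poly q (X t \<omega>))"
proof (rule square_integrable_mult)
  show "integrable M (\<lambda>\<omega>. (poly p (X s \<omega>))\<^sup>2)" "integrable M (\<lambda>\<omega>. (poly q (X t \<omega>))\<^sup>2)"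
    using integrable_poly_X[of "p\<^sup>2" s] integrable_poly_X[of "q\<^sup>2" t] by simp_all
qed auto

text \<open>With index zero the two-time moment of \<open>h n\<close> equals one, so the mean square
  of the increment is \<open>1 - 2 + 1 = 0\<close>.\<close>

lemma constant_if_\<alpha>_zero:
  assumes n: "n \<in> basis.I" and \<alpha>: "\<alpha> n = 0"
  shows "AE \<omega> in M. poly (h n) (X t \<omega>) = poly (h n) (X s \<omega>)"
proof -
  have one: "(\<integral>\<omega>. poly (h n) (X s \<omega>) * poly (h n) (X t \<omega>) \<partial>M) = 1" for s t
    using integral_h_two_times[OF n n, of s t] integral_h_two_times[OF n n, of t s] \<alpha>
    by (cases "s \<le> t") (auto simp: mult.commute)
  have i: "integrable M (\<lambda>\<omega>. (poly (h n) (X t \<omega>) - poly (h n) (X s \<omega>))\<^sup>2)"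
    using integrable_poly_X_mult by (simp add: power2_eq_square algebra_simps)
  have "(\<integral>\<omega>. (poly (h n) (X t \<omega>) - poly (h n) (X s \<omega>))\<^sup>2 \<partial>M) = 0"
    using integrable_poly_X_mult by (simp add: power2_eq_square left_diff_distrib right_diff_distrib one)
  then have "AE \<omega> in M. (poly (h n) (X t \<omega>) - poly (h n) (X s \<omega>))\<^sup>2 = 0"
    using integral_nonneg_eq_0_iff_AE[OF i] by simp
  then show ?thesis by simp
qed

lemma \<alpha>_pos:
  assumes n: "n \<in> basis.I" and ne: "\<not> (AE \<omega> in M. poly (h n) (X t \<omega>) = poly (h n) (X s \<omega>))"
  shows "0 < \<alpha> n"
  using \<alpha>_nonneg[OF n] constant_if_\<alpha>_zero[OF n, of t s] ne by (cases "\<alpha> n = 0") auto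

text \<open>\<open>h 1\<close> is affine: if it did not move between the times 0 and 1, neither
  would \<open>X\<close>, and the covariance matrix at these times would have equal rows. Its
  non-singularity is assumed for fewer than \<open>v\<close> times, hence
  \<open>2 < v\<close>.\<close>

lemma \<alpha>_1_pos:
  assumes v: "2 < supp_size \<mu>"
  shows "0 < \<alpha> 1"
proof (rule \<alpha>_pos)
  have "(1::enat) < 2" by simp
  then have "enat 1 < supp_size \<mu>" using v by (metis less_trans one_enat_def)
  then show n: "1 \<in> basis.I" by (simp add: basis.I_def)
  show "\<not> (AE \<omega> in M. poly (h 1) (X 1 \<omega>) = poly (h 1) (X 0 \<omega>))"
  proof
    assume "AE \<omega> in M. poly (h 1) (X 1 \<omega>) = poly (h 1) (X 0 \<omega>)"
    moreover obtain a b where ab: "h 1 = [:a, b:]" "b \<noteq> 0"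
    proof -
      have "degree (h 1) = Suc 0" using basis.degree_h[OF n] by simp
      moreover obtain a q where q: "h 1 = pCons a q" by (cases "h 1")
      ultimately have "degree q = 0" "q \<noteq> 0" by (auto simp: degree_pCons_eq_if split: if_splits)
      then show ?thesis using q by (auto elim!: degree_eq_zeroE intro: that)
    qed
    ultimately have ae: "AE \<omega> in M. X 1 \<omega> = X 0 \<omega>" by simp
    let ?A = "Matrix.mat (length [0, 1::real]) (length [0, 1::real]) (\<lambda>(i, j). covariance M (X ([0, 1::real] ! i)) (X ([0, 1::real] ! j)))"
    have e: "(\<integral>\<omega>. X 1 \<omega> \<partial>M) = (\<integral>\<omega>. X 0 \<omega> \<partial>M)" by (rule integral_cong_AE) (use ae in auto)
    have c: "covariance M (X 1) Y = covariance M (X 0) Y" if [measurable]: "Y \<in> borel_measurable M" for Y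
      unfolding covariance_def e by (rule integral_cong_AE) (use ae in auto)
    have "row ?A 0 = row ?A 1"
      by (rule eq_vecI) (auto simp: c less_Suc_eq numeral_2_eq_2)
    then have "Determinant.det ?A = 0"
      by (intro det_identical_rows[of _ 2 0 1]) (auto simp: numeral_2_eq_2)
    moreover have "enat (length [0, 1::real]) = 2" by (simp add: numeral_eq_enat)
    ultimately show False using TLD[of "[0, 1]"] v by simp
  qed
qed

section \<open>Martingales and transition densities\<close>

lemma martingale_h:
  assumes n: "n \<in> basis.I"
  shows "martingale M (past M X) (\<lambda>t \<omega>. exp (\<alpha> n * t) * poly (h n) (X t \<omega>))"
  unfolding martingale_def
proof (intro conjI allI impI)
  show "filtration (space M) (past M X)" by (rule filtration_past)
  show "subalgebra M (past M X t)" for t by (rule subalgebra_past)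
  show m: "(\<lambda>\<omega>. exp (\<alpha> n * t) * poly (h n) (X t \<omega>)) \<in> borel_measurable (past M X t)" for t
    using measurable_past[OF order_refl, of t] by simp
  show i: "integrable M (\<lambda>\<omega>. exp (\<alpha> n * t) * poly (h n) (X t \<omega>))" for t
    using integrable_poly_X by simp
  fix s t :: real assume "s \<le> t"
  interpret P: sigma_finite_subalgebra M "past M X s" by (rule finite_subalgebra[OF subalgebra_past])
  show "AE \<omega> in M. real_cond_exp M (past M X s) (\<lambda>\<omega>. exp (\<alpha> n * t) * poly (h n) (X t \<omega>)) \<omega> = exp (\<alpha> n * s) * poly (h n) (X s \<omega>)"
  proof (cases "s = t")
    case True
    then show ?thesis using P.real_cond_exp_F_meas[OF i m] by simp
  next
    case False
    then have st: "s < t" using \<open>s \<le> t\<close> by simp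
    show ?thesis
      using P.real_cond_exp_cmult[OF integrable_poly_X, of "exp (\<alpha> n * t)" "h n" t] eigen_past[OF n st]
    proof eventually_elim
      case (elim \<omega>)
      have "exp (\<alpha> n * t) * exp (- \<alpha> n * (t - s)) = exp (\<alpha> n * s)"
        by (simp add: exp_add[symmetric] algebra_simps)
      then show ?case unfolding elim by (simp add: mult.assoc[symmetric])
    qed
  qed
qed

lemma martingales_orthogonal:
  assumes m: "m \<in> basis.I" and n: "n \<in> basis.I" and mn: "m \<noteq> n"
  shows "(\<integral>\<omega>. (exp (\<alpha> m * s) * poly (h m) (X s \<omega>)) * (exp (\<alpha> n * t) * poly (h n) (X t \<omega>)) \<partial>M) = 0"
proof -
  have "(\<integral>\<omega>. poly (h m) (X s \<omega>) * poly (h n) (X t \<omega>) \<partial>M) = 0"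
    using integral_h_two_times[OF m n, of s t] integral_h_two_times[OF n m, of t s] mn
    by (cases "s \<le> t") (auto simp: mult.commute)
  moreover have "(\<lambda>\<omega>. (exp (\<alpha> m * s) * poly (h m) (X s \<omega>)) * (exp (\<alpha> n * t) * poly (h n) (X t \<omega>)))
      = (\<lambda>\<omega>. (exp (\<alpha> m * s) * exp (\<alpha> n * t)) * (poly (h m) (X s \<omega>) * poly (h n) (X t \<omega>)))"
    by (auto simp: mult_ac)
  ultimately show ?thesis by simp
qed

text \<open>The \<open>n\<close>-th coefficient of the density in \<open>x\<close> is the integral
  of \<open>h n\<close> under the kernel at \<open>y\<close>, that is
  \<open>exp (- \<alpha> n * t) * poly (h n) y\<close>. There are countably many indices, so one
  null set of exceptional \<open>y\<close> serves all of them.\<close>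

lemma density_expansion:
  assumes t: "0 < t"
  shows "AE y in \<mu>. absolutely_continuous \<mu> (\<eta> y t) \<and> (\<integral>\<^sup>+x. (RN_deriv \<mu> (\<eta> y t) x)\<^sup>2 \<partial>\<mu>) < \<infinity> \<longrightarrow>
    has_expansion \<mu> h (\<lambda>n. exp (- \<alpha> n * t) * poly (h n) y) (\<lambda>x. enn2real (RN_deriv \<mu> (\<eta> y t) x))"
proof -
  have "AE y in \<mu>. \<forall>n\<in>basis.I. kernel_op t (poly (h n)) y = exp (- \<alpha> n * t) * poly (h n) y"
    using kernel_op_h[OF _ t] by (subst AE_ball_countable) auto
  then show ?thesis
  proof (eventually_elim, intro impI)
    fix y assume y: "\<forall>n\<in>basis.I. kernel_op t (poly (h n)) y = exp (- \<alpha> n * t) * poly (h n) y"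
      and D2: "absolutely_continuous \<mu> (\<eta> y t) \<and> (\<integral>\<^sup>+x. (RN_deriv \<mu> (\<eta> y t) x)\<^sup>2 \<partial>\<mu>) < \<infinity>"
    define D where "D = RN_deriv \<mu> (\<eta> y t)"
    define d where "d x = enn2real (D x)" for x
    have [measurable]: "D \<in> borel_measurable borel"
      using borel_measurable_RN_deriv[of \<mu> "\<eta> y t"] by (simp add: D_def)
    have [measurable]: "d \<in> borel_measurable borel" unfolding d_def by measurable
    \<comment> \<open>The Radon--Nikodym derivative has extended values; square integrability makes
      it finite almost everywhere, so \<open>enn2real\<close> loses nothing.\<close>
    have "AE x in \<mu>. (D x)\<^sup>2 \<noteq> \<infinity>" using D2 by (intro nn_integral_PInf_AE) (auto simp: D_def[symmetric])
    then have Dd: "AE x in \<mu>. D x = ennreal (d x)"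
      by eventually_elim (auto simp: d_def power2_eq_square less_top ennreal_mult_eq_top_iff)
    have dens: "density \<mu> (\<lambda>x. ennreal (d x)) = \<eta> y t"
    proof -
      have "density \<mu> (\<lambda>x. ennreal (d x)) = density \<mu> D"
        by (rule density_cong) (use Dd in auto)
      also have "\<dots> = \<eta> y t"
        unfolding D_def using D2 by (intro mu.density_RN_deriv) (auto simp: sets_kernel[OF t])
      finally show ?thesis .
    qed
    have "(\<integral>\<^sup>+x. ennreal ((d x)\<^sup>2) \<partial>\<mu>) = (\<integral>\<^sup>+x. (D x)\<^sup>2 \<partial>\<mu>)"
      by (rule nn_integral_cong_AE, use Dd in eventually_elim) (simp add: ennreal_power[symmetric] d_def)
    then have dL: "d \<in> L2 \<mu>" using D2 by (intro L2I) (auto simp: integrable_iff_bounded D_def)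
    have "has_expansion \<mu> h (\<lambda>n. exp (- \<alpha> n * t) * poly (h n) y) d"
    proof (rule basis.has_expansionI[OF dL])
      fix n assume n: "n \<in> basis.I"
      have "basis.coef d n = (\<integral>x. poly (h n) x \<partial>density \<mu> (\<lambda>x. ennreal (d x)))"
        unfolding basis.coef_def by (subst integral_density) (auto simp: d_def)
      then show "basis.coef d n = exp (- \<alpha> n * t) * poly (h n) y"
        using y n by (simp add: dens kernel_op_def)
    qed
    then show "has_expansion \<mu> h (\<lambda>n. exp (- \<alpha> n * t) * poly (h n) y) (\<lambda>x. enn2real (RN_deriv \<mu> (\<eta> y t) x))"
      by (simp add: d_def[abs_def] D_def)
  qed
qed

end

section \<open>Uniqueness of the finite-dimensional distributions\<close>

context smpr_process
begin

text \<open>The product over earlier times is measurable with respect to the past up to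
  \<open>s\<close>, so conditioning acts on the last factor alone.\<close>

lemma integral_prod_step:
  assumes K: "finite K" "\<And>r. r \<in> K \<Longrightarrow> r \<le> s" and st: "s < t"
    and f: "\<And>r. f r \<in> borel_measurable borel" "\<And>r x. 0 \<le> f r x" "\<And>r x. f r x \<le> (1::real)"
  shows "(\<integral>\<omega>. (\<Prod>r\<in>K. f r (X r \<omega>)) * f t (X t \<omega>) \<partial>M)
    = (\<integral>\<omega>. (\<Prod>r\<in>K. f r (X r \<omega>)) * kernel_op (t - s) (f t) (X s \<omega>) \<partial>M)"
proof -
  interpret P: sigma_finite_subalgebra M "past M X s" by (rule finite_subalgebra[OF subalgebra_past])
  have ts: "0 < t - s" using st by simp
  note [measurable] = f(1)
  have [measurable]: "kernel_op (t - s) (f t) \<in> borel_measurable borel"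
    by (rule kernel_op_measurable[OF ts f(1)])
  have fi: "integrable \<mu> (f t)"
    using f by (intro mu.integrable_const_bound[of _ 1]) auto
  have pm: "(\<lambda>\<omega>. \<Prod>r\<in>K. f r (X r \<omega>)) \<in> borel_measurable (past M X s)"
    by (intro borel_measurable_prod measurable_compose[OF measurable_past f(1)] K(2))
  have p01: "0 \<le> (\<Prod>r\<in>K. f r (X r \<omega>))" "(\<Prod>r\<in>K. f r (X r \<omega>)) \<le> 1" for \<omega>
    using f by (auto intro: prod_nonneg prod_le_1)
  have i: "integrable M (\<lambda>\<omega>. (\<Prod>r\<in>K. f r (X r \<omega>)) * f t (X t \<omega>))"
  proof (rule integrable_const_bound[of _ 1])
    show "AE \<omega> in M. norm ((\<Prod>r\<in>K. f r (X r \<omega>)) * f t (X t \<omega>)) \<le> 1"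
      using p01 f by (intro AE_I2) (auto simp: abs_mult intro!: mult_le_one)
  qed measurable
  have "(\<integral>\<omega>. (\<Prod>r\<in>K. f r (X r \<omega>)) * f t (X t \<omega>) \<partial>M)
      = (\<integral>\<omega>. (\<Prod>r\<in>K. f r (X r \<omega>)) * real_cond_exp M (past M X s) (\<lambda>\<omega>. f t (X t \<omega>)) \<omega> \<partial>M)"
    by (rule P.real_cond_exp_intg(2)[OF i pm, symmetric]) measurable
  also have "\<dots> = (\<integral>\<omega>. (\<Prod>r\<in>K. f r (X r \<omega>)) * kernel_op (t - s) (f t) (X s \<omega>) \<partial>M)"
    by (rule integral_cong_AE) (use cond_exp_past[OF st fi] in auto)
  finally show ?thesis .
qed

lemma kernel_op_bounds:
  assumes t: "0 < t" and f: "f \<in> borel_measurable borel" "\<And>x. 0 \<le> f x" "\<And>x. f x \<le> 1"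
  shows "0 \<le> kernel_op t f y" "kernel_op t f y \<le> 1"
proof -
  interpret K: prob_space "\<eta> y t" by (rule prob_kernel[OF t])
  have "integrable (\<eta> y t) f"
    using f by (intro K.integrable_const_bound[of _ 1]) (auto simp: measurable_kernel_eq[OF t])
  then have "kernel_op t f y \<le> (\<integral>x. 1 \<partial>\<eta> y t)"
    unfolding kernel_op_def using f(3) by (intro integral_mono) auto
  then show "kernel_op t f y \<le> 1" using K.prob_space by simp
  show "0 \<le> kernel_op t f y" unfolding kernel_op_def using f(2) by simp
qed

lemma emeasure_fdd_PiE:
  assumes J: "finite J" and B: "\<And>t. t \<in> J \<Longrightarrow> B t \<in> sets borel"
  shows "emeasure (fdd M X J) (Pi\<^sub>E J B) = ennreal (\<integral>\<omega>. (\<Prod>t\<in>J. indicator (B t) (X t \<omega>)) \<partial>M)"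
proof -
  have m: "(\<lambda>\<omega>. \<lambda>t\<in>J. X t \<omega>) \<in> M \<rightarrow>\<^sub>M PiM J (\<lambda>_. borel)" by measurable
  define S where "S = (\<lambda>\<omega>. \<lambda>t\<in>J. X t \<omega>) -` Pi\<^sub>E J B \<inter> space M"
  have S: "S \<in> sets M" unfolding S_def by (rule measurable_sets[OF m]) (use J B in auto)
  have "emeasure (fdd M X J) (Pi\<^sub>E J B) = emeasure M S"
    unfolding fdd_def S_def by (rule emeasure_distr[OF m]) (use J B in auto)
  also have "\<dots> = ennreal (\<integral>\<omega>. indicator S \<omega> \<partial>M)"
    using S by (simp add: emeasure_eq_measure)
  also have "(\<integral>\<omega>. (indicator S \<omega> :: real) \<partial>M) = (\<integral>\<omega>. (\<Prod>t\<in>J. indicator (B t) (X t \<omega>)) \<partial>M)"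
  proof (rule Bochner_Integration.integral_cong[OF refl])
    fix \<omega> assume \<omega>: "\<omega> \<in> space M"
    have "\<omega> \<in> S \<longleftrightarrow> (\<forall>t\<in>J. X t \<omega> \<in> B t)"
      using \<omega> unfolding S_def by (auto simp: PiE_iff)
    then show "indicator S \<omega> = (\<Prod>t\<in>J. indicator (B t) (X t \<omega>) :: real)"
      using J by (auto simp: indicator_def prod_zero_iff)
  qed
  finally show ?thesis .
qed

end

text \<open>Induction on the set of times, removing the largest: its factor is replaced by a
  transition operator evaluated at the preceding time. Test functions with values between 0 and 1
  are stable under this, and indicators of boxes, which are among their products, determine the law
  on a finite product.\<close>

lemma fdd_eq_if_spectral_data_eq:
  assumes A: "spectral_process M X \<eta> h \<alpha>" and B: "spectral_process M' X' \<eta>' h \<alpha>"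
    and law: "stationary_law M' X' = stationary_law M X" and J: "finite J"
  shows "fdd M' X' J = fdd M X J"
proof -
  interpret A: spectral_process M X \<eta> h \<alpha> by (rule A)
  interpret B: spectral_process M' X' \<eta>' h \<alpha> by (rule B)
  have op: "AE y in A.\<mu>. A.kernel_op t f y = B.kernel_op t f y" if t: "0 < t" and f: "f \<in> L2 A.\<mu>" for t f
    using A.basis.has_expansion_unique[OF A.kernel_op_expansion[OF t A.basis.has_expansion_self[OF f]]]
      B.kernel_op_expansion[OF t, of "A.basis.coef f" f] A.basis.has_expansion_self[OF f]
    by (simp add: law)
  have eq: "(\<integral>\<omega>. (\<Prod>t\<in>J. f t (X t \<omega>)) \<partial>M) = (\<integral>\<omega>. (\<Prod>t\<in>J. f t (X' t \<omega>)) \<partial>M')"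
    if "\<And>t. f t \<in> borel_measurable borel" "\<And>t x. 0 \<le> f t x" "\<And>t x. f t x \<le> (1::real)" for f
    using J that
  proof (induction J arbitrary: f rule: finite_linorder_max_induct)
    case empty
    then show ?case using A.prob_space B.prob_space by simp
  next
    case (insert t K)
    note f = insert.prems
    have tK: "t \<notin> K" using insert.hyps by auto
    show ?case
    proof (cases "K = {}")
      case True
      then show ?thesis using A.integral_law[OF f(1), of t t] B.integral_law[OF f(1), of t t] by (simp add: law)
    next
      case False
      define s where "s = Max K"
      have sK: "s \<in> K" "\<And>r. r \<in> K \<Longrightarrow> r \<le> s" using insert.hyps False by (auto simp: s_def)
      have st: "s < t" using sK insert.hyps by auto
      then have ts: "0 < t - s" by simp
      define g where "g = A.kernel_op (t - s) (f t)"
      have gm [measurable]: "g \<in> borel_measurable borel" unfolding g_def by (rule A.kernel_op_measurable[OF ts f(1)])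
      have g01: "0 \<le> g x" "g x \<le> 1" for x
        unfolding g_def using A.kernel_op_bounds[OF ts f(1) f(2) f(3)] by auto
      have [measurable]: "B.kernel_op (t - s) (f t) \<in> borel_measurable borel" by (rule B.kernel_op_measurable[OF ts f(1)])
      note [measurable] = f(1)
      \<comment> \<open>What remains after integrating out time \<open>t\<close> is absorbed into
        the factor at \<open>s\<close>.\<close>
      define f' where "f' = f(s := (\<lambda>x. f s x * g x))"
      have f'K: "(\<Prod>r\<in>K. f' r (z r)) = (\<Prod>r\<in>K. f r (z r)) * g (z s)" for z :: "real \<Rightarrow> real"
      proof -
        have "(\<Prod>r\<in>K. f' r (z r)) = f' s (z s) * (\<Prod>r\<in>K - {s}. f' r (z r))"
          using insert.hyps sK by (simp add: prod.remove)
        also have "(\<Prod>r\<in>K - {s}. f' r (z r)) = (\<Prod>r\<in>K - {s}. f r (z r))"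
          by (rule prod.cong) (auto simp: f'_def)
        also have "f' s (z s) * \<dots> = (f s (z s) * (\<Prod>r\<in>K - {s}. f r (z r))) * g (z s)" by (simp add: f'_def)
        also have "f s (z s) * (\<Prod>r\<in>K - {s}. f r (z r)) = (\<Prod>r\<in>K. f r (z r))"
          using insert.hyps sK by (simp add: prod.remove)
        finally show ?thesis .
      qed
      have "(\<integral>\<omega>. (\<Prod>r\<in>insert t K. f r (X r \<omega>)) \<partial>M) = (\<integral>\<omega>. (\<Prod>r\<in>K. f r (X r \<omega>)) * f t (X t \<omega>) \<partial>M)"
        using insert.hyps tK by (simp add: mult.commute)
      also have "\<dots> = (\<integral>\<omega>. (\<Prod>r\<in>K. f r (X r \<omega>)) * g (X s \<omega>) \<partial>M)"
        unfolding g_def by (rule A.integral_prod_step[OF insert.hyps(1) sK(2) st f])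
      also have "\<dots> = (\<integral>\<omega>. (\<Prod>r\<in>K. f' r (X r \<omega>)) \<partial>M)"
        using f'K[of "\<lambda>r. X r \<omega>" for \<omega>] by simp
      also have "\<dots> = (\<integral>\<omega>. (\<Prod>r\<in>K. f' r (X' r \<omega>)) \<partial>M')"
      proof (rule insert.IH)
        show "f' r \<in> borel_measurable borel" for r by (auto simp: f'_def)
        show "0 \<le> f' r x" "f' r x \<le> 1" for r x
          using f(2,3) g01 by (auto simp: f'_def intro: mult_le_one)
      qed
      also have "\<dots> = (\<integral>\<omega>. (\<Prod>r\<in>K. f r (X' r \<omega>)) * g (X' s \<omega>) \<partial>M')"
        using f'K[of "\<lambda>r. X' r \<omega>" for \<omega>] by simp
      \<comment> \<open>The kernels may differ, but both operators give the same expansion and the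
        marginal law at \<open>s\<close> is common, so the results agree almost surely at
        \<open>X' s\<close>.\<close>
      also have "\<dots> = (\<integral>\<omega>. (\<Prod>r\<in>K. f r (X' r \<omega>)) * B.kernel_op (t - s) (f t) (X' s \<omega>) \<partial>M')"
      proof (rule integral_cong_AE)
        have "f t \<in> L2 A.\<mu>"
        proof (rule L2I)
          show "integrable A.\<mu> (\<lambda>x. (f t x)\<^sup>2)"
            using f by (intro A.mu.integrable_const_bound[of _ 1]) (auto simp: power_le_one)
        qed simp
        then have "AE y in B.\<mu>. g y = B.kernel_op (t - s) (f t) y"
          unfolding law g_def by (rule op[OF ts])
        then have "AE \<omega> in M'. g (X' s \<omega>) = B.kernel_op (t - s) (f t) (X' s \<omega>)" by (rule B.AE_law)
        then show "AE \<omega> in M'. (\<Prod>r\<in>K. f r (X' r \<omega>)) * g (X' s \<omega>) = (\<Prod>r\<in>K. f r (X' r \<omega>)) * B.kernel_op (t - s) (f t) (X' s \<omega>)"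
          by eventually_elim simp
      qed measurable
      also have "\<dots> = (\<integral>\<omega>. (\<Prod>r\<in>K. f r (X' r \<omega>)) * f t (X' t \<omega>) \<partial>M')"
        by (rule B.integral_prod_step[OF insert.hyps(1) sK(2) st f, symmetric])
      also have "\<dots> = (\<integral>\<omega>. (\<Prod>r\<in>insert t K. f r (X' r \<omega>)) \<partial>M')"
        using insert.hyps tK by (simp add: mult.commute)
      finally show ?thesis .
    qed
  qed
  show ?thesis
  proof (rule measure_eqI_PiM_finite[OF J, of _ "\<lambda>_. borel"])
    show "sets (fdd M' X' J) = sets (PiM J (\<lambda>_. borel))" "sets (fdd M X J) = sets (PiM J (\<lambda>_. borel))"
      by (simp_all add: fdd_def)
    fix S :: "real \<Rightarrow> real set" assume S: "\<And>i. i \<in> J \<Longrightarrow> S i \<in> sets borel"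
    \<comment> \<open>Emptied outside \<open>J\<close>, because \<open>eq\<close> asks for
      measurability at every time.\<close>
    define S' where "S' t = (if t \<in> J then S t else {})" for t
    have PiE: "Pi\<^sub>E J S = Pi\<^sub>E J S'" by (rule PiE_cong) (simp add: S'_def)
    have S': "S' t \<in> sets borel" for t using S by (simp add: S'_def)
    show "emeasure (fdd M' X' J) (Pi\<^sub>E J S) = emeasure (fdd M X J) (Pi\<^sub>E J S)"
      unfolding PiE A.emeasure_fdd_PiE[OF J S'] B.emeasure_fdd_PiE[OF J S']
      using eq[of "\<lambda>t. indicator (S' t)"] S' by (simp add: indicator_def)
  next
    show "range (\<lambda>_. space (PiM J (\<lambda>_. borel))) \<subseteq> prod_algebra J (\<lambda>_. borel :: real measure)"
      using space_in_prod_algebra[of J "\<lambda>_. borel :: real measure"] by (auto simp: space_PiM)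
    show "(\<Union>i::nat. space (PiM J (\<lambda>_. borel :: real measure))) = space (PiM J (\<lambda>_. borel))" by simp
    have "prob_space (fdd M' X' J)" unfolding fdd_def by (rule B.prob_space_distr) measurable
    then show "emeasure (fdd M' X' J) (space (PiM J (\<lambda>_. borel))) \<noteq> \<infinity>"
      by (simp add: prob_space_def finite_measure.emeasure_eq_measure)
  qed
qed

text \<open>Orthogonality to \<open>h 0 = 1\<close> fixes the integrals of all \<open>h n\<close>,
  hence those of all polynomials in their span, and determinacy concludes once these are all
  polynomials. For finite \<open>v\<close> they are not, and the data leave the law open: for
  \<open>v = 1\<close> only the constant polynomial remains, shared by every point mass. Equality of
  the supports fills this gap, since reduction modulo the polynomial vanishing there then respects
  both integrals.\<close>

lemma stationary_law_eq_if_spectral_data_eq: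
  assumes A: "spectral_process M X \<eta> h \<alpha>" and B: "spectral_process M' X' \<eta>' h \<alpha>"
    and size: "supp_size (stationary_law M' X') = supp_size (stationary_law M X)"
    and supp: "supp_size (stationary_law M X) = \<infinity> \<or> supp (stationary_law M' X') = supp (stationary_law M X)"
  shows "stationary_law M' X' = stationary_law M X"
proof -
  interpret A: spectral_process M X \<eta> h \<alpha> by (rule A)
  interpret B: spectral_process M' X' \<eta>' h \<alpha> by (rule B)
  have I: "B.basis.I = A.basis.I" by (simp add: A.basis.I_def B.basis.I_def size)
  have eq: "(\<integral>x. poly p x \<partial>B.\<mu>) = (\<integral>x. poly p x \<partial>A.\<mu>)" for p
  proof (rule A.basis.poly_induct_basis[where P="\<lambda>p. (\<integral>x. poly p x \<partial>B.\<mu>) = (\<integral>x. poly p x \<partial>A.\<mu>)"])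
    show "(\<integral>x. poly (p + q) x \<partial>B.\<mu>) = (\<integral>x. poly (p + q) x \<partial>A.\<mu>)"
      if "(\<integral>x. poly p x \<partial>B.\<mu>) = (\<integral>x. poly p x \<partial>A.\<mu>)" "(\<integral>x. poly q x \<partial>B.\<mu>) = (\<integral>x. poly q x \<partial>A.\<mu>)" for p q
      using that A.mu.poly_integrable B.mu.poly_integrable by simp
    show "(\<integral>x. poly (Polynomial.smult c p) x \<partial>B.\<mu>) = (\<integral>x. poly (Polynomial.smult c p) x \<partial>A.\<mu>)"
      if "(\<integral>x. poly p x \<partial>B.\<mu>) = (\<integral>x. poly p x \<partial>A.\<mu>)" for c p
      using that by simp
    show "(\<integral>x. poly (h n) x \<partial>B.\<mu>) = (\<integral>x. poly (h n) x \<partial>A.\<mu>)" if n: "n \<in> A.basis.I" for n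
      using A.basis.inner_h[OF n A.basis.zero_in_I] B.basis.inner_h[of n 0] n A.basis.zero_in_I
      by (simp add: I A.basis.h_0)
    show "(\<integral>x. poly q x \<partial>B.\<mu>) = (\<integral>x. poly q x \<partial>A.\<mu>)"
      if pq: "\<And>x. x \<in> supp A.\<mu> \<Longrightarrow> poly p x = poly q x" and p: "(\<integral>x. poly p x \<partial>B.\<mu>) = (\<integral>x. poly p x \<partial>A.\<mu>)" for p q
    proof (cases "finite (supp A.\<mu>)")
      case True
      then have sB: "supp B.\<mu> = supp A.\<mu>" using supp by (simp add: supp_size_def)
      have "(\<integral>x. poly q x \<partial>B.\<mu>) = (\<integral>x. poly p x \<partial>B.\<mu>)"
        using B.mu.AE_supp pq sB by (intro integral_cong_AE) auto
      moreover have "(\<integral>x. poly q x \<partial>A.\<mu>) = (\<integral>x. poly p x \<partial>A.\<mu>)"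
        using A.mu.AE_supp pq by (intro integral_cong_AE) auto
      ultimately show ?thesis using p by simp
    next
      case False
      \<comment> \<open>Polynomials that agree on an infinite set are equal, so the other law
        integrates them alike.\<close>
      have "p - q = 0"
      proof (rule ccontr)
        assume "p - q \<noteq> 0"
        then have "finite {x. poly (p - q) x = 0}" by (rule poly_roots_finite)
        then show False using False pq by (auto dest!: finite_subset[rotated, of _ "supp A.\<mu>"])
      qed
      then show ?thesis using p by simp
    qed
  qed
  have "(\<lambda>x::real. x ^ n) = poly (monom 1 n)" for n by (auto simp: poly_monom)
  then show ?thesis
    using A.determinate B.mu.prob_space_axioms B.mu.power_integrable eq
    unfolding moment_determinate_def by auto
qed

text \<open>Normalising the monic polynomials keeps the eigenvalue relation, as scalars pass through
  conditional expectations. A polynomial of degree below \<open>v\<close> with norm zero would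
  vanish identically, so the norms are positive; \<open>p 0 = 1\<close> has norm one under a
  probability law.\<close>

lemma (in rsmpr_process) exists_spectral_data: "\<exists>h \<alpha>. spectral_data M X h \<alpha>"
proof -
  obtain p :: "nat \<Rightarrow> real poly" and \<alpha> where
    p: "\<And>n. enat n < supp_size \<mu> \<Longrightarrow> degree (p n) = n \<and> lead_coeff (p n) = 1"
    and eig: "eigen_regression M X p \<alpha>"
    and orth: "\<And>m n. enat m < supp_size \<mu> \<Longrightarrow> enat n < supp_size \<mu> \<Longrightarrow> m \<noteq> n \<Longrightarrow> (\<integral>x. poly (p m) x * poly (p n) x \<partial>\<mu>) = 0"
    using regular by blast
  define c where "c n = 1 / L2_norm \<mu> (poly (p n))" for n
  define h where "h n = Polynomial.smult (c n) (p n)" for n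
  have norm_pos: "0 < L2_norm \<mu> (poly (p n))" if n: "enat n < supp_size \<mu>" for n
  proof (rule ccontr)
    assume "\<not> 0 < L2_norm \<mu> (poly (p n))"
    then have "L2_norm \<mu> (poly (p n)) = 0" using L2_norm_nonneg[of \<mu> "poly (p n)"] by linarith
    then have "AE x in \<mu>. poly (p n) x = 0" using L2_norm_zero_iff[OF mu.poly_L2] by blast
    then have "p n = 0" using p[OF n] n by (intro mu.AE_poly_zero_imp_zero) auto
    then show False using p[OF n] by simp
  qed
  have p0: "p 0 = 1"
  proof -
    have "enat 0 < supp_size \<mu>" using mu.supp_size_pos by (simp add: zero_enat_def)
    from p[OF this] show ?thesis by (auto elim!: degree_eq_zeroE simp: one_pCons)
  qed
  have "h 0 = 1" using p0 mu.prob_space by (simp add: h_def c_def L2_norm_def)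
  moreover have "degree (h n) = n" if "enat n < supp_size \<mu>" for n
    using p[OF that] norm_pos[OF that] by (simp add: h_def c_def)
  moreover have "(\<integral>x. poly (h m) x * poly (h n) x \<partial>\<mu>) = (if m = n then 1 else 0)"
    if mn: "enat m < supp_size \<mu>" "enat n < supp_size \<mu>" for m n
  proof -
    have "(\<integral>x. poly (h m) x * poly (h n) x \<partial>\<mu>) = (\<integral>x. (c m * c n) * (poly (p m) x * poly (p n) x) \<partial>\<mu>)"
      by (intro Bochner_Integration.integral_cong) (simp_all add: h_def mult_ac)
    also have "\<dots> = (c m * c n) * (\<integral>x. poly (p m) x * poly (p n) x \<partial>\<mu>)" by simp
    also have "\<dots> = (if m = n then 1 else 0)"
      using orth[OF mn] norm_pos[OF mn(1)] L2_norm_power2[of \<mu> "poly (p m)"]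
      by (auto simp: c_def power2_eq_square field_simps)
    finally show ?thesis .
  qed
  ultimately have "orthonormal_polys \<mu> h" by (simp add: orthonormal_polys_def)
  moreover have "eigen_regression M X h \<alpha>"
    unfolding eigen_regression_def
  proof (intro conjI allI impI)
    show "\<alpha> 0 = 0" using eig by (simp add: eigen_regression_def)
    fix n and s t :: real assume nst: "enat n < supp_size \<mu> \<and> s < t"
    interpret P: sigma_finite_subalgebra M "past M X s" by (rule finite_subalgebra[OF subalgebra_past])
    have "integrable M (\<lambda>\<omega>. poly (p n) (X t \<omega>))"
      using integrable_law_iff[of "poly (p n)" t] mu.poly_integrable by simp
    then have "AE \<omega> in M. real_cond_exp M (past M X s) (\<lambda>\<omega>. c n * poly (p n) (X t \<omega>)) \<omega>
        = c n * real_cond_exp M (past M X s) (\<lambda>\<omega>. poly (p n) (X t \<omega>)) \<omega>"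
      by (rule P.real_cond_exp_cmult)
    moreover have "AE \<omega> in M. real_cond_exp M (past M X s) (\<lambda>\<omega>. poly (p n) (X t \<omega>)) \<omega>
        = exp (- \<alpha> n * (t - s)) * poly (p n) (X s \<omega>)"
      using eig nst unfolding eigen_regression_def by blast
    ultimately show "AE \<omega> in M. real_cond_exp M (past M X s) (\<lambda>\<omega>. poly (h n) (X t \<omega>)) \<omega>
        = exp (- \<alpha> n * (t - s)) * poly (h n) (X s \<omega>)"
      by eventually_elim (simp add: h_def)
  qed
  ultimately show ?thesis by (auto simp: spectral_data_def)
qed

text \<open>The density assumptions stand inside the almost-everywhere statement, so the expansion
  is asserted at each \<open>y\<close> outside a null set at which they hold. \<open>M'\<close> has
  a sample space of its own type, since a process with the same data may live on another probability
  space.\<close>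

theorem theorem1:
  fixes M :: "'a measure" and X :: "real \<Rightarrow> 'a \<Rightarrow> real"
    and \<eta> :: "real \<Rightarrow> real \<Rightarrow> real measure"
    and \<mu> :: "real measure" and v :: enat
  assumes rsmpr: "rsmpr_process M X \<eta>"
    and \<mu>: "\<mu> = stationary_law M X"
    and v: "v = supp_size \<mu>"
  shows
    "\<exists>(h :: nat \<Rightarrow> real poly) (\<alpha> :: nat \<Rightarrow> real)
      (U :: real \<Rightarrow> (real \<Rightarrow> real) \<Rightarrow> real \<Rightarrow> real) (A :: (real \<Rightarrow> real) \<Rightarrow> real \<Rightarrow> real).
      spectral_data M X h \<alpha>
    \<and> (\<forall>n. 1 \<le> n \<and> enat n < v \<longrightarrow> 0 \<le> \<alpha> n
         \<and> ((\<exists>s t. \<not> (AE \<omega> in M. poly (h n) (X t \<omega>) = poly (h n) (X s \<omega>))) \<longrightarrow> 0 < \<alpha> n))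
    \<and> (2 < v \<longrightarrow> 0 < \<alpha> 1)
    \<and> (\<forall>n. 1 \<le> n \<and> enat n < v \<longrightarrow>
         martingale M (past M X) (\<lambda>t \<omega>. exp (\<alpha> n * t) * poly (h n) (X t \<omega>)))
    \<and> (\<forall>m n s t. 1 \<le> m \<and> enat m < v \<and> 1 \<le> n \<and> enat n < v \<and> m \<noteq> n \<longrightarrow>
         (\<integral>\<omega>. (exp (\<alpha> m * s) * poly (h m) (X s \<omega>)) * (exp (\<alpha> n * t) * poly (h n) (X t \<omega>)) \<partial>M) = 0)
    \<and> (\<forall>f\<in>L2 \<mu>. \<exists>c. has_expansion \<mu> h c f)
    \<and> U 0 = id
    \<and> (\<forall>t\<ge>0. \<forall>f c. has_expansion \<mu> h c f \<longrightarrow>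
         has_expansion \<mu> h (\<lambda>n. exp (- \<alpha> n * t) * c n) (U t f))
    \<and> strongly_continuous_semigroup \<mu> U
    \<and> (\<forall>f\<in>L2 \<mu>. \<forall>t\<ge>0. cond_exp_given M (\<lambda>\<omega>. f (X t \<omega>)) (X 0) (U t f))
    \<and> (\<forall>f\<in>spectral_domain \<mu> h \<alpha>. \<forall>c. has_expansion \<mu> h c f \<longrightarrow>
         has_expansion \<mu> h (\<lambda>n. - (\<alpha> n * c n)) (A f))
    \<and> is_generator \<mu> U (spectral_domain \<mu> h \<alpha>) A
    \<and> (\<forall>(M' :: 'b measure) X' \<eta>'.
         rsmpr_process M' X' \<eta>' \<and> spectral_data M' X' h \<alpha>
       \<and> supp_size (stationary_law M' X') = v
       \<and> (v = \<infinity> \<or> supp (stationary_law M' X') = supp \<mu>) \<longrightarrow>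
         (\<forall>J. finite J \<longrightarrow> fdd M' X' J = fdd M X J))
    \<and> (\<forall>t>0. AE y in \<mu>.
         absolutely_continuous \<mu> (\<eta> y t) \<and> (\<integral>\<^sup>+x. (RN_deriv \<mu> (\<eta> y t) x)\<^sup>2 \<partial>\<mu>) < \<infinity> \<longrightarrow>
         has_expansion \<mu> h (\<lambda>n. exp (- \<alpha> n * t) * poly (h n) y)
           (\<lambda>x. enn2real (RN_deriv \<mu> (\<eta> y t) x)))"
proof -
  interpret R: rsmpr_process M X \<eta> by (rule rsmpr)
  obtain h \<alpha> where sd: "spectral_data M X h \<alpha>" using R.exists_spectral_data by blast
  have sp: "spectral_process M X \<eta> h \<alpha>"
    using sd by (intro spectral_process.intro spectral_process_axioms.intro R.smpr_process_axioms)
  interpret S: spectral_process M X \<eta> h \<alpha> by (rule sp)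
  have I: "n \<in> S.basis.I \<longleftrightarrow> enat n < v" for n by (simp add: S.basis.I_def v \<mu>)
  have L2S: "f \<in> L2 (stationary_law M X) \<Longrightarrow> \<exists>c. has_expansion (stationary_law M X) h c f" for f
    using S.basis.has_expansion_self by blast
  have fdd: "fdd M' X' J = fdd M X J"
    if "rsmpr_process M' X' \<eta>'" "spectral_data M' X' h \<alpha>" "supp_size (stationary_law M' X') = v"
      "v = \<infinity> \<or> supp (stationary_law M' X') = supp \<mu>" "finite J"
    for M' :: "'b measure" and X' \<eta>' J
  proof -
    have sp': "spectral_process M' X' \<eta>' h \<alpha>"
      using that(1,2) by (intro spectral_process.intro spectral_process_axioms.intro) (auto simp: rsmpr_process_def)
    show ?thesis
      using that by (intro fdd_eq_if_spectral_data_eq[OF sp sp'] stationary_law_eq_if_spectral_data_eq[OF sp sp'])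
        (auto simp: v \<mu>)
  qed
  show ?thesis
    unfolding \<mu>
    apply (rule exI[of _ h], rule exI[of _ \<alpha>], rule exI[of _ S.U], rule exI[of _ S.semigroup.A])
    apply (intro conjI)
    subgoal by (rule sd)
    subgoal using S.\<alpha>_nonneg S.\<alpha>_pos by (auto simp: I)
    subgoal using S.\<alpha>_1_pos by (simp add: v \<mu>)
    subgoal using S.martingale_h by (simp add: I)
    subgoal using S.martingales_orthogonal by (simp add: I)
    subgoal using L2S by blast
    subgoal by (simp add: S.U_def)
    subgoal using S.semigroup.U_expansion by blast
    subgoal by (rule S.semigroup.strongly_continuous)
    subgoal using S.cond_exp_given_U by blast
    subgoal using S.semigroup.A_expansion' by blast
    subgoal by (rule S.semigroup.generator)
    subgoal using fdd unfolding \<mu> by blast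
    subgoal using S.density_expansion by blast
    done
qed

end
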